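(* Every tuple in the Urysohn space $\mathbb{U}$ is homogeneously isolated. In particular, every homomorphism $\Phi:\mathrm{Iso}(\mathbb{U})\to K$ into a separable topological group $K$ with a left-invariant, complete (compatible) metric is trivial.
   Context: The Urysohn space $\mathbb{U}$ is the unique, up to isometry, Polish metric space that is universal (every Polish metric space embeds isometrically into it) and homogeneous (every isometry between finite subspaces extends to an isometry of the whole space onto itself). It is viewed as the structure $(\mathbb{U},d)$ in the language having only the metric $d$; its substructures are its subspaces, its automorphisms are its surjective isometries, and $\mathrm{Aut}(\mathbb{U})=\mathrm{Iso}(\mathbb{U})$ (with the topology of pointwise convergence). Tuples are finite. The quantifier-free type $\mathrm{qftp}(\bar a)$ of a tuple $\bar a$ is the set of quantifier-free formulas it satisfies, where formulas may use real numbers as constants (e.g. $d(x,y)=r$); for $p=\mathrm{qftp}(\bar a)$ and $Y\subseteq\mathbb{U}$, $p(Y)$ is the set of tuples of elements of $Y$ realizing $p$. A metric structure is homogeneous if every partial isomorphism between its finitely generated substructures extends to an automorphism of it. $S_\infty$ is the group of all permutations of $\mathbb{N}$. A tuple $\bar a$ in a homogeneous metric structure $X$, with $p=\mathrm{qftp}(\bar a)$ and $G=\mathrm{Aut}(X)$, is homogeneously isolated if there exist $X_k\subseteq X$ and $\bar a_k\in p(X_k)$, $k\in\mathbb{N}$, such that: (1) each $X_k$ is a homogeneous substructure of $X$; (2) for all $\phi_l\in\mathrm{Aut}(X_l)$, $l\in\mathbb{N}$, there exists $\phi\in\mathrm{Aut}(X)$ that extends each $\phi_l$; (3) there exists an injective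 group homomorphism $e:S_\infty\to G$ such that for every $\sigma\in S_\infty$ and $k,l\in\mathbb{N}$, $\sigma(k)=l\Leftrightarrow e(\sigma)[X_k]=X_l$. *)

theory Defs
  imports "HOL-Analysis.Analysis" "HOL-Algebra.Bij"
begin

subsection \<open>Polish metric spaces, isometries and the Urysohn space\<close>

definition polish_metric :: "'a metric \<Rightarrow> bool" where
  "polish_metric m \<longleftrightarrow> mcomplete_of m \<and> separable_space (mtopology_of m)"

definition isometric_embedding :: "'a metric \<Rightarrow> 'b metric \<Rightarrow> ('a \<Rightarrow> 'b) \<Rightarrow> bool" where
  "isometric_embedding m n f \<longleftrightarrow>
     f \<in> mspace m \<rightarrow> mspace n \<and>
     (\<forall>x\<in>mspace m. \<forall>y\<in>mspace m. mdist n (f x) (f y) = mdist m x y)"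

definition surj_isometry :: "'a metric \<Rightarrow> 'b metric \<Rightarrow> ('a \<Rightarrow> 'b) \<Rightarrow> bool" where
  "surj_isometry m n f \<longleftrightarrow> isometric_embedding m n f \<and> f ` mspace m = mspace n"

text \<open>In the language of the metric alone, substructures are arbitrary subspaces, and the finitely
  generated ones are the finite ones.\<close>

definition homogeneous_metric :: "'a metric \<Rightarrow> bool" where
  "homogeneous_metric m \<longleftrightarrow>
     (\<forall>A B f. finite A \<and> A \<subseteq> mspace m \<and> finite B \<and> B \<subseteq> mspace m \<and>
        surj_isometry (submetric m A) (submetric m B) f \<longrightarrow>
        (\<exists>g. surj_isometry m m g \<and> (\<forall>x\<in>A. g x = f x)))"

text \<open>HOL cannot quantify over types inside a definition, so universality is stated for all Polish
  metric spaces whose points are real sequences. By the lemma \<open>universal_metric_embeds\<close> below, this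
  already gives it for Polish metric spaces over an arbitrary type.\<close>

definition universal_metric :: "'a metric \<Rightarrow> bool" where
  "universal_metric m \<longleftrightarrow>
     (\<forall>P :: (nat \<Rightarrow> real) metric. polish_metric P \<longrightarrow> (\<exists>f. isometric_embedding P m f))"

definition urysohn_space :: "'a metric \<Rightarrow> bool" where
  "urysohn_space m \<longleftrightarrow> polish_metric m \<and> universal_metric m \<and> homogeneous_metric m"

text \<open>As with \<^const>\<open>Bij\<close>, only extensional functions are allowed, so that an isometry is determined
  by its values on the space.\<close>

definition Iso :: "'a metric \<Rightarrow> ('a \<Rightarrow> 'a) set" where
  "Iso m = {f \<in> Bij (mspace m). surj_isometry m m f}"

definition IsoGroup :: "'a metric \<Rightarrow> ('a \<Rightarrow> 'a) monoid" where
  "IsoGroup m = (BijGroup (mspace m))\<lparr>carrier := Iso m\<rparr>"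

subsection \<open>Quantifier-free types\<close>

text \<open>Formulas are two-sorted (points and reals); the point variable \<open>i\<close> refers to the \<open>i\<close>-th entry
  of a tuple, and tuples are lists.\<close>

datatype real_term = Const real | Dist nat nat

datatype qf_formula =
    PointEq nat nat
  | RealEq real_term real_term
  | Neg qf_formula
  | Conj qf_formula qf_formula
  | Disj qf_formula qf_formula

primrec real_term_vars :: "real_term \<Rightarrow> nat set" where
  "real_term_vars (Const r) = {}"
| "real_term_vars (Dist i j) = {i, j}"

primrec qf_vars :: "qf_formula \<Rightarrow> nat set" where
  "qf_vars (PointEq i j) = {i, j}"
| "qf_vars (RealEq s t) = real_term_vars s \<union> real_term_vars t"
| "qf_vars (Neg \<phi>) = qf_vars \<phi>"
| "qf_vars (Conj \<phi> \<psi>) = qf_vars \<phi> \<union> qf_vars \<psi>"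
| "qf_vars (Disj \<phi> \<psi>) = qf_vars \<phi> \<union> qf_vars \<psi>"

primrec real_term_val :: "'a metric \<Rightarrow> 'a list \<Rightarrow> real_term \<Rightarrow> real" where
  "real_term_val m a (Const r) = r"
| "real_term_val m a (Dist i j) = mdist m (a ! i) (a ! j)"

primrec qf_sat :: "'a metric \<Rightarrow> 'a list \<Rightarrow> qf_formula \<Rightarrow> bool" where
  "qf_sat m a (PointEq i j) \<longleftrightarrow> a ! i = a ! j"
| "qf_sat m a (RealEq s t) \<longleftrightarrow> real_term_val m a s = real_term_val m a t"
| "qf_sat m a (Neg \<phi>) \<longleftrightarrow> \<not> qf_sat m a \<phi>"
| "qf_sat m a (Conj \<phi> \<psi>) \<longleftrightarrow> qf_sat m a \<phi> \<and> qf_sat m a \<psi>"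
| "qf_sat m a (Disj \<phi> \<psi>) \<longleftrightarrow> qf_sat m a \<phi> \<or> qf_sat m a \<psi>"

definition qftp :: "'a metric \<Rightarrow> 'a list \<Rightarrow> qf_formula set" where
  "qftp m a = {\<phi>. qf_vars \<phi> \<subseteq> {..<length a} \<and> qf_sat m a \<phi>}"

text \<open>The arity \<open>n\<close> is a separate argument because a set of formulas does not record it.\<close>

definition realizations :: "'a metric \<Rightarrow> nat \<Rightarrow> qf_formula set \<Rightarrow> 'a set \<Rightarrow> 'a list set" where
  "realizations m n p Y = {b. length b = n \<and> set b \<subseteq> Y \<and> (\<forall>\<phi>\<in>p. qf_sat m b \<phi>)}"

subsection \<open>Homogeneously isolated tuples\<close>

definition homogeneously_isolated :: "'a metric \<Rightarrow> 'a list \<Rightarrow> bool" where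
  "homogeneously_isolated m a \<longleftrightarrow>
     (\<exists>(X :: nat \<Rightarrow> 'a set) (b :: nat \<Rightarrow> 'a list).
        (\<forall>k. X k \<subseteq> mspace m \<and> b k \<in> realizations m (length a) (qftp m a) (X k)) \<and>
        (\<forall>k. homogeneous_metric (submetric m (X k))) \<and>
        (\<forall>\<phi>. (\<forall>l. \<phi> l \<in> Iso (submetric m (X l))) \<longrightarrow>
              (\<exists>\<psi> \<in> Iso m. \<forall>l. \<forall>x\<in>X l. \<psi> x = \<phi> l x)) \<and>
        (\<exists>e \<in> hom (BijGroup (UNIV :: nat set)) (IsoGroup m).
           inj_on e (carrier (BijGroup (UNIV :: nat set))) \<and>
           (\<forall>\<sigma> \<in> carrier (BijGroup (UNIV :: nat set)).
              \<forall>k l. \<sigma> k = l \<longleftrightarrow> e \<sigma> ` X k = X l)))"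

subsection \<open>Topological groups\<close>

definition topological_group :: "('a, 'm) monoid_scheme \<Rightarrow> 'a topology \<Rightarrow> bool" where
  "topological_group K T \<longleftrightarrow>
     group K \<and> topspace T = carrier K \<and>
     continuous_map (prod_topology T T) T (\<lambda>(x, y). x \<otimes>\<^bsub>K\<^esub> y) \<and>
     continuous_map T T (\<lambda>x. inv\<^bsub>K\<^esub> x)"

definition left_invariant_metric :: "('a, 'm) monoid_scheme \<Rightarrow> 'a metric \<Rightarrow> bool" where
  "left_invariant_metric K \<rho> \<longleftrightarrow>
     (\<forall>g\<in>carrier K. \<forall>x\<in>carrier K. \<forall>y\<in>carrier K.
        mdist \<rho> (g \<otimes>\<^bsub>K\<^esub> x) (g \<otimes>\<^bsub>K\<^esub> y) = mdist \<rho> x y)"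

subsection \<open>Sanity checks\<close>

lemma surj_isometry_bij_betw:
  assumes "surj_isometry m n f"
  shows "bij_betw f (mspace m) (mspace n)"
proof -
  have "inj_on f (mspace m)"
  proof (rule inj_onI)
    fix x y assume xy: "x \<in> mspace m" "y \<in> mspace m" "f x = f y"
    then have "mdist n (f x) (f y) = mdist m x y" "f x \<in> mspace n"
      using assms unfolding surj_isometry_def isometric_embedding_def by blast+
    then show "x = y" using xy by (metis mdist_zero)
  qed
  then show ?thesis using assms by (simp add: bij_betw_def surj_isometry_def)
qed

lemma Iso_alt:
  "f \<in> Iso m \<longleftrightarrow> f \<in> extensional (mspace m) \<and> surj_isometry m m f"
  by (auto simp: Iso_def Bij_def dest: surj_isometry_bij_betw)

lemma subgroup_Iso: "subgroup (Iso m) (BijGroup (mspace m))"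
proof
  show "Iso m \<subseteq> carrier (BijGroup (mspace m))"
    by (auto simp: Iso_def BijGroup_def)
next
  fix g f assume gf: "g \<in> Iso m" "f \<in> Iso m"
  then have B: "g \<in> Bij (mspace m)" "f \<in> Bij (mspace m)"
    by (auto simp: Iso_def)
  have mem: "f x \<in> mspace m" if "x \<in> mspace m" for x
    using that B(2) Bij_imp_funcset by blast
  have "compose (mspace m) g f \<in> Bij (mspace m)"
    using B by (rule compose_Bij)
  moreover have "isometric_embedding m m (compose (mspace m) g f)"
    using gf mem by (auto simp: Iso_def surj_isometry_def isometric_embedding_def compose_def Pi_iff)
  ultimately have "compose (mspace m) g f \<in> Iso m"
    by (auto simp: Iso_def surj_isometry_def Bij_def bij_betw_def)
  then show "g \<otimes>\<^bsub>BijGroup (mspace m)\<^esub> f \<in> Iso m"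
    using B by (simp add: BijGroup_def)
next
  have "restrict (\<lambda>x. x) (mspace m) \<in> Bij (mspace m)" by (rule id_Bij)
  then show "\<one>\<^bsub>BijGroup (mspace m)\<^esub> \<in> Iso m"
    by (auto simp: BijGroup_def Iso_def surj_isometry_def isometric_embedding_def)
next
  fix f assume f: "f \<in> Iso m"
  then have B: "f \<in> Bij (mspace m)" by (simp add: Iso_def)
  let ?g = "restrict (inv_into (mspace m) f) (mspace m)"
  have gB: "?g \<in> Bij (mspace m)" using B by (rule restrict_inv_into_Bij)
  have im: "f ` mspace m = mspace m" using B by (auto simp: Bij_def bij_betw_def)
  have "mdist m (?g x) (?g y) = mdist m x y" if "x \<in> mspace m" "y \<in> mspace m" for x y
  proof -
    have "?g x \<in> mspace m" "?g y \<in> mspace m" "f (?g x) = x" "f (?g y) = y"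
      using that im by (auto simp: inv_into_into f_inv_into_f)
    then show ?thesis
      using f by (metis (no_types, lifting) Iso_alt isometric_embedding_def surj_isometry_def)
  qed
  then have "?g \<in> Iso m"
    using gB Bij_imp_funcset[OF gB]
    by (auto simp: Iso_def surj_isometry_def isometric_embedding_def Bij_def bij_betw_def)
  then show "inv\<^bsub>BijGroup (mspace m)\<^esub> f \<in> Iso m"
    using B by (simp add: inv_BijGroup)
qed

lemma group_IsoGroup: "group (IsoGroup m)"
  unfolding IsoGroup_def
  by (rule subgroup.subgroup_is_group[OF subgroup_Iso group_BijGroup])

lemma surj_isometry_polish:
  fixes m :: "'a metric" and n :: "'b metric"
  assumes h: "surj_isometry m n h" and m: "polish_metric m"
  shows "polish_metric n"
proof -
  interpret Metric_space12 "mspace m" "mdist m" "mspace n" "mdist n"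
    by (simp add: Metric_space12_def)
  have bij: "bij_betw h (mspace m) (mspace n)"
    using h by (rule surj_isometry_bij_betw)
  have iso: "mdist n (h x) (h y) = mdist m x y" if "x \<in> mspace m" "y \<in> mspace m" for x y
    using h that by (auto simp: surj_isometry_def isometric_embedding_def)
  have im: "h ` mspace m = mspace n"
    using h by (simp add: surj_isometry_def)
  have hom: "homeomorphic_map (mtopology_of m) (mtopology_of n) h"
    using isometry_imp_homeomorphic_map[OF im iso] by (simp add: mtopology_of_def)
  have sep: "separable_space (mtopology_of n)"
    using homeomorphic_separable_space[OF homeomorphic_map_imp_homeomorphic_space[OF hom]] m
    by (simp add: polish_metric_def)
  have cm: "M1.mcomplete"
    using m by (simp add: polish_metric_def mcomplete_of_def)
  have "M2.mcomplete"
    unfolding M2.mcomplete_def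
  proof (intro allI impI)
    fix \<sigma> assume c: "M2.MCauchy \<sigma>"
    let ?g = "inv_into (mspace m) h"
    have r: "\<sigma> i \<in> mspace n" for i
      using c by (auto simp: M2.MCauchy_def)
    have g: "?g (\<sigma> i) \<in> mspace m" "h (?g (\<sigma> i)) = \<sigma> i" for i
      using r[of i] im by (auto simp: inv_into_into f_inv_into_f)
    have d: "mdist m (?g (\<sigma> i)) (?g (\<sigma> j)) = mdist n (\<sigma> i) (\<sigma> j)" for i j
      using iso[OF g(1) g(1), of i j] by (simp add: g(2))
    have "M1.MCauchy (\<lambda>i. ?g (\<sigma> i))"
      using c g(1) unfolding M1.MCauchy_def M2.MCauchy_def by (auto simp: d)
    then obtain x where x: "limitin M1.mtopology (\<lambda>i. ?g (\<sigma> i)) x sequentially"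
      using cm by (auto simp: M1.mcomplete_def)
    then have xm: "x \<in> mspace m"
      by (simp add: M1.limitin_metric)
    have "mdist n (\<sigma> i) (h x) = mdist m (?g (\<sigma> i)) x" for i
      using iso[OF g(1) xm, of i] by (simp add: g(2))
    moreover have "h x \<in> mspace n"
      using xm im by auto
    ultimately have "limitin M2.mtopology \<sigma> (h x) sequentially"
      using x r by (simp add: M1.limitin_metric M2.limitin_metric g(1))
    then show "\<exists>y. limitin M2.mtopology \<sigma> y sequentially" by blast
  qed
  then show ?thesis
    using sep by (simp add: polish_metric_def mcomplete_of_def)
qed

lemma separable_metric_code:
  fixes P :: "'b metric"
  assumes "separable_space (mtopology_of P)"
  shows "\<exists>h :: 'b \<Rightarrow> nat \<Rightarrow> real. inj_on h (mspace P)"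
proof (cases "mspace P = {}")
  case False
  interpret PM: Metric_space "mspace P" "mdist P" by simp
  obtain C where C: "countable C" "C \<subseteq> mspace P" "PM.mtopology closure_of C = mspace P"
    using assms by (auto simp: separable_space_def mtopology_of_def)
  then have ne: "C \<noteq> {}" using False by auto
  define h where "h x = (\<lambda>n. mdist P x (from_nat_into C n))" for x
  have "inj_on h (mspace P)"
  proof (rule inj_onI, rule ccontr)
    fix x y assume xy: "x \<in> mspace P" "y \<in> mspace P" "h x = h y" "x \<noteq> y"
    have pos: "mdist P x y > 0"
      using mdist_nonneg[of P x y] mdist_zero[OF xy(1,2)] xy(4) by linarith
    have "x \<in> PM.mtopology closure_of C"
      using C(3) xy(1) by simp
    then have "\<forall>r>0. \<exists>c\<in>C. c \<in> PM.mball x r"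
      by (simp add: PM.metric_closure_of)
    then obtain c where c: "c \<in> C" "c \<in> PM.mball x (mdist P x y / 2)"
      using pos half_gt_zero by blast
    obtain n where "from_nat_into C n = c"
      using from_nat_into_surj[OF C(1) c(1)] by blast
    then have "mdist P x c = mdist P y c"
      using fun_cong[OF xy(3), of n] by (simp add: h_def)
    moreover have "mdist P x y \<le> mdist P x c + mdist P c y"
      using xy c(1) C(2) by (intro mdist_triangle) auto
    moreover have "mdist P c y = mdist P y c"
      by (rule mdist_commute)
    ultimately show False using c(2) by simp
  qed
  then show ?thesis by blast
qed auto

theorem universal_metric_embeds:
  fixes m :: "'a metric" and P :: "'b metric"
  assumes "universal_metric m" "polish_metric P"
  shows "\<exists>f. isometric_embedding P m f"
proof -
  obtain h :: "'b \<Rightarrow> nat \<Rightarrow> real" where h: "inj_on h (mspace P)"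
    using separable_metric_code assms(2) by (auto simp: polish_metric_def)
  let ?g = "inv_into (mspace P) h"
  define e where "e u v = mdist P (?g u) (?g v)" for u v
  have "Metric_space (h ` mspace P) e"
    using h by unfold_locales
      (auto simp: e_def mdist_commute mdist_triangle)
  then interpret Q: Metric_space "h ` mspace P" e .
  let ?Q = "metric (h ` mspace P, e)"
  have Q: "surj_isometry P ?Q h"
    using h by (auto simp: surj_isometry_def isometric_embedding_def e_def)
  then have "polish_metric ?Q"
    using assms(2) by (rule surj_isometry_polish)
  then obtain f where f: "isometric_embedding ?Q m f"
    using assms(1) by (auto simp: universal_metric_def)
  have "isometric_embedding P m (f \<circ> h)"
    using f h by (auto simp: isometric_embedding_def e_def)
  then show ?thesis by blast
qed

lemma realizations_qftp_iff:
  assumes "Y \<subseteq> mspace m" "set a \<subseteq> mspace m"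
  shows "b \<in> realizations m (length a) (qftp m a) Y \<longleftrightarrow>
    length b = length a \<and> set b \<subseteq> Y \<and>
    (\<forall>i<length a. \<forall>j<length a. mdist m (b ! i) (b ! j) = mdist m (a ! i) (a ! j))"
    (is "?L \<longleftrightarrow> ?R")
proof
  assume L: ?L
  have "mdist m (b ! i) (b ! j) = mdist m (a ! i) (a ! j)"
    if "i < length a" "j < length a" for i j
  proof -
    have "RealEq (Dist i j) (Const (mdist m (a ! i) (a ! j))) \<in> qftp m a"
      using that by (simp add: qftp_def)
    then show ?thesis using L by (fastforce simp: realizations_def)
  qed
  then show ?R using L by (simp add: realizations_def)
next
  assume R: ?R
  have pt: "b ! i = b ! j \<longleftrightarrow> a ! i = a ! j" if "i < length a" "j < length a" for i j
  proof -
    have "a ! i \<in> mspace m" "a ! j \<in> mspace m" "b ! i \<in> mspace m" "b ! j \<in> mspace m"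
      using that R assms by (metis nth_mem subset_iff)+
    then show ?thesis using that R by (metis mdist_zero)
  qed
  have tm: "real_term_val m b s = real_term_val m a s"
    if "real_term_vars s \<subseteq> {..<length a}" for s
    using that R by (cases s) auto
  have "qf_sat m b \<phi> \<longleftrightarrow> qf_sat m a \<phi>" if "qf_vars \<phi> \<subseteq> {..<length a}" for \<phi>
    using that by (induction \<phi>) (auto simp: pt tm)
  then show ?L using R by (simp add: realizations_def qftp_def)
qed

end

theory Submission
  imports Defs "HOL-Library.FSet"
begin

text \<open>
Both halves of the theorem rest on one construction: a countable metric space of terms on which
the permutations of the labels, and the isometries of a given countable space, act by substitution.

\<^emph>\<open>Rational skeletons.\<close> By a closing-off argument (\<open>dense_rational_subspace\<close>), any countable
subset of the Urysohn space \<open>U\<close> and any isometry \<open>g\<close> of \<open>U\<close> can be captured by a countable dense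
subspace \<open>Y\<close> with \<open>g ` Y = Y\<close>, whose distances lie in a countable additive subgroup \<open>Q\<close> of the
reals and in which every distance prescription over a finite subset with values in \<open>Q\<close> that obeys
the triangle inequality is realized.

\<^emph>\<open>Generic isometries.\<close> Call an isometry of \<open>Y\<close> generic if all its orbits are finite, it has a fixed
point, and over every finite invariant set it realizes every conceivable configuration of a cycle.
A back-and-forth argument shows that any two generic isometries are isomorphic, even as isometries
of two different spaces over the same \<open>Q\<close> (\<open>generic_isometries_isomorphic\<close>). They are plentiful:
for each isometry \<open>g\<close> of \<open>Y\<close> there is an \<open>f\<close> such that both \<open>f\<close> and \<open>g \<circ> f\<close> are generic
(\<open>generic_isometry_pair\<close>). The density that this requires is the extension property for one
partial isometry of a finite metric space: it extends to an isometry of a larger finite metric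
space (\<open>partial_isometry_extends_to_finite_isometry\<close>).

\<^emph>\<open>Terms.\<close> Over a countable space \<open>Z\<close>, adjoin formally all configurations of finitely many new points,
the new points carrying labels. The resulting space of terms contains \<open>Z\<close>, isometries of \<open>Z\<close> and
permutations of the labels act on it compatibly with composition (\<open>term_action\<close>), and a label
permutation with finite cycles of every length acts as a generic isometry (\<open>generic_term_map\<close>). Hence the
space of terms is isometric to the skeleton \<open>Y\<close>, and these actions extend by continuity to \<open>U\<close>.

\<^emph>\<open>Triviality of homomorphisms.\<close> A homomorphism from the symmetric group of the natural numbers into a
separable group with a complete left-invariant metric kills every involution that moves infinitely
many points and fixes infinitely many points (\<open>kills_moiety_involutions\<close>), and therefore it kills
a product of two such involutions that has finite cycles of every length. Since a generic isometry is
isomorphic to the action of that product on terms, a homomorphism \<open>\<Phi>\<close> on \<open>Iso U\<close> kills the extension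
of every generic isometry, in particular of \<open>f\<close> and \<open>g \<circ> f\<close>, and so it kills \<open>g\<close>.

\<^emph>\<open>Isolation of tuples.\<close> Given a tuple, choose a point \<open>p\<close> at the same distance \<open>R\<close> from all its entries
and a countable homogeneous subset \<open>A\<close> of the sphere of radius \<open>R\<close> about \<open>p\<close> that contains the tuple. Any
two points of \<open>A\<close> are at distance at most \<open>2 * R\<close>, so countably many copies of \<open>A\<close> can be placed at
mutual distance \<open>R\<close>. Taking their union for \<open>Z\<close>, both the isometries of the single copies and the
permutations of the copies are isometries of \<open>Z\<close>, so that they act on terms and hence on \<open>U\<close>.
\<close>

section \<open>Homomorphisms from the symmetric group\<close>

text \<open>The support of such an involution is a moiety of \<open>X\<close>: an infinite subset with infinite
complement in \<open>X\<close>.\<close>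

definition moiety_involution :: "nat set \<Rightarrow> (nat \<Rightarrow> nat) \<Rightarrow> bool" where
  "moiety_involution X \<tau> \<longleftrightarrow>
     (\<forall>x. \<tau> (\<tau> x) = x) \<and> (\<forall>x. x \<notin> X \<longrightarrow> \<tau> x = x) \<and>
     infinite {x. \<tau> x \<noteq> x} \<and> infinite {x \<in> X. \<tau> x = x}"

lemma moiety_involution_bij: "moiety_involution X \<tau> \<Longrightarrow> bij \<tau>"
  by (rule involuntory_imp_bij) (simp add: moiety_involution_def)

lemma moiety_involution_mono:
  "moiety_involution X \<tau> \<Longrightarrow> X \<subseteq> Y \<Longrightarrow> moiety_involution Y \<tau>"
  using infinite_super[of "{x \<in> X. \<tau> x = x}" "{x \<in> Y. \<tau> x = x}"]
  by (auto simp: moiety_involution_def)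

lemma infinite_nat_bij_betw:
  fixes A B :: "nat set"
  assumes "infinite A" "infinite B"
  shows "\<exists>f. bij_betw f A B"
  using bij_betw_trans[OF bij_betw_inv_into[OF bij_enumerate[OF assms(1)]] bij_enumerate[OF assms(2)]]
  by blast

text \<open>Both involutions have infinitely many 2-cycles and infinitely many fixed points in \<open>X\<close>. Matching the
smaller entries of the 2-cycles, and separately the fixed points in \<open>X\<close>, gives a conjugating permutation;
it can be taken to be the identity outside \<open>X\<close>.\<close>

lemma moiety_involutions_conjugate:
  assumes a: "moiety_involution X \<alpha>" and b: "moiety_involution X \<beta>"
  shows "\<exists>\<phi>. bij \<phi> \<and> (\<forall>x. x \<notin> X \<longrightarrow> \<phi> x = x) \<and> \<phi> \<circ> \<alpha> = \<beta> \<circ> \<phi>"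
proof -
  have half: "infinite {x. x < \<tau> x}" if t: "moiety_involution X \<tau>" for \<tau>
  proof
    assume f: "finite {x. x < \<tau> x}"
    have "{x. \<tau> x \<noteq> x} \<subseteq> {x. x < \<tau> x} \<union> \<tau> ` {x. x < \<tau> x}"
    proof
      fix x assume "x \<in> {x. \<tau> x \<noteq> x}"
      then have "x < \<tau> x \<or> \<tau> x < \<tau> (\<tau> x) \<and> x = \<tau> (\<tau> x)"
        using t by (auto simp: moiety_involution_def)
      then show "x \<in> {x. x < \<tau> x} \<union> \<tau> ` {x. x < \<tau> x}" by blast
    qed
    then have "finite {x. \<tau> x \<noteq> x}" using f by (auto intro: finite_subset)
    then show False using t by (simp add: moiety_involution_def)
  qed
  obtain f where f: "bij_betw f {x. x < \<alpha> x} {x. x < \<beta> x}"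
    using infinite_nat_bij_betw half a b by blast
  obtain h where h: "bij_betw h {x\<in>X. \<alpha> x = x} {x\<in>X. \<beta> x = x}"
    using infinite_nat_bij_betw[of "{x\<in>X. \<alpha> x = x}" "{x\<in>X. \<beta> x = x}"] a b
    by (auto simp: moiety_involution_def)
  have aa: "\<alpha> (\<alpha> x) = x" "\<beta> (\<beta> x) = x" for x using a b by (auto simp: moiety_involution_def)
  have ax: "\<alpha> x = x" "\<beta> x = x" if "x \<notin> X" for x using a b that by (auto simp: moiety_involution_def)
  (* The same recipe serves for the conjugating map and, with f and h inverted and the two
     involutions exchanged, for its inverse. *)
  define mk where "mk f h \<alpha> \<beta> x = (if x < \<alpha> x then f x else if \<alpha> x < x then \<beta> (f (\<alpha> x)) else if x \<in> X then h x else x)"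
    for f h \<alpha> \<beta> and x :: nat
  define \<phi> where "\<phi> = mk f h \<alpha> \<beta>"
  define f' where "f' = inv_into {x. x < \<alpha> x} f"
  define h' where "h' = inv_into {x\<in>X. \<alpha> x = x} h"
  define \<psi> where "\<psi> = mk f' h' \<beta> \<alpha>"
  have f1: "f x < \<beta> (f x)" "f' (f x) = x" if "x < \<alpha> x" for x
    using f that by (auto simp: f'_def bij_betw_def)
  have f2: "f' x < \<alpha> (f' x)" "f (f' x) = x" if "x < \<beta> x" for x
    using bij_betw_inv_into[OF f] f that by (auto simp: f'_def bij_betw_def f_inv_into_f)
  have h1: "h x \<in> X" "\<beta> (h x) = h x" "h' (h x) = x" if "x \<in> X" "\<alpha> x = x" for x
    using h that by (auto simp: h'_def bij_betw_def)
  have h2: "h' x \<in> X" "\<alpha> (h' x) = h' x" "h (h' x) = x" if "x \<in> X" "\<beta> x = x" for x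
    using bij_betw_inv_into[OF h] h that by (auto simp: h'_def bij_betw_def f_inv_into_f)
  have "\<psi> (\<phi> x) = x" for x
  proof (cases x "\<alpha> x" rule: linorder_cases)
    case less
    then show ?thesis by (simp add: \<phi>_def \<psi>_def mk_def f1)
  next
    case greater
    then have "\<alpha> x < \<alpha> (\<alpha> x)" by (simp add: aa)
    from f1[OF this] greater show ?thesis by (simp add: \<phi>_def \<psi>_def mk_def aa)
  next
    case equal
    then show ?thesis using h1[of x] ax by (auto simp: \<phi>_def \<psi>_def mk_def)
  qed
  moreover have "\<phi> (\<psi> x) = x" for x
  proof (cases x "\<beta> x" rule: linorder_cases)
    case less
    then show ?thesis by (simp add: \<phi>_def \<psi>_def mk_def f2)
  next
    case greater
    then have "\<beta> x < \<beta> (\<beta> x)" by (simp add: aa)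
    from f2[OF this] greater show ?thesis by (simp add: \<phi>_def \<psi>_def mk_def aa)
  next
    case equal
    then show ?thesis using h2[of x] ax by (auto simp: \<phi>_def \<psi>_def mk_def)
  qed
  ultimately have "bij \<phi>" by (intro o_bij[of \<psi>]) auto
  moreover have "\<phi> (\<alpha> x) = \<beta> (\<phi> x)" for x
  proof (cases x "\<alpha> x" rule: linorder_cases)
    case less
    then show ?thesis by (simp add: \<phi>_def mk_def aa)
  next
    case greater
    then show ?thesis by (simp add: \<phi>_def mk_def aa)
  next
    case equal
    then show ?thesis using h1[of x] ax by (auto simp: \<phi>_def mk_def)
  qed
  ultimately show ?thesis using ax by (intro exI[of _ \<phi>]) (auto simp: \<phi>_def mk_def)
qed

abbreviation pinv :: "(nat \<Rightarrow> nat) \<Rightarrow> nat \<Rightarrow> nat" where "pinv f \<equiv> inv_into UNIV f"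

text \<open>No continuity is assumed of \<open>\<Psi>\<close>: everything below comes from separability, completeness and
diagonal arguments inside the symmetric group.\<close>

locale perm_hom =
  fixes K :: "('b, 'm) monoid_scheme" and \<rho> :: "'b metric" and \<Psi> :: "(nat \<Rightarrow> nat) \<Rightarrow> 'b"
  assumes K: "group K" and sp: "mspace \<rho> = carrier K"
    and complete: "mcomplete_of \<rho>" and separable: "separable_space (mtopology_of \<rho>)"
    and left_inv: "left_invariant_metric K \<rho>"
    and closed: "\<And>f. bij f \<Longrightarrow> \<Psi> f \<in> carrier K"
    and hom: "\<And>f g. bij f \<Longrightarrow> bij g \<Longrightarrow> \<Psi> (f \<circ> g) = \<Psi> f \<otimes>\<^bsub>K\<^esub> \<Psi> g"
begin

interpretation K: group K by (rule K)

text \<open>By left invariance this length determines all distances between values of \<open>\<Psi>\<close>; it is subadditive and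
invariant under inversion.\<close>

definition len :: "(nat \<Rightarrow> nat) \<Rightarrow> real" where "len f = mdist \<rho> \<one>\<^bsub>K\<^esub> (\<Psi> f)"

lemma Psi_id: "\<Psi> id = \<one>\<^bsub>K\<^esub>"
  using hom[of id id] closed[of id] K.l_cancel_one'[of "\<Psi> id" "\<Psi> id"] by simp

lemma Psi_inv: "bij f \<Longrightarrow> \<Psi> (pinv f) = inv\<^bsub>K\<^esub> \<Psi> f"
  using hom[of "pinv f" f] closed[of f] closed[of "pinv f"] Psi_id
  by (simp add: K.inv_equality[symmetric] bij_imp_bij_inv bij_is_inj)

lemma dist_left:
  "\<lbrakk>g \<in> carrier K; x \<in> carrier K; y \<in> carrier K\<rbrakk> \<Longrightarrow>
    mdist \<rho> (g \<otimes>\<^bsub>K\<^esub> x) (g \<otimes>\<^bsub>K\<^esub> y) = mdist \<rho> x y"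
  using left_inv by (simp add: left_invariant_metric_def)

lemma dist_Psi_comp: "bij f \<Longrightarrow> bij g \<Longrightarrow> mdist \<rho> (\<Psi> f) (\<Psi> (f \<circ> g)) = len g"
  using dist_left[of "\<Psi> f" "\<one>\<^bsub>K\<^esub>" "\<Psi> g"] by (simp add: closed hom len_def)

lemma len_comp: "bij f \<Longrightarrow> bij g \<Longrightarrow> len (f \<circ> g) \<le> len f + len g"
  using mdist_triangle[of "\<one>\<^bsub>K\<^esub>" \<rho> "\<Psi> f" "\<Psi> (f \<circ> g)"] dist_Psi_comp[of f g]
  by (simp add: sp closed bij_comp len_def)

lemma len_inv: "bij f \<Longrightarrow> len (pinv f) = len f"
  using dist_left[of "\<Psi> f" "\<one>\<^bsub>K\<^esub>" "\<Psi> (pinv f)"]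
  by (simp add: len_def Psi_inv closed mdist_commute)

text \<open>A separable group is covered by countably many left translates of any ball about the identity. The
translates are taken at values of \<open>\<Psi>\<close>, which makes the conclusion one about permutations only.\<close>

lemma countable_cover:
  assumes "e > 0"
  shows "\<exists>c :: nat \<Rightarrow> nat \<Rightarrow> nat. (\<forall>n. bij (c n)) \<and> (\<forall>f. bij f \<longrightarrow> (\<exists>n. len (pinv (c n) \<circ> f) < e))"
proof -
  interpret M: Metric_space "mspace \<rho>" "mdist \<rho>" by simp
  obtain D where D: "countable D" "D \<subseteq> mspace \<rho>" "M.mtopology closure_of D = mspace \<rho>"
    using separable by (auto simp: separable_space_def mtopology_of_def)
  define P where "P x f \<longleftrightarrow> bij f \<and> mdist \<rho> (\<Psi> f) x < e / 2" for x f
  define c where "c x = (if \<exists>f. P x f then SOME f. P x f else id)" for x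
  have bc: "bij (c x)" for x
    using someI_ex[of "P x"] by (auto simp: c_def P_def)
  have "D \<noteq> {}" using D(3) sp by auto
  have "\<exists>n. len (pinv (c (from_nat_into D n)) \<circ> f) < e" if f: "bij f" for f
  proof -
    have "\<Psi> f \<in> M.mtopology closure_of D" using D(3) closed[OF f] sp by simp
    then obtain x where x: "x \<in> D" "mdist \<rho> (\<Psi> f) x < e / 2"
      using half_gt_zero[OF assms] unfolding M.metric_closure_of M.in_mball by blast
    then have "P x f" using f by (simp add: P_def)
    then have "P x (c x)" using someI[of "P x" f] by (auto simp: c_def)
    then have "mdist \<rho> (\<Psi> (c x)) (\<Psi> f) < e"
      using x mdist_triangle[of "\<Psi> (c x)" \<rho> x "\<Psi> f"] closed[OF f] closed[OF bc, of x] D(2) sp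
        mdist_commute[of \<rho> x "\<Psi> f"] by (auto simp: P_def)
    moreover have "c x \<circ> (pinv (c x) \<circ> f) = f"
      by (metis bc bij_is_surj comp_assoc id_comp surj_iff)
    ultimately have "len (pinv (c x) \<circ> f) < e"
      using dist_Psi_comp[of "c x" "pinv (c x) \<circ> f"] bc f by (simp add: bij_imp_bij_inv bij_comp)
    then show ?thesis using from_nat_into_surj[OF D(1) x(1)] by metis
  qed
  then show ?thesis using bc by (intro exI[of _ "\<lambda>n. c (from_nat_into D n)"]) blast
qed

lemma len_diff_less:
  assumes "bij c" "bij f" "bij g" "len (pinv c \<circ> f) < e" "len (pinv c \<circ> g) < e"
  shows "len (pinv f \<circ> g) < 2 * e"
proof -
  have "pinv f \<circ> g = pinv (pinv c \<circ> f) \<circ> (pinv c \<circ> g)"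
    using assms by (simp add: o_inv_distrib bij_imp_bij_inv inv_inv_eq fun_eq_iff)
      (metis bij_inv_eq_iff)
  then show ?thesis
    using len_comp[of "pinv (pinv c \<circ> f)" "pinv c \<circ> g"] len_inv[of "pinv c \<circ> f"] assms
    by (simp add: bij_imp_bij_inv bij_comp)
qed

text \<open>Here \<open>\<kappa>\<close> splits a set of naturals into disjoint blocks. For some block, every permutation of that
block agrees on it with a permutation of small length, by diagonalization. Otherwise, for each \<open>k\<close>,
the \<open>k\<close>-th translate of the covering misses some permutation \<open>\<zeta> k\<close> of the \<open>k\<close>-th block, even up to changes
outside the block: if it contained a modification of the identity and one of a counterexample, their quotient
would be a small modification of the counterexample. The permutation glued from all \<open>\<zeta> k\<close> then lies in no
translate.\<close>

lemma full_block:
  fixes \<kappa> :: "nat \<Rightarrow> nat option"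
  assumes "e > 0"
  shows "\<exists>k. \<forall>\<phi>. bij \<phi> \<and> (\<forall>x. \<kappa> x \<noteq> Some k \<longrightarrow> \<phi> x = x) \<longrightarrow>
           (\<exists>\<psi>. bij \<psi> \<and> (\<forall>x. \<kappa> x = Some k \<longrightarrow> \<psi> x = \<phi> x) \<and> len \<psi> < 2 * e)"
proof (rule ccontr)
  define S where "S k \<phi> \<longleftrightarrow> bij \<phi> \<and> (\<forall>x. \<kappa> x \<noteq> Some k \<longrightarrow> \<phi> x = x)" for k \<phi>
  define A where "A k \<psi> \<phi> \<longleftrightarrow> bij \<psi> \<and> (\<forall>x. \<kappa> x = Some k \<longrightarrow> \<psi> x = \<phi> x)" for k and \<psi> \<phi> :: "nat \<Rightarrow> nat"
  assume neg: "\<not> ?thesis"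
  have "\<exists>\<phi>. S k \<phi> \<and> (\<forall>\<psi>. A k \<psi> \<phi> \<longrightarrow> \<not> len \<psi> < 2 * e)" for k
  proof (rule ccontr)
    assume "\<not> ?thesis"
    then have "\<forall>\<phi>. S k \<phi> \<longrightarrow> (\<exists>\<psi>. A k \<psi> \<phi> \<and> len \<psi> < 2 * e)" by auto
    then show False using neg unfolding S_def A_def conj_assoc by blast
  qed
  then obtain \<phi> where \<phi>: "S k (\<phi> k)" "\<And>\<psi>. A k \<psi> (\<phi> k) \<Longrightarrow> \<not> len \<psi> < 2 * e" for k by metis
  obtain c :: "nat \<Rightarrow> nat \<Rightarrow> nat" where c: "\<And>n. bij (c n)" "\<And>f. bij f \<Longrightarrow> \<exists>n. len (pinv (c n) \<circ> f) < e"
    using countable_cover[OF assms] by blast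
  have "\<exists>\<zeta>. S k \<zeta> \<and> (\<forall>\<psi>. A k \<psi> \<zeta> \<longrightarrow> \<not> len (pinv (c k) \<circ> \<psi>) < e)" for k
  proof (rule ccontr)
    assume neg: "\<not> ?thesis"
    have "S k id" by (simp add: S_def)
    then obtain \<psi>0 where 0: "A k \<psi>0 id" "len (pinv (c k) \<circ> \<psi>0) < e" using neg by blast
    obtain \<psi>1 where 1: "A k \<psi>1 (\<phi> k)" "len (pinv (c k) \<circ> \<psi>1) < e" using neg \<phi>(1) by blast
    have inv0: "pinv \<psi>0 x = x" if "\<kappa> x = Some k" for x
      using 0(1) that by (intro inv_f_eq) (auto simp: A_def bij_is_inj)
    have "\<kappa> (\<phi> k x) = Some k" if x: "\<kappa> x = Some k" for x
    proof (rule ccontr)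
      assume "\<kappa> (\<phi> k x) \<noteq> Some k"
      then have "\<phi> k (\<phi> k x) = \<phi> k x" using \<phi>(1)[of k] by (simp add: S_def)
      then have "\<phi> k x = x" using \<phi>(1)[of k] by (simp add: S_def bij_is_inj inj_eq)
      then show False using x \<open>\<kappa> (\<phi> k x) \<noteq> Some k\<close> by simp
    qed
    then have "A k (pinv \<psi>0 \<circ> \<psi>1) (\<phi> k)"
      using 0 1 unfolding A_def by (auto simp: bij_imp_bij_inv bij_comp inv0)
    moreover have "len (pinv \<psi>0 \<circ> \<psi>1) < 2 * e"
      using len_diff_less[of "c k" \<psi>0 \<psi>1 e] 0 1 c(1) by (simp add: A_def)
    ultimately show False using \<phi>(2) by blast
  qed
  then obtain \<zeta> where \<zeta>: "S k (\<zeta> k)" "\<And>\<psi>. A k \<psi> (\<zeta> k) \<Longrightarrow> \<not> len (pinv (c k) \<circ> \<psi>) < e" for k by metis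
  define glue where "glue f x = (case \<kappa> x of None \<Rightarrow> x | Some k \<Rightarrow> f k x)" for f :: "nat \<Rightarrow> nat \<Rightarrow> nat" and x
  have st: "\<kappa> (\<zeta> k x) = Some k" "\<kappa> (pinv (\<zeta> k) x) = Some k" if x: "\<kappa> x = Some k" for k x
  proof -
    have k: "bij (\<zeta> k)" "\<And>x. \<kappa> x \<noteq> Some k \<Longrightarrow> \<zeta> k x = x" using \<zeta>(1)[of k] by (auto simp: S_def)
    show "\<kappa> (\<zeta> k x) = Some k"
      using k(2)[of "\<zeta> k x"] x inj_eq[OF bij_is_inj[OF k(1)], of "\<zeta> k x" x] by metis
    show "\<kappa> (pinv (\<zeta> k) x) = Some k"
      using k(2)[of "pinv (\<zeta> k) x"] x surj_f_inv_f[OF bij_is_surj[OF k(1)], of x] by metis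
  qed
  have "glue \<zeta> (glue (\<lambda>k. pinv (\<zeta> k)) x) = x" "glue (\<lambda>k. pinv (\<zeta> k)) (glue \<zeta> x) = x" for x
    using st \<zeta>(1) by (auto simp: glue_def S_def bij_is_surj bij_is_inj surj_f_inv_f split: option.splits)
  then have "bij (glue \<zeta>)" by (intro o_bij[of "glue (\<lambda>k. pinv (\<zeta> k))"]) auto
  then obtain n where "len (pinv (c n) \<circ> glue \<zeta>) < e" using c(2) by blast
  moreover have "A n (glue \<zeta>) (\<zeta> n)" using \<open>bij (glue \<zeta>)\<close> by (auto simp: A_def glue_def)
  ultimately show False using \<zeta>(2) by blast
qed

lemma infinite_section:
  fixes p :: "nat \<times> nat \<Rightarrow> nat"
  assumes "inj p"
  shows "infinite S \<Longrightarrow> infinite ((\<lambda>w. p (w, j)) ` S)" and "infinite (range (\<lambda>j. p (i, j)))"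
proof -
  have "inj_on (\<lambda>w. p (w, j)) S" and "inj (\<lambda>j. p (i, j))"
    by (auto simp: inj_on_def inj_eq[OF assms])
  then show "infinite S \<Longrightarrow> infinite ((\<lambda>w. p (w, j)) ` S)" "infinite (range (\<lambda>j. p (i, j)))"
    by (simp_all add: finite_image_iff range_inj_infinite)
qed

lemma infinite_nat_coords:
  assumes "infinite (X :: nat set)"
  obtains p :: "nat \<times> nat \<Rightarrow> nat" and q where
    "\<And>z. p z \<in> X" "\<And>z. q (p z) = z" "\<And>x. x \<in> X \<Longrightarrow> p (q x) = x"
proof -
  have b: "bij_betw (enumerate X) UNIV X" using assms by (rule bij_enumerate)
  show ?thesis
    by (rule that[of "\<lambda>z. enumerate X (prod_encode z)" "\<lambda>x. prod_decode (inv_into UNIV (enumerate X) x)"])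
      (use b in \<open>auto simp: bij_betw_def f_inv_into_f\<close>)
qed

text \<open>Divide part of \<open>X\<close> into infinitely many pairs and let \<open>t S\<close> swap the pairs with index in \<open>S\<close>. The branches
of the binary tree are uncountably many infinite index sets, any two of which have infinite
difference. Two of them give involutions in the same translate of a small ball, and the product of these
two is \<open>t\<close> of the symmetric difference and has small length.\<close>

lemma small_moiety_involution:
  assumes "infinite X" "e > 0"
  shows "\<exists>\<tau>. moiety_involution X \<tau> \<and> len \<tau> < 2 * e"
proof -
  obtain p :: "nat \<times> nat \<Rightarrow> nat" and q where pq: "\<And>z. p z \<in> X" "\<And>z. q (p z) = z" "\<And>x. x \<in> X \<Longrightarrow> p (q x) = x"
    using infinite_nat_coords[OF assms(1)] by blast
  define sw :: "nat \<Rightarrow> nat" where "sw j = (if j = 0 then 1 else if j = 1 then 0 else j)" for j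
  define t where "t S x = (if x \<in> X \<and> fst (q x) \<in> S then p (fst (q x), sw (snd (q x))) else x)" for S x
  have sw: "sw (sw j) = j" for j by (simp add: sw_def)
  have tt: "t S (t S' x) = t (S - S' \<union> (S' - S)) x" for S S' x
    by (auto simp: t_def pq sw)
  have t0: "t {} = id" by (auto simp: t_def)
  have tb: "bij (t S)" for S by (rule involuntory_imp_bij) (simp add: tt t0)
  have mo: "moiety_involution X (t S)" if S: "infinite S" for S
  proof -
    have p: "inj p" using pq(2) by (metis injI)
    have "(\<lambda>w. p (w, 0)) ` S \<subseteq> {x. t S x \<noteq> x}"
      using p by (auto simp: t_def pq sw_def dest: injD)
    moreover have "infinite ((\<lambda>w. p (w, 0)) ` S)"
      by (rule infinite_section(1)[OF p S])
    ultimately have 1: "infinite {x. t S x \<noteq> x}" using infinite_super by blast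
    have "range (\<lambda>w. p (w, 2)) \<subseteq> {x \<in> X. t S x = x}"
      by (auto simp: t_def pq sw_def)
    moreover have "infinite (range (\<lambda>w. p (w, 2)))"
      using infinite_section(1)[OF p, of UNIV] by simp
    ultimately have 2: "infinite {x \<in> X. t S x = x}" using infinite_super by blast
    show ?thesis unfolding moiety_involution_def
      using 1 2 by (auto simp: tt t0) (auto simp: t_def)
  qed
  obtain c :: "nat \<Rightarrow> nat \<Rightarrow> nat" where c: "\<And>n. bij (c n)" "\<And>f. bij f \<Longrightarrow> \<exists>n. len (pinv (c n) \<circ> f) < e"
    using countable_cover[OF assms(2)] by blast
  (* The branch of a 0-1 sequence is the set of (codes of) its finite initial segments. *)
  define br :: "(nat \<Rightarrow> bool) \<Rightarrow> nat set" where "br a = range (\<lambda>n. to_nat (map a [0..<n]))" for a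
  have "\<forall>a. \<exists>n. len (pinv (c n) \<circ> t (br a)) < e" using c(2)[OF tb] by blast
  then obtain k where k: "len (pinv (c (k a)) \<circ> t (br a)) < e" for a by metis
  have "\<not> inj (k :: (nat \<Rightarrow> bool) \<Rightarrow> nat)"
  proof
    assume "inj k"
    (* Cantor's diagonal: k would inject the 0-1 sequences into the naturals. *)
    define d where "d n \<longleftrightarrow> \<not> inv_into UNIV k n n" for n
    have eq: "inv_into UNIV k (k d) = d" using \<open>inj k\<close> by simp
    show False using d_def[of "k d"] unfolding eq by blast
  qed
  then obtain a b where ab: "a \<noteq> b" "k a = k b" by (auto simp: inj_on_def)
  have "infinite (br a - br b)"
  proof -
    obtain i where i: "a i \<noteq> b i" using ab by blast
    have "(\<lambda>n. to_nat (map a [0..<n])) ` {i<..} \<subseteq> br a - br b"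
    proof clarsimp
      fix n assume n: "i < n"
      have "map a [0..<n] \<noteq> map b [0..<m]" for m
        using i n by (metis length_map length_upt diff_zero nth_map nth_upt add_0)
      then show "to_nat (map a [0..<n]) \<in> br a \<and> to_nat (map a [0..<n]) \<notin> br b"
        by (auto simp: br_def)
    qed
    moreover have "inj (\<lambda>n. to_nat (map a [0..<n]))"
      by (rule injI) (metis diff_zero from_nat_to_nat length_map length_upt)
    then have "infinite ((\<lambda>n. to_nat (map a [0..<n])) ` {i<..})"
      by (metis finite_imageD infinite_Ioi inj_on_subset subset_UNIV)
    ultimately show ?thesis using infinite_super by blast
  qed
  then have "moiety_involution X (t (br a) \<circ> t (br b))"
    using mo[of "br a - br b \<union> (br b - br a)"] by (simp add: tt comp_def)
  moreover have "pinv (t (br a)) = t (br a)"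
    by (rule inv_unique_comp) (auto simp: tt t0 fun_eq_iff)
  then have "len (t (br a) \<circ> t (br b)) < 2 * e"
    using len_diff_less[OF c(1) tb tb, of _ "br a" e "br b"] k ab(2) by metis
  ultimately show ?thesis by blast
qed

text \<open>Inside a full block \<open>Y\<close> there is one short moiety involution \<open>\<alpha>\<close>. Any other one is conjugate to \<open>\<alpha>\<close> by a
permutation of \<open>Y\<close>, which may be replaced by a short permutation with the same values on \<open>Y\<close>. So it is a
product of three short permutations, whence the bound \<open>e / 6\<close>, doubled in the lemmas used.\<close>

lemma shrink:
  assumes "infinite X" "e > 0"
  shows "\<exists>Y. Y \<subseteq> X \<and> infinite Y \<and> infinite (X - Y) \<and> (\<forall>\<tau>. moiety_involution Y \<tau> \<longrightarrow> len \<tau> < e)"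
proof -
  obtain p :: "nat \<times> nat \<Rightarrow> nat" and q where pq: "\<And>z. p z \<in> X" "\<And>z. q (p z) = z" "\<And>x. x \<in> X \<Longrightarrow> p (q x) = x"
    using infinite_nat_coords[OF assms(1)] by blast
  define \<kappa> where "\<kappa> x = (if x \<in> X then Some (fst (q x)) else None)" for x
  obtain k where k: "\<And>\<phi>. bij \<phi> \<Longrightarrow> \<forall>x. \<kappa> x \<noteq> Some k \<longrightarrow> \<phi> x = x \<Longrightarrow>
      \<exists>\<psi>. bij \<psi> \<and> (\<forall>x. \<kappa> x = Some k \<longrightarrow> \<psi> x = \<phi> x) \<and> len \<psi> < 2 * (e / 6)"
    using full_block[of "e / 6" \<kappa>] assms(2) by auto
  define Y where "Y = {x. \<kappa> x = Some k}"
  have p: "inj p" using pq(2) by (metis injI)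
  have inf: "infinite (range (\<lambda>j. p (i, j)))" for i
    by (rule infinite_section(2)[OF p])
  have "range (\<lambda>j. p (k, j)) \<subseteq> Y" "range (\<lambda>j. p (Suc k, j)) \<subseteq> X - Y"
    by (auto simp: Y_def \<kappa>_def pq)
  then have Y: "infinite Y" "infinite (X - Y)" using inf infinite_super by blast+
  obtain \<alpha> where \<alpha>: "moiety_involution Y \<alpha>" "len \<alpha> < 2 * (e / 6)"
    using small_moiety_involution[OF Y(1), of "e / 6"] assms(2) by auto
  have "len \<tau> < e" if \<tau>: "moiety_involution Y \<tau>" for \<tau>
  proof -
    obtain \<phi> where \<phi>: "bij \<phi>" "\<forall>x. x \<notin> Y \<longrightarrow> \<phi> x = x" "\<phi> \<circ> \<alpha> = \<tau> \<circ> \<phi>"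
      using moiety_involutions_conjugate[OF \<alpha>(1) \<tau>] by blast
    obtain \<psi> where \<psi>: "bij \<psi>" "\<forall>x. x \<in> Y \<longrightarrow> \<psi> x = \<phi> x" "len \<psi> < 2 * (e / 6)"
      using k[OF \<phi>(1)] \<phi>(2) by (auto simp: Y_def)
    have YY: "\<phi> x \<in> Y \<longleftrightarrow> x \<in> Y" for x
      using \<phi>(1,2) by (metis bij_is_inj injD)
    have \<psi>Y: "\<psi> x \<in> Y \<longleftrightarrow> x \<in> Y" for x
    proof
      assume "\<psi> x \<in> Y"
      then obtain y where "y \<in> Y" "\<phi> y = \<psi> x" using YY \<phi>(1) by (metis bij_pointE)
      then show "x \<in> Y" using \<psi> by (metis bij_is_inj injD)
    qed (use \<psi> YY in auto)
    have "\<psi> (\<alpha> x) = \<tau> (\<psi> x)" for x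
    proof (cases "x \<in> Y")
      case True
      have "\<alpha> x \<in> Y" using True \<alpha>(1) unfolding moiety_involution_def by metis
      then show ?thesis using \<psi>(2) True fun_cong[OF \<phi>(3), of x] by simp
    next
      case False
      then show ?thesis using \<alpha>(1) \<tau> \<psi>Y by (simp add: moiety_involution_def)
    qed
    then have eq: "\<tau> = \<psi> \<circ> \<alpha> \<circ> pinv \<psi>"
      using \<psi>(1) by (auto simp: fun_eq_iff bij_is_surj surj_f_inv_f)
    have b: "bij \<alpha>" using \<alpha>(1) by (rule moiety_involution_bij)
    have "len \<tau> \<le> len \<psi> + len \<alpha> + len \<psi>"
      unfolding eq using len_comp[of "\<psi> \<circ> \<alpha>" "pinv \<psi>"] len_comp[of \<psi> \<alpha>] len_inv[of \<psi>] \<psi>(1) b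
      by (simp add: bij_comp bij_imp_bij_inv)
    then show ?thesis using \<psi>(3) \<alpha>(2) by simp
  qed
  moreover have "Y \<subseteq> X" by (auto simp: Y_def \<kappa>_def split: if_splits)
  ultimately show ?thesis using Y by blast
qed

text \<open>Shrinking repeatedly gives disjoint infinite sets \<open>D n\<close> on which moiety involutions become arbitrarily short.
Let \<open>t n\<close> be a fixed-point-free involution of \<open>D n\<close> and \<open>h n\<close> an exchange of \<open>D n\<close> with \<open>D (Suc n)\<close> that
carries \<open>t (Suc n)\<close> to \<open>t n\<close>. The products \<open>g n\<close> of the \<open>h i\<close> with \<open>i < n\<close> are Cauchy under \<open>\<Psi>\<close>, with limit
\<open>k\<close> say, and \<open>g n \<circ> t n = t 0 \<circ> g n\<close>. As \<open>t n\<close> becomes short, passing to the limit yields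
\<open>\<Psi> (t 0) * k = k\<close>, so \<open>\<Psi> (t 0)\<close> is trivial; and all moiety involutions are conjugate.\<close>

lemma kills_moiety_involutions:
  assumes "moiety_involution UNIV \<tau>"
  shows "\<Psi> \<tau> = \<one>\<^bsub>K\<^esub>"
proof -
  let ?P = "\<lambda>n Y. infinite Y \<and> (\<forall>\<tau>. moiety_involution Y \<tau> \<longrightarrow> len \<tau> < (1/2)^n)"
  let ?Q = "\<lambda>n Y Z. Z \<subseteq> Y \<and> infinite (Y - Z)"
  have "\<exists>Z. ?P (Suc n) Z \<and> ?Q n Y Z" if "?P n Y" for Y n
    using shrink[of Y "(1/2)^Suc n"] that by auto
  moreover have "\<exists>Y. ?P 0 Y" using shrink[of UNIV 1] by auto
  ultimately have "\<exists>X. \<forall>n. ?P n (X n) \<and> ?Q n (X n) (X (Suc n))"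
    by (intro dependent_nat_choice) auto
  then obtain X where X: "infinite (X n)" "X (Suc n) \<subseteq> X n" "infinite (X n - X (Suc n))"
      "\<And>\<tau>. moiety_involution (X n) \<tau> \<Longrightarrow> len \<tau> < (1/2)^n" for n by metis
  define D where "D n = X n - X (Suc n)" for n
  have DX: "D n \<subseteq> X n" "D n \<inter> X (Suc n) = {}" "D n \<inter> D (Suc n) = {}" for n by (auto simp: D_def)
  define e where "e n = enumerate (D n)" for n
  define r where "r n = inv_into UNIV (e n)" for n
  have b: "bij_betw (e n) UNIV (D n)" for n unfolding e_def using X(3) by (intro bij_enumerate) (simp add: D_def)
  have er: "e n j \<in> D n" "r n (e n j) = j" "x \<in> D n \<Longrightarrow> e n (r n x) = x" for n j x
    using b[of n] by (auto simp: r_def bij_betw_def f_inv_into_f)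
  have disj: "e n j \<notin> D (Suc n)" "e (Suc n) j \<notin> D n" for n j using er(1) DX(3) by blast+
  define sw :: "nat \<Rightarrow> nat" where "sw j = (if even j then j + 1 else j - 1)" for j
  have sw: "sw (sw j) = j" "sw j \<noteq> j" for j by (auto simp: sw_def elim: oddE)
  define t where "t n x = (if x \<in> D n then e n (sw (r n x)) else x)" for n x
  define h where "h n x = (if x \<in> D n then e (Suc n) (r n x) else if x \<in> D (Suc n) then e n (r (Suc n) x) else x)" for n x
  have hh: "h n (h n x) = x" for n x by (auto simp: h_def er disj)
  have tt: "t n (t n x) = x" for n x by (auto simp: t_def er sw)
  have ht: "h n (t (Suc n) x) = t n (h n x)" for n x using DX(3)[of n] by (auto simp: h_def t_def er disj)
  have t: "moiety_involution (X n) (t n)" for n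
  proof -
    have "e n j \<noteq> e n (sw j)" for j using er(2)[of n] sw(2)[of j] by metis
    then have "D n \<subseteq> {x. t n x \<noteq> x}" by (auto simp: t_def er) (metis er(3))
    moreover have "X (Suc n) \<subseteq> {x \<in> X n. t n x = x}" using X(2) DX(2) by (auto simp: t_def)
    ultimately have "infinite {x. t n x \<noteq> x}" "infinite {x \<in> X n. t n x = x}"
      using X(1)[of "Suc n"] X(3)[of n] infinite_super unfolding D_def by blast+
    moreover have "t n x = x" if "x \<notin> X n" for x
      using that DX(1)[of n] by (auto simp: t_def)
    ultimately show ?thesis using tt by (simp add: moiety_involution_def)
  qed
  have h: "moiety_involution (X n) (h n)" for n
  proof -
    have "h n x \<noteq> x" if "x \<in> D n" for x
      using disj(2)[of n "r n x"] that by (auto simp: h_def)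
    then have "D n \<subseteq> {x. h n x \<noteq> x}" by blast
    moreover have "X (Suc (Suc n)) \<subseteq> {x \<in> X n. h n x = x}"
      using X(2)[of n] X(2)[of "Suc n"] by (auto simp: h_def D_def)
    ultimately have "infinite {x. h n x \<noteq> x}" "infinite {x \<in> X n. h n x = x}"
      using X(1)[of "Suc (Suc n)"] X(3)[of n] infinite_super unfolding D_def by blast+
    moreover have "h n x = x" if "x \<notin> X n" for x
      using that X(2)[of n] DX(1)[of n] DX(1)[of "Suc n"] by (auto simp: h_def)
    ultimately show ?thesis using hh by (simp add: moiety_involution_def)
  qed
  have bt: "bij (t n)" and bh: "bij (h n)" for n using t h moiety_involution_bij by blast+
  define g where "g = rec_nat id (\<lambda>n f. f \<circ> h n)"
  have g: "g 0 = id" "g (Suc n) = g n \<circ> h n" for n by (simp_all add: g_def)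
  have bg: "bij (g n)" for n by (induction n) (simp_all only: g bh bij_comp bij_id)
  have gt: "g n \<circ> t n = t 0 \<circ> g n" for n
  proof (induction n)
    case (Suc n)
    show ?case using fun_cong[OF Suc] by (auto simp: g ht)
  qed (simp add: g)
  interpret M: Metric_space "mspace \<rho>" "mdist \<rho>" by simp
  have step: "mdist \<rho> (\<Psi> (g n)) (\<Psi> (g (Suc n))) \<le> (1/2)^n" for n
    using dist_Psi_comp[OF bg bh, of n n] X(4)[OF h, of n] by (simp add: g)
  have "mdist \<rho> (\<Psi> (g n)) (\<Psi> (g (n + k))) \<le> 2 * (1/2)^n - 2 * (1/2)^(n + k)" for n k
  proof (induction k)
    case (Suc k)
    have "mdist \<rho> (\<Psi> (g n)) (\<Psi> (g (n + Suc k))) \<le>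
        mdist \<rho> (\<Psi> (g n)) (\<Psi> (g (n + k))) + mdist \<rho> (\<Psi> (g (n + k))) (\<Psi> (g (n + Suc k)))"
      by (intro mdist_triangle) (simp_all add: sp closed bg)
    moreover have "2 * (1/2)^(n + Suc k) = (1/2 :: real)^(n + k)" by simp
    ultimately show ?case using Suc step[of "n + k"] by (simp only: add_Suc_right)
  qed (simp add: sp closed bg)
  then have cau: "mdist \<rho> (\<Psi> (g n)) (\<Psi> (g (n + k))) \<le> 2 * (1/2)^n" for n k
    by (smt (verit) zero_le_power divide_nonneg_nonneg)
  have lim0: "(\<lambda>n. 2 * (1/2)^n :: real) \<longlonglongrightarrow> 0"
    by (intro tendsto_mult_right_zero LIMSEQ_realpow_zero) auto
  have "M.MCauchy (\<lambda>n. \<Psi> (g n))"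
    unfolding M.MCauchy_def
  proof (intro conjI allI impI)
    show "range (\<lambda>n. \<Psi> (g n)) \<subseteq> mspace \<rho>" by (auto simp: sp closed bg)
    fix \<epsilon> :: real assume "0 < \<epsilon>"
    then obtain N where N: "\<And>n. n \<ge> N \<Longrightarrow> 2 * (1/2)^n < \<epsilon>"
      using order_tendstoD(2)[OF lim0] by (auto simp: eventually_sequentially)
    have "mdist \<rho> (\<Psi> (g n)) (\<Psi> (g n')) < \<epsilon>" if "N \<le> n" "n \<le> n'" for n n'
      using cau[of n "n' - n"] N[OF that(1)] that(2) by simp
    then show "\<exists>N. \<forall>n n'. N \<le> n \<longrightarrow> N \<le> n' \<longrightarrow> mdist \<rho> (\<Psi> (g n)) (\<Psi> (g n')) < \<epsilon>"
      by (metis mdist_commute nle_le)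
  qed
  then obtain k where "limitin M.mtopology (\<lambda>n. \<Psi> (g n)) k sequentially"
    using complete by (auto simp: mcomplete_of_def M.mcomplete_def)
  then have k: "k \<in> carrier K" "(\<lambda>n. mdist \<rho> (\<Psi> (g n)) k) \<longlonglongrightarrow> 0"
    unfolding M.limitin_metric_dist_null by (simp_all add: sp)
  have "mdist \<rho> (\<Psi> (t 0) \<otimes>\<^bsub>K\<^esub> k) k \<le> 2 * mdist \<rho> (\<Psi> (g n)) k + 2 * (1/2)^n" for n
  proof -
    have "mdist \<rho> (\<Psi> (t 0) \<otimes>\<^bsub>K\<^esub> k) (\<Psi> (g n \<circ> t n)) = mdist \<rho> (\<Psi> (g n)) k"
      using dist_left[of "\<Psi> (t 0)" k "\<Psi> (g n)"] k(1) closed bt bg gt by (simp add: hom mdist_commute)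
    moreover have "mdist \<rho> (\<Psi> (g n)) (\<Psi> (g n \<circ> t n)) \<le> 2 * (1/2)^n"
      using dist_Psi_comp[OF bg bt, of n n] X(4)[OF t, of n] zero_le_power[of "1/2 :: real" n] by linarith
    ultimately show ?thesis
      using mdist_triangle[of "\<Psi> (t 0) \<otimes>\<^bsub>K\<^esub> k" \<rho> "\<Psi> (g n \<circ> t n)" k]
        mdist_triangle[of "\<Psi> (g n \<circ> t n)" \<rho> "\<Psi> (g n)" k] mdist_commute[of \<rho> "\<Psi> (g n)" "\<Psi> (g n \<circ> t n)"]
        k(1) closed bt bg by (simp add: sp bij_comp)
  qed
  moreover have "(\<lambda>n. 2 * mdist \<rho> (\<Psi> (g n)) k + 2 * (1/2)^n) \<longlonglongrightarrow> 0"
    using tendsto_add[OF tendsto_mult_right_zero[OF k(2), of 2] lim0] by simp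
  ultimately have "mdist \<rho> (\<Psi> (t 0) \<otimes>\<^bsub>K\<^esub> k) k \<le> 0"
    by (intro LIMSEQ_le_const[where X = "\<lambda>n. 2 * mdist \<rho> (\<Psi> (g n)) k + 2 * (1/2)^n"]) auto
  then have "\<Psi> (t 0) \<otimes>\<^bsub>K\<^esub> k = k"
    using mdist_nonneg[of \<rho> "\<Psi> (t 0) \<otimes>\<^bsub>K\<^esub> k" k] k(1) closed bt
    by (metis K.m_closed antisym mdist_zero sp)
  then have one: "\<Psi> (t 0) = \<one>\<^bsub>K\<^esub>" using k(1) closed[OF bt[of 0]] by simp
  obtain \<phi> where \<phi>: "bij \<phi>" "\<phi> \<circ> \<tau> = t 0 \<circ> \<phi>"
    using moiety_involutions_conjugate[OF assms moiety_involution_mono[OF t]] by blast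
  then have "\<Psi> \<phi> \<otimes>\<^bsub>K\<^esub> \<Psi> \<tau> = \<Psi> \<phi>"
    using hom[of \<phi> \<tau>] hom[of "t 0" \<phi>] one closed bt moiety_involution_bij[OF assms] by simp
  then show ?thesis using closed \<phi>(1) moiety_involution_bij[OF assms] by (metis K.l_cancel_one)
qed

end

text \<open>On \<open>m\<close> points in a circle the product of two suitable reflections is the rotation by one step. Doing
this on disjoint circles of all sizes, with infinitely many points left fixed, realizes the
required permutation as a product of two moiety involutions. In \<open>w m i\<close>, the first argument names the circle
and the arguments \<open>i < m\<close> run through it.\<close>

lemma permutation_with_all_cycle_lengths:
  obtains \<sigma> \<alpha> \<beta> :: "nat \<Rightarrow> nat" and w :: "nat \<Rightarrow> nat \<Rightarrow> nat" where
    "moiety_involution UNIV \<alpha>" "moiety_involution UNIV \<beta>" "\<sigma> = \<alpha> \<circ> \<beta>"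
    "\<And>m i. i < m \<Longrightarrow> \<sigma> (w m i) = w m (Suc i mod m)"
    "\<And>m. inj (w m)" "\<And>x. \<exists>n>0. (\<sigma> ^^ n) x = x"
proof -
  define a :: "nat \<times> nat \<Rightarrow> nat \<times> nat" where "a = (\<lambda>(m, i). (m, if i < m then m - 1 - i else i))"
  define b :: "nat \<times> nat \<Rightarrow> nat \<times> nat" where "b = (\<lambda>(m, i). (m, if 0 < i \<and> i < m then m - i else i))"
  have aa: "a (a z) = z" and bb: "b (b z) = z" for z by (auto simp: a_def b_def split: prod.splits)
  define \<alpha> where "\<alpha> x = prod_encode (b (prod_decode x))" for x
  define \<beta> where "\<beta> x = prod_encode (a (prod_decode x))" for x
  have inf: "infinite S" if "range (\<lambda>m. prod_encode (f m)) \<subseteq> S" "inj f" for S and f :: "nat \<Rightarrow> nat \<times> nat"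
  proof -
    have "inj (\<lambda>m. prod_encode (f m))" using that(2) by (auto simp: inj_def)
    then show ?thesis using that(1) range_inj_infinite infinite_super by blast
  qed
  have A: "moiety_involution UNIV \<alpha>" unfolding moiety_involution_def
  proof (intro conjI)
    show "infinite {x. \<alpha> x \<noteq> x}"
      by (rule inf[of "\<lambda>m. (m + 3, 1)"]) (auto simp: \<alpha>_def b_def inj_def)
    show "infinite {x \<in> UNIV. \<alpha> x = x}"
      by (rule inf[of "\<lambda>m. (m, 0)"]) (auto simp: \<alpha>_def b_def inj_def)
  qed (auto simp: \<alpha>_def bb)
  have B: "moiety_involution UNIV \<beta>" unfolding moiety_involution_def
  proof (intro conjI)
    show "infinite {x. \<beta> x \<noteq> x}"
      by (rule inf[of "\<lambda>m. (m + 2, 0)"]) (auto simp: \<beta>_def a_def inj_def)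
    show "infinite {x \<in> UNIV. \<beta> x = x}"
      by (rule inf[of "\<lambda>m. (m, m)"]) (auto simp: \<beta>_def a_def inj_def)
  qed (auto simp: \<beta>_def aa)
  define w where "w m i = prod_encode (m, i)" for m i
  have s: "(\<alpha> \<circ> \<beta>) (w m i) = w m (Suc i mod m)" if "i < m" for m i
  proof (cases "Suc i = m")
    case True
    then show ?thesis by (auto simp: \<alpha>_def \<beta>_def a_def b_def w_def)
  next
    case False
    then show ?thesis using that by (auto simp: \<alpha>_def \<beta>_def a_def b_def w_def)
  qed
  have "\<exists>n>0. ((\<alpha> \<circ> \<beta>) ^^ n) x = x" for x
  proof -
    obtain m i where x: "x = w m i" by (metis surj_pair w_def prod_decode_inverse)
    show ?thesis
    proof (cases "i < m")
      case True
      have "((\<alpha> \<circ> \<beta>) ^^ n) (w m i) = w m ((i + n) mod m)" for n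
      proof (induction n)
        case (Suc n)
        have "(i + n) mod m < m" using True by simp
        then show ?case using Suc s[of "(i + n) mod m" m] by (simp add: mod_Suc_eq)
      qed (use True in simp)
      from this[of m] True show ?thesis unfolding x by (intro exI[of _ m]) auto
    next
      case False
      then show ?thesis by (intro exI[of _ 1]) (auto simp: x w_def \<alpha>_def \<beta>_def a_def b_def)
    qed
  qed
  then show ?thesis using A B s by (intro that[of \<alpha> \<beta> "\<alpha> \<circ> \<beta>" w]) (auto simp: w_def inj_def)
qed

section \<open>Extending partial isometries\<close>

definition metric_on :: "'a set \<Rightarrow> ('a \<Rightarrow> 'a \<Rightarrow> real) \<Rightarrow> bool" where
  "metric_on X d \<longleftrightarrow>
     (\<forall>x\<in>X. \<forall>y\<in>X. 0 \<le> d x y \<and> d x y = d y x \<and> (d x y = 0 \<longleftrightarrow> x = y)) \<and>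
     (\<forall>x\<in>X. \<forall>y\<in>X. \<forall>z\<in>X. d x z \<le> d x y + d y z)"

definition real_subgroup :: "real set \<Rightarrow> bool" where
  "real_subgroup Q \<longleftrightarrow> 0 \<in> Q \<and> (\<forall>x\<in>Q. \<forall>y\<in>Q. x - y \<in> Q)"

definition Qmetric :: "real set \<Rightarrow> 'a set \<Rightarrow> ('a \<Rightarrow> 'a \<Rightarrow> real) \<Rightarrow> bool" where
  "Qmetric Q X d \<longleftrightarrow> metric_on X d \<and> (\<forall>x\<in>X. \<forall>y\<in>X. d x y \<in> Q)"

text \<open>The functions \<open>h\<close> are the Katetov functions with values in \<open>Q\<close>: the candidates for the distances of a
new point from \<open>F\<close>. For \<open>Q = UNIV\<close> this is the characteristic property of the Urysohn space.\<close>

definition one_point_extensions :: "real set \<Rightarrow> 'a set \<Rightarrow> ('a \<Rightarrow> 'a \<Rightarrow> real) \<Rightarrow> bool" where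
  "one_point_extensions Q X d \<longleftrightarrow>
     (\<forall>F h. finite F \<and> F \<subseteq> X \<and> F \<noteq> {} \<and> (\<forall>x\<in>F. h x \<in> Q \<and> 0 < h x) \<and>
        (\<forall>x\<in>F. \<forall>y\<in>F. h x \<le> h y + d x y \<and> d x y \<le> h x + h y) \<longrightarrow>
        (\<exists>z\<in>X. \<forall>x\<in>F. d z x = h x))"

definition isometry_on :: "'a set \<Rightarrow> ('a \<Rightarrow> 'a \<Rightarrow> real) \<Rightarrow> ('b \<Rightarrow> 'b \<Rightarrow> real) \<Rightarrow> ('a \<Rightarrow> 'b) \<Rightarrow> bool" where
  "isometry_on X d d' f \<longleftrightarrow> (\<forall>x\<in>X. \<forall>y\<in>X. d' (f x) (f y) = d x y)"

lemma metric_onD: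
  assumes "metric_on X d" "x \<in> X" "y \<in> X"
  shows "0 \<le> d x y" "d x y = d y x" "d x y = 0 \<longleftrightarrow> x = y" "d x x = 0" "z \<in> X \<Longrightarrow> d x z \<le> d x y + d y z"
  using assms unfolding metric_on_def by blast+

lemma QmetricD: "Qmetric Q X d \<Longrightarrow> metric_on X d" "Qmetric Q X d \<Longrightarrow> x \<in> X \<Longrightarrow> y \<in> X \<Longrightarrow> d x y \<in> Q"
  by (auto simp: Qmetric_def)

lemma Qmetric_subset: "Qmetric Q X d \<Longrightarrow> Y \<subseteq> X \<Longrightarrow> Qmetric Q Y d"
  unfolding Qmetric_def metric_on_def by (meson subsetD)

lemma isometry_on_inj:
  assumes "metric_on X d" "metric_on Y d'" "f ` X \<subseteq> Y" "isometry_on X d d' f"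
  shows "inj_on f X"
proof (rule inj_onI)
  fix x y assume "x \<in> X" "y \<in> X" "f x = f y"
  then show "x = y"
    using assms metric_onD(3)[OF assms(1), of x y] metric_onD(4)[OF assms(2), of "f x" "f y"]
    by (auto simp: isometry_on_def image_subset_iff) metis
qed

lemma real_subgroupD:
  assumes "real_subgroup Q"
  shows "0 \<in> Q" "x \<in> Q \<Longrightarrow> y \<in> Q \<Longrightarrow> x - y \<in> Q" "x \<in> Q \<Longrightarrow> y \<in> Q \<Longrightarrow> x + y \<in> Q" "x \<in> Q \<Longrightarrow> \<bar>x\<bar> \<in> Q"
proof -
  show 0: "0 \<in> Q" and 1: "\<And>x y. x \<in> Q \<Longrightarrow> y \<in> Q \<Longrightarrow> x - y \<in> Q"
    using assms by (auto simp: real_subgroup_def)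
  show "x \<in> Q \<Longrightarrow> y \<in> Q \<Longrightarrow> x + y \<in> Q" using 1[of x "0 - y"] 1[OF 0, of y] by simp
  show "x \<in> Q \<Longrightarrow> \<bar>x\<bar> \<in> Q" using 1[OF 0, of x] by (simp add: abs_if)
qed

text \<open>The points of \<open>E - S\<close> are added one at a time, each as a one-point extension of the image of the
previous ones.\<close>

lemma embed_finite:
  assumes Y: "Qmetric Q Y d" "one_point_extensions Q Y d"
    and E: "finite E" "Qmetric Q E dE" and S: "S \<subseteq> E" "S \<noteq> {}"
    and \<kappa>0: "\<kappa>0 ` S \<subseteq> Y" "isometry_on S dE d \<kappa>0"
  shows "\<exists>\<kappa>. \<kappa> ` E \<subseteq> Y \<and> (\<forall>x\<in>S. \<kappa> x = \<kappa>0 x) \<and> isometry_on E dE d \<kappa>"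
proof -
  have "\<exists>\<kappa>. \<kappa> ` (S \<union> W) \<subseteq> Y \<and> (\<forall>x\<in>S. \<kappa> x = \<kappa>0 x) \<and> isometry_on (S \<union> W) dE d \<kappa>"
    if "finite W" "W \<subseteq> E - S" for W
    using that
  proof (induction W rule: finite_induct)
    case empty
    then show ?case using \<kappa>0 by (intro exI[of _ \<kappa>0]) auto
  next
    case (insert w W)
    then obtain \<kappa> where \<kappa>: "\<kappa> ` (S \<union> W) \<subseteq> Y" "\<forall>x\<in>S. \<kappa> x = \<kappa>0 x" "isometry_on (S \<union> W) dE d \<kappa>" by auto
    define T where "T = S \<union> W"
    have T: "T \<subseteq> E" "T \<noteq> {}" "finite T" "w \<in> E" "w \<notin> T"
      using insert S E(1) finite_subset by (auto simp: T_def)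
    note m = metric_onD[OF QmetricD(1)[OF E(2)]]
    have inj: "inj_on \<kappa> T"
      using isometry_on_inj[of T dE Y d \<kappa>] \<kappa> Y(1) Qmetric_subset[OF E(2) T(1)] by (simp add: T_def Qmetric_def)
    define h where "h y = dE w (inv_into T \<kappa> y)" for y
    have h: "h (\<kappa> x) = dE w x" if "x \<in> T" for x using that inj by (simp add: h_def)
    have k: "d (\<kappa> x) (\<kappa> y) = dE x y" if "x \<in> T" "y \<in> T" for x y
      using \<kappa>(3) that by (simp add: isometry_on_def T_def)
    have "\<exists>z\<in>Y. \<forall>x\<in>\<kappa> ` T. d z x = h x"
    proof (rule Y(2)[unfolded one_point_extensions_def, rule_format], intro conjI ballI)
      show "finite (\<kappa> ` T)" "\<kappa> ` T \<subseteq> Y" "\<kappa> ` T \<noteq> {}" using T \<kappa>(1) by (auto simp: T_def)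
      fix y assume "y \<in> \<kappa> ` T"
      then obtain x where x: "x \<in> T" "y = \<kappa> x" by blast
      then have xE: "x \<in> E" using T by blast
      show "h y \<in> Q" using QmetricD(2)[OF E(2) T(4) xE] by (simp add: x h)
      show "0 < h y" using m(1,3)[OF T(4) xE] x T(5) by (auto simp: h less_le)
      fix y' assume "y' \<in> \<kappa> ` T"
      then obtain x' where x': "x' \<in> T" "y' = \<kappa> x'" by blast
      then have xE': "x' \<in> E" using T by blast
      show "h y \<le> h y' + d y y'"
        using m(5)[OF T(4) xE' xE] m(2)[OF xE xE'] by (simp add: x x' h k)
      show "d y y' \<le> h y + h y'"
        using m(5)[OF xE T(4) xE'] m(2)[OF xE T(4)] by (simp add: x x' h k)
    qed
    then obtain z where z: "z \<in> Y" "\<And>x. x \<in> T \<Longrightarrow> d z (\<kappa> x) = dE w x" by (auto simp: h)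
    have z': "d (\<kappa> x) z = dE x w" if "x \<in> T" for x
    proof -
      have "\<kappa> x \<in> Y" "x \<in> E" using that T(1) \<kappa>(1) by (auto simp: T_def)
      then show ?thesis
        using metric_onD(2)[OF QmetricD(1)[OF Y(1)], of "\<kappa> x" z] m(2)[of x w] z that T(4) by simp
    qed
    have "isometry_on (insert w T) dE d (\<kappa>(w := z))"
      using T(4,5) k z z' metric_onD(4)[OF QmetricD(1)[OF Y(1)] z(1) z(1)] m(4)[OF T(4) T(4)]
      by (auto simp: isometry_on_def)
    then have 1: "isometry_on (S \<union> insert w W) dE d (\<kappa>(w := z))" by (simp add: T_def)
    have 2: "(\<kappa>(w := z)) ` (S \<union> insert w W) \<subseteq> Y" "\<forall>x\<in>S. (\<kappa>(w := z)) x = \<kappa>0 x"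
      using \<kappa>(1,2) z(1) T(5) by (auto simp: T_def)
    show ?case using 1 2 by blast
  qed
  from this[of "E - S"] show ?thesis using E(1) S(1) by (simp add: Un_absorb1)
qed

lemma finite_injection_period:
  assumes "finite C" "inj_on p C" "p ` C \<subseteq> C"
  shows "\<exists>L>0. \<forall>x\<in>C. (p ^^ L) x = x"
proof -
  have it: "(p ^^ n) ` C \<subseteq> C" "inj_on (p ^^ n) C" for n
  proof (induction n)
    case (Suc n)
    show "(p ^^ Suc n) ` C \<subseteq> C" using Suc(1) assms(3) by (auto simp: image_subset_iff)
    show "inj_on (p ^^ Suc n) C"
      using comp_inj_on[OF Suc(2) inj_on_subset[OF assms(2) Suc(1)]] by (simp add: comp_def)
  qed auto
  have "range (\<lambda>n. restrict (p ^^ n) C) \<subseteq> C \<rightarrow>\<^sub>E C" using it(1) by (auto simp: image_subset_iff)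
  moreover have "finite (C \<rightarrow>\<^sub>E C)" using assms(1) by (intro finite_PiE) auto
  ultimately have "finite (range (\<lambda>n. restrict (p ^^ n) C))" using finite_subset by blast
  then have "\<not> inj (\<lambda>n. restrict (p ^^ n) C)" using range_inj_infinite by blast
  then obtain i j where ij: "i < j" "restrict (p ^^ i) C = restrict (p ^^ j) C"
    by (auto simp: inj_def) (metis linorder_neqE_nat)
  have "(p ^^ (j - i)) x = x" if "x \<in> C" for x
  proof -
    have "(p ^^ i) ((p ^^ (j - i)) x) = (p ^^ i) x"
      using ij that by (metis funpow_add o_apply le_add_diff_inverse less_imp_le restrict_apply')
    then show ?thesis using it that by (metis image_subset_iff inj_onD)
  qed
  then show ?thesis using ij(1) by (intro exI[of _ "j - i"]) auto
qed

text \<open>A function \<open>h i\<close> prescribes the distances of a point from \<open>S\<close>, and the equation \<open>h (Suc i) a = h i (p a)\<close> makes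
it possible that \<open>p\<close> maps the point described by \<open>h (Suc i)\<close> to the one described by \<open>h i\<close>. Each \<open>h (Suc i)\<close> is taken as large as possible below the profile
\<open>e (Suc i)\<close>, namely as the largest 1-Lipschitz function with the values forced on \<open>A\<close>. A value below the profile
is produced by a chain of constraints; going back along the chain, each step either follows \<open>p\<close>, which can
happen only a bounded number of times in succession for a point that eventually leaves \<open>A\<close>, or costs at least the
smallest distance in \<open>S\<close>. As the profile is bounded by \<open>D\<close>, after finitely many steps \<open>h i\<close> equals
\<open>e i\<close>. On the points that never leave \<open>A\<close> the two agree from the beginning.\<close>

lemma forward_extensions:
  assumes Q: "real_subgroup Q" and S: "Qmetric Q S d" "finite S"
    and p: "A \<subseteq> S" "p ` A \<subseteq> S" "isometry_on A d d p"
    and h0: "\<And>x. x \<in> S \<Longrightarrow> h0 x \<in> Q \<and> 0 \<le> h0 x" "\<And>x y. x \<in> S \<Longrightarrow> y \<in> S \<Longrightarrow> h0 x \<le> h0 y + d x y"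
    and e: "\<And>i x. x \<in> S \<Longrightarrow> e i x \<in> Q \<and> 0 \<le> e i x \<and> e i x \<le> D" "\<And>i x y. x \<in> S \<Longrightarrow> y \<in> S \<Longrightarrow> e i x \<le> e i y + d x y"
      "\<And>i a. a \<in> A \<Longrightarrow> e (Suc i) a = e i (p a)"
    and le: "\<And>x. x \<in> S \<Longrightarrow> h0 x \<le> e 0 x"
    and agree: "\<And>x. x \<in> S \<Longrightarrow> (\<And>n. (p ^^ n) x \<in> A) \<Longrightarrow> h0 x = e 0 x"
  shows "\<exists>h k. h 0 = h0 \<and> (\<forall>i. \<forall>x\<in>S. h i x \<in> Q) \<and> (\<forall>i. \<forall>x\<in>S. \<forall>y\<in>S. h i x \<le> h i y + d x y) \<and>
           (\<forall>i. \<forall>a\<in>A. h (Suc i) a = h i (p a)) \<and> (\<forall>i\<ge>k. \<forall>x\<in>S. h i x = e i x)"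
proof -
  have A: "finite A" using p(1) S(2) finite_subset by blast
  note m = metric_onD[OF QmetricD(1)[OF S(1)]]
  have pS: "p a \<in> S" "a \<in> S" if "a \<in> A" for a using p that by auto
  have pd: "d (p a) (p b) = d a b" if "a \<in> A" "b \<in> A" for a b using p(3) that by (simp add: isometry_on_def)
  define V where "V i h x = insert (e (Suc i) x) ((\<lambda>a. h (p a) + d a x) ` A)" for i h x
  define h where "h = rec_nat h0 (\<lambda>i h x. Min (V i h x))"
  have h: "h 0 = h0" "h (Suc i) x = Min (V i (h i) x)" for i x by (simp_all add: h_def)
  have V: "finite (V i (h i) x)" "V i (h i) x \<noteq> {}" for i x using A by (auto simp: V_def)
  have hle: "h (Suc i) x \<le> e (Suc i) x" "a \<in> A \<Longrightarrow> h (Suc i) x \<le> h i (p a) + d a x" for i x a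
    using Min_le[OF V(1)] by (auto simp: h V_def)
  have hin: "h (Suc i) x = e (Suc i) x \<or> (\<exists>a\<in>A. h (Suc i) x = h i (p a) + d a x)" for i x
    using Min_in[OF V] by (auto simp: h V_def)
  have I: "(\<forall>x\<in>S. h i x \<in> Q \<and> h i x \<le> e i x \<and> 0 \<le> h i x) \<and> (\<forall>x\<in>S. \<forall>y\<in>S. h i x \<le> h i y + d x y)" for i
  proof (induction i)
    case 0
    then show ?case using h0 le by (simp add: h)
  next
    case (Suc i)
    have 1: "h (Suc i) x \<in> Q \<and> h (Suc i) x \<le> e (Suc i) x \<and> 0 \<le> h (Suc i) x" if x: "x \<in> S" for x
      using hin[of i x]
    proof
      assume "h (Suc i) x = e (Suc i) x"
      then show ?thesis using e(1)[OF x, of "Suc i"] by simp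
    next
      assume "\<exists>a\<in>A. h (Suc i) x = h i (p a) + d a x"
      then obtain a where a: "a \<in> A" "h (Suc i) x = h i (p a) + d a x" by blast
      then show ?thesis
        using Suc pS[OF a(1)] x m(1)[of a x] QmetricD(2)[OF S(1), of a x] real_subgroupD(3)[OF Q] hle(1)[of i x] by auto
    qed
    have 2: "h (Suc i) x \<le> h (Suc i) y + d x y" if x: "x \<in> S" and y: "y \<in> S" for x y
      using hin[of i y]
    proof
      assume "h (Suc i) y = e (Suc i) y"
      then show ?thesis using e(2)[OF x y, of "Suc i"] hle(1)[of i x] by simp
    next
      assume "\<exists>a\<in>A. h (Suc i) y = h i (p a) + d a y"
      then obtain a where a: "a \<in> A" "h (Suc i) y = h i (p a) + d a y" by blast
      then show ?thesis
        using hle(2)[OF a(1), of i x] m(5)[OF pS(2)[OF a(1)] y x] m(2)[OF x y] by simp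
    qed
    show ?case using 1 2 by blast
  qed
  have step: "h (Suc i) a = h i (p a)" if a: "a \<in> A" for i a
  proof (rule antisym)
    show "h (Suc i) a \<le> h i (p a)" using hle(2)[OF a, of i a] m(4)[of a] pS[OF a] by simp
    show "h i (p a) \<le> h (Suc i) a"
      using hin[of i a]
    proof
      assume "h (Suc i) a = e (Suc i) a"
      then show ?thesis using e(3)[OF a] I[of i] pS[OF a] by auto
    next
      assume "\<exists>b\<in>A. h (Suc i) a = h i (p b) + d b a"
      then obtain b where b: "b \<in> A" "h (Suc i) a = h i (p b) + d b a" by blast
      have "h i (p a) \<le> h i (p b) + d (p a) (p b)" using I[of i] pS[OF a] pS[OF b(1)] by blast
      then show ?thesis using b(2) pS[OF a] pS[OF b(1)] pd[OF a b(1)] m(2)[of a b] by simp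
    qed
  qed
  define C where "C = {x \<in> S. \<forall>n. (p ^^ n) x \<in> A}"
  have CA: "x \<in> A" if "x \<in> C" for x using that by (auto simp: C_def dest: spec[of _ 0])
  have Cp: "p x \<in> C \<longleftrightarrow> x \<in> C" if "x \<in> A" for x
  proof
    assume "x \<in> C" then show "p x \<in> C"
      using pS[OF that] by (auto simp: C_def funpow_swap1 dest: spec[of _ "Suc _"])
  next
    assume c: "p x \<in> C"
    have "(p ^^ n) x \<in> A" for n
      using c that by (cases n) (auto simp: C_def funpow_swap1)
    then show "x \<in> C" using pS[OF that] by (simp add: C_def)
  qed
  have hC: "h i x = e i x" if "x \<in> C" for i x
    using that
  proof (induction i arbitrary: x)
    case 0
    then show ?case using agree by (simp add: h C_def)
  next
    case (Suc i)
    then show ?case using step[OF CA] e(3)[OF CA] Cp[OF CA] by simp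
  qed
  define len where "len x = (LEAST n. (p ^^ n) x \<notin> A)" for x
  have lenS: "len x = Suc (len (p x))" if x: "x \<in> A" "x \<notin> C" for x
  proof -
    obtain n where "(p ^^ n) x \<notin> A" using x pS by (auto simp: C_def)
    then show ?thesis using Least_Suc[of "\<lambda>n. (p ^^ n) x \<notin> A"] x(1) by (simp add: len_def funpow_swap1)
  qed
  obtain N where N: "\<And>x. x \<in> S \<Longrightarrow> len x \<le> N"
    using S(2) by (metis finite_imageI finite_nat_set_iff_bounded_le imageI)
  obtain \<epsilon> where \<epsilon>: "\<epsilon> > 0" "\<And>x y. x \<in> S \<Longrightarrow> y \<in> S \<Longrightarrow> x \<noteq> y \<Longrightarrow> \<epsilon> \<le> d x y"
  proof
    let ?M = "insert 1 ((\<lambda>(x, y). d x y) ` {(x, y). x \<in> S \<and> y \<in> S \<and> x \<noteq> y})"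
    have "finite {(x, y). x \<in> S \<and> y \<in> S \<and> x \<noteq> y}" using S(2) by (auto intro: finite_subset[of _ "S \<times> S"])
    then have f: "finite ?M" by simp
    have "Min ?M \<in> ?M" using f by (intro Min_in) auto
    then show "0 < Min ?M" using m(1,3) by (force simp: less_le)
    fix x y assume "x \<in> S" "y \<in> S" "x \<noteq> y"
    then show "Min ?M \<le> d x y" using f by (intro Min_le) auto
  qed
  define \<delta> where "\<delta> = \<epsilon> / (N + 1)"
  have \<delta>: "\<delta> > 0" "\<delta> * (N + 1) = \<epsilon>" using \<epsilon>(1) by (auto simp: \<delta>_def)
  (* Following p shortens len by one, and a change of points pays \<epsilon> = \<delta> * (N + 1), which makes up
     for any increase of len; so the deviation from e drives the value up at the rate \<delta>. *)
  have grow: "h i x = e i x \<or> x \<notin> C \<and> \<delta> * (real i - real (len x)) \<le> h i x" if "x \<in> S" for i x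
    using that
  proof (induction i arbitrary: x)
    case 0
    have "\<delta> * (0 - real (len x)) \<le> 0" using \<delta> by (simp add: mult_nonneg_nonneg)
    moreover have "0 \<le> h 0 x" using I 0 by blast
    ultimately show ?case using hC[of x 0] by force
  next
    case (Suc i)
    show ?case
    proof (cases "x \<in> C \<or> h (Suc i) x = e (Suc i) x")
      case True
      then show ?thesis using hC by blast
    next
      case F: False
      then obtain a where a: "a \<in> A" "h (Suc i) x = h i (p a) + d a x" using hin[of i x] by blast
      have "h i (p a) \<noteq> e i (p a)"
        using e(3)[OF a(1), of i] e(2)[OF Suc.prems pS(2)[OF a(1)], of "Suc i"] F hle(1)[of i x] a(2)
          m(2)[OF Suc.prems pS(2)[OF a(1)]] by auto
      then have ih: "p a \<notin> C" "\<delta> * (real i - real (len (p a))) \<le> h i (p a)"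
        using Suc.IH[OF pS(1)[OF a(1)]] by auto
      have "\<delta> * (real (Suc i) - real (len x)) \<le> h (Suc i) x"
      proof (cases "a = x")
        case True
        then show ?thesis using lenS[of x] a F ih(2) m(1)[OF Suc.prems Suc.prems] by auto
      next
        case False
        have "\<epsilon> \<le> d a x" using \<epsilon>(2) pS(2)[OF a(1)] Suc.prems False by blast
        moreover have "\<delta> * (real (Suc i) - real (len x)) \<le> \<delta> * ((real i - real (len (p a))) + (N + 1))"
          using \<delta>(1) N[OF pS(1)[OF a(1)]] by (intro mult_left_mono) auto
        ultimately show ?thesis using ih(2) a(2) \<delta>(2) by (simp add: distrib_left)
      qed
      then show ?thesis using F by blast
    qed
  qed
  obtain k :: nat where k: "D / \<delta> + N < k" using reals_Archimedean2 by blast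
  have "h i x = e i x" if i: "i \<ge> k" and x: "x \<in> S" for i x
  proof (rule ccontr)
    assume "h i x \<noteq> e i x"
    then have "\<delta> * (real i - real (len x)) \<le> D" using grow[OF x, of i] I[of i] e(1)[OF x, of i] x by force
    then have "real i - real (len x) \<le> D / \<delta>" using \<delta>(1) by (simp add: field_simps)
    then show False using k i N[OF x] by linarith
  qed
  then show ?thesis using h(1) I step by (intro exI[of _ h] exI[of _ k]) blast
qed

text \<open>For every \<open>s\<close> in \<open>S\<close> there is a closed sequence of distance prescriptions, from the distances of \<open>s\<close> back to
themselves, that is compatible with \<open>p\<close>, and one length \<open>M\<close> serves all \<open>s\<close>. The part \<open>C\<close> on which \<open>p\<close> can be
iterated for ever is permuted by \<open>p\<close> with some period \<open>L\<close>; it determines a profile \<open>e\<close> of period \<open>L\<close>, the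
largest 1-Lipschitz function bounded by the diameter with the right values on \<open>C\<close>. Extending forwards from
\<open>s\<close> along \<open>p\<close>, and backwards along the inverse of \<open>p\<close>, both sequences run into this profile, and the two
halves can be joined.\<close>

lemma cyclic_extensions:
  assumes Q: "real_subgroup Q" and S: "Qmetric Q S d" "finite S"
    and p: "A \<subseteq> S" "p ` A \<subseteq> S" "isometry_on A d d p"
  shows "\<exists>M>0. \<forall>s\<in>S. \<exists>h :: nat \<Rightarrow> 'a \<Rightarrow> real.
           (\<forall>x\<in>S. h 0 x = d s x \<and> h M x = d s x) \<and> (\<forall>j\<le>M. \<forall>x\<in>S. h j x \<in> Q) \<and>
           (\<forall>j\<le>M. \<forall>x\<in>S. \<forall>y\<in>S. h j x \<le> h j y + d x y) \<and> (\<forall>j<M. \<forall>a\<in>A. h (Suc j) a = h j (p a))"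
proof -
  note m = metric_onD[OF QmetricD(1)[OF S(1)]]
  have pS: "p a \<in> S" "a \<in> S" if "a \<in> A" for a using p that by auto
  have pd: "d (p a) (p b) = d a b" if "a \<in> A" "b \<in> A" for a b using p(3) that by (simp add: isometry_on_def)
  have inj: "inj_on p A"
    using isometry_on_inj[OF QmetricD(1)[OF Qmetric_subset[OF S(1) p(1)]] QmetricD(1)[OF S(1)] p(2,3)] .
  define C where "C = {x \<in> S. \<forall>n. (p ^^ n) x \<in> A}"
  have CA: "C \<subseteq> A" by (auto simp: C_def dest: spec[of _ 0])
  have CS: "C \<subseteq> S" and Cf: "finite C" using S(2) by (auto simp: C_def)
  have pC: "p ` C \<subseteq> C"
  proof clarify
    fix x assume x: "x \<in> C"
    have "(p ^^ n) (p x) \<in> A" for n using x by (auto simp: C_def funpow_swap1 dest: spec[of _ "Suc n"])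
    then show "p x \<in> C" using x CA pS by (auto simp: C_def)
  qed
  have injC: "inj_on p C" using inj CA inj_on_subset by blast
  have pC': "p ` C = C" using endo_inj_surj[OF Cf pC injC] .
  obtain L where L: "L > 0" "\<And>x. x \<in> C \<Longrightarrow> (p ^^ L) x = x"
    using finite_injection_period[OF Cf injC pC] by blast
  have pnC: "(p ^^ n) c \<in> C" if "c \<in> C" for c n using that pC by (induction n) auto
  define D where "D = Max (insert 0 ((\<lambda>(x, y). d x y) ` (S \<times> S)))"
  have D: "d x y \<le> D" if "x \<in> S" "y \<in> S" for x y
    unfolding D_def using S(2) that by (intro Max_ge) auto
  have DQ: "D \<in> Q" "0 \<le> D"
  proof -
    have "D \<in> insert 0 ((\<lambda>(x, y). d x y) ` (S \<times> S))" unfolding D_def using S(2) by (intro Max_in) auto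
    then show "D \<in> Q" using real_subgroupD(1)[OF Q] QmetricD(2)[OF S(1)] by auto
    show "0 \<le> D" unfolding D_def using S(2) by (intro Max_ge) auto
  qed
  define W where "W s i x = insert D ((\<lambda>c. d s ((p ^^ i) c) + d c x) ` C)" for s i x
  define e where "e s i x = Min (W s i x)" for s i x
  have Wf: "finite (W s i x)" "W s i x \<noteq> {}" for s i x using Cf by (auto simp: W_def)
  have eD: "e s i x \<le> D" and ec: "c \<in> C \<Longrightarrow> e s i x \<le> d s ((p ^^ i) c) + d c x" for s i x c
    unfolding e_def using Min_le[OF Wf(1)] by (auto simp: W_def)
  have ein: "e s i x = D \<or> (\<exists>c\<in>C. e s i x = d s ((p ^^ i) c) + d c x)" for s i x
    using Min_in[OF Wf] by (auto simp: e_def W_def)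
  have eQ: "e s i x \<in> Q \<and> 0 \<le> e s i x \<and> e s i x \<le> D" if "s \<in> S" "x \<in> S" for s i x
    using ein[of s i x]
  proof
    assume "\<exists>c\<in>C. e s i x = d s ((p ^^ i) c) + d c x"
    then obtain c where c: "c \<in> C" "e s i x = d s ((p ^^ i) c) + d c x" by blast
    have "(p ^^ i) c \<in> S" "c \<in> S" using pnC c(1) CS by auto
    then show ?thesis using that c(2) eD[of s i x] m(1) QmetricD(2)[OF S(1)] real_subgroupD(3)[OF Q] by (simp add: add_nonneg_nonneg)
  qed (use DQ in simp)
  have eLip: "e s i x \<le> e s i y + d x y" if xy: "s \<in> S" "x \<in> S" "y \<in> S" for s i x y
    using ein[of s i y]
  proof
    assume "e s i y = D"
    then show ?thesis using eD[of s i x] m(1)[OF xy(2,3)] by simp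
  next
    assume "\<exists>c\<in>C. e s i y = d s ((p ^^ i) c) + d c y"
    then obtain c where c: "c \<in> C" "e s i y = d s ((p ^^ i) c) + d c y" by blast
    then show ?thesis using ec[OF c(1), of s i x] m(5)[of c y x] m(2)[of y x] xy CS by auto
  qed
  have eS: "e s (Suc i) a = e s i (p a)" if a: "a \<in> A" for s i a
  proof -
    have "(\<lambda>c. d s ((p ^^ i) c) + d c (p a)) ` C = (\<lambda>c. d s ((p ^^ i) c) + d c (p a)) ` p ` C" by (simp add: pC')
    also have "\<dots> = (\<lambda>c. d s ((p ^^ Suc i) c) + d c a) ` C"
      unfolding image_image using CA a by (intro image_cong) (auto simp: pd funpow_swap1)
    finally show ?thesis by (simp add: e_def W_def)
  qed
  have eL: "e s (i + L) x = e s i x" for s i x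
  proof -
    have "(\<lambda>c. d s ((p ^^ (i + L)) c) + d c x) ` C = (\<lambda>c. d s ((p ^^ i) c) + d c x) ` C"
      using L(2) by (intro image_cong) (auto simp: funpow_add)
    then show ?thesis by (simp add: e_def W_def)
  qed
  have eLn: "e s (i + L * n) x = e s i x" for s i x n
  proof (induction n)
    case (Suc n)
    then show ?case using eL[of s "i + L * n" x] by (simp add: algebra_simps)
  qed simp
  have le: "d s x \<le> e s 0 x" if sx: "s \<in> S" "x \<in> S" for s x
    using ein[of s 0 x]
  proof
    assume "\<exists>c\<in>C. e s 0 x = d s ((p ^^ 0) c) + d c x"
    then obtain c where c: "c \<in> C" "e s 0 x = d s c + d c x" by auto
    then show ?thesis using m(5)[of s c x] sx CS by auto
  qed (use D[OF sx] in simp)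
  have agree: "d s x = e s 0 x" if "s \<in> S" "x \<in> C" for s x
    using le[OF that(1)] ec[OF that(2), of s 0 x] that CS m(4)[of x] by (intro antisym) auto
  define A' where "A' = p ` A"
  define p' where "p' = inv_into A p"
  have p': "p' b \<in> A" "p (p' b) = b" if "b \<in> A'" for b
    using that by (auto simp: A'_def p'_def inv_into_into f_inv_into_f)
  have p'S: "A' \<subseteq> S" "p' ` A' \<subseteq> S" "isometry_on A' d d p'"
  proof -
    show "A' \<subseteq> S" "p' ` A' \<subseteq> S" using p'(1) pS by (auto simp: A'_def)
    show "isometry_on A' d d p'"
      unfolding isometry_on_def
    proof (intro ballI)
      fix b c assume b: "b \<in> A'" and c: "c \<in> A'"
      show "d (p' b) (p' c) = d b c" using pd[OF p'(1)[OF b] p'(1)[OF c]] by (simp add: p'(2)[OF b] p'(2)[OF c])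
    qed
  qed
  (* The profile read backwards: L - 1 is congruent to -1 modulo the period L. *)
  define e' where "e' s i = e s ((L - 1) * i)" for s i
  have e'S: "e' s (Suc i) b = e' s i (p' b)" if b: "b \<in> A'" for s i b
  proof -
    have "e' s (Suc i) b = e s (Suc ((L - 1) * Suc i)) (p' b)"
      using eS[OF p'(1)[OF b]] p'(2)[OF b] by (simp add: e'_def)
    also have "Suc ((L - 1) * Suc i) = (L - 1) * i + L" using L(1) by (cases L) simp_all
    finally show ?thesis by (simp add: eL e'_def)
  qed
  have agree': "d s x = e' s 0 x" if s: "s \<in> S" and x: "x \<in> S" "\<And>n. (p' ^^ n) x \<in> A'" for s x
  proof -
    define C' where "C' = {x \<in> S. \<forall>n. (p' ^^ n) x \<in> A'}"
    have C'A: "C' \<subseteq> A'" by (auto simp: C'_def dest: spec[of _ 0])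
    have p'C: "p' ` C' \<subseteq> C'"
    proof clarify
      fix x assume x: "x \<in> C'"
      have "(p' ^^ n) (p' x) \<in> A'" for n using x by (auto simp: C'_def funpow_swap1 dest: spec[of _ "Suc n"])
      then show "p' x \<in> C'" using x C'A p'(1) pS(2) by (auto simp: C'_def)
    qed
    have "inj_on p' C'" using p'(2) C'A by (metis inj_onI subsetD)
    moreover have "finite C'" using S(2) by (simp add: C'_def)
    ultimately have img: "p' ` C' = C'" using endo_inj_surj p'C by blast
    have cl: "x \<in> A \<and> p x \<in> C'" if "x \<in> C'" for x
      using that img p' C'A by (metis image_iff subsetD)
    have "(p ^^ n) x \<in> C'" if "x \<in> C'" for n x
      using that by (induction n) (auto simp: cl)
    then have "x \<in> C" if "x \<in> C'" for x using that cl by (auto simp: C_def C'_def)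
    moreover have "x \<in> C'" using x by (simp add: C'_def)
    ultimately show ?thesis using agree[OF s] by (simp add: e'_def)
  qed
  define R where "R A p e s h k \<longleftrightarrow> h 0 = d s \<and> (\<forall>i. \<forall>x\<in>S. h i x \<in> Q) \<and>
      (\<forall>i. \<forall>x\<in>S. \<forall>y\<in>S. h i x \<le> h i y + d x y) \<and>
      (\<forall>i. \<forall>a\<in>A. h (Suc i) a = h i (p a)) \<and> (\<forall>i\<ge>k. \<forall>x\<in>S. h i x = e s i x)"
    for A p e s and h :: "nat \<Rightarrow> 'a \<Rightarrow> real" and k :: nat
  have "\<exists>h k. R A p e s h k" if s: "s \<in> S" for s
    unfolding R_def
  proof (rule forward_extensions[OF Q S p, where D = D])
    show "d s x \<in> Q \<and> 0 \<le> d s x" if "x \<in> S" for x using s that m(1) QmetricD(2)[OF S(1)] by blast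
    show "d s x \<le> d s y + d x y" if "x \<in> S" "y \<in> S" for x y using m(5)[OF s that(2,1)] m(2)[OF that] by simp
    show "d s x = e s 0 x" if "x \<in> S" "\<And>n. (p ^^ n) x \<in> A" for x using agree[OF s] that by (simp add: C_def)
  qed (use s eQ eLip eS le in auto)
  then obtain f k where F: "\<And>s. s \<in> S \<Longrightarrow> R A p e s (f s) (k s)" by metis
  have f: "\<And>s. s \<in> S \<Longrightarrow> f s 0 = d s" "\<And>s i x. s \<in> S \<Longrightarrow> x \<in> S \<Longrightarrow> f s i x \<in> Q"
      "\<And>s i x y. s \<in> S \<Longrightarrow> x \<in> S \<Longrightarrow> y \<in> S \<Longrightarrow> f s i x \<le> f s i y + d x y"
      "\<And>s i a. s \<in> S \<Longrightarrow> a \<in> A \<Longrightarrow> f s (Suc i) a = f s i (p a)"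
      "\<And>s i x. s \<in> S \<Longrightarrow> i \<ge> k s \<Longrightarrow> x \<in> S \<Longrightarrow> f s i x = e s i x"
    using F unfolding R_def by simp_all
  have "\<exists>h k. R A' p' e' s h k" if s: "s \<in> S" for s
    unfolding R_def
  proof (rule forward_extensions[OF Q S p'S, where D = D])
    show "d s x \<in> Q \<and> 0 \<le> d s x" if "x \<in> S" for x using s that m(1) QmetricD(2)[OF S(1)] by blast
    show "d s x \<le> d s y + d x y" if "x \<in> S" "y \<in> S" for x y using m(5)[OF s that(2,1)] m(2)[OF that] by simp
    show "d s x = e' s 0 x" if "x \<in> S" "\<And>n. (p' ^^ n) x \<in> A'" for x using agree'[OF s] that by blast
    show "d s x \<le> e' s 0 x" if "x \<in> S" for x using le[OF s that] by (simp add: e'_def)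
    show "e' s i x \<in> Q \<and> 0 \<le> e' s i x \<and> e' s i x \<le> D" if "x \<in> S" for i x using eQ[OF s that] by (simp add: e'_def)
    show "e' s i x \<le> e' s i y + d x y" if "x \<in> S" "y \<in> S" for i x y using eLip[OF s that] by (simp add: e'_def)
  qed (rule e'S)
  then obtain g k' where G: "\<And>s. s \<in> S \<Longrightarrow> R A' p' e' s (g s) (k' s)" by metis
  have g: "\<And>s. s \<in> S \<Longrightarrow> g s 0 = d s" "\<And>s i x. s \<in> S \<Longrightarrow> x \<in> S \<Longrightarrow> g s i x \<in> Q"
      "\<And>s i x y. s \<in> S \<Longrightarrow> x \<in> S \<Longrightarrow> y \<in> S \<Longrightarrow> g s i x \<le> g s i y + d x y"
      "\<And>s i a. s \<in> S \<Longrightarrow> a \<in> A' \<Longrightarrow> g s (Suc i) a = g s i (p' a)"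
      "\<And>s i x. s \<in> S \<Longrightarrow> i \<ge> k' s \<Longrightarrow> x \<in> S \<Longrightarrow> g s i x = e' s i x"
    using G unfolding R_def by simp_all
  obtain K where K: "\<And>s. s \<in> S \<Longrightarrow> k s \<le> K" "\<And>s. s \<in> S \<Longrightarrow> k' s \<le> K"
  proof -
    have "finite (k ` S \<union> k' ` S)" using S(2) by simp
    then obtain K where "\<forall>n\<in>k ` S \<union> k' ` S. n \<le> K" using finite_nat_set_iff_bounded_le by blast
    then show ?thesis by (intro that[of K]) auto
  qed
  (* A multiple of the period, so that the forward and the backward profile match, and long enough
     for both halves to have reached the profile. *)
  define M where "M = L * (2 * K + 1)"
  have "2 * K + 1 \<le> M" unfolding M_def using L(1) by (cases L) simp_all
  then have MK: "M > 0" "M - K \<ge> K" "K \<le> M" "M - K < M \<or> K = 0" by auto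
  define h where "h s j = (if j \<le> M - K then f s j else g s (M - j))" for s j
  have meet: "f s (M - K) x = g s K x" if "s \<in> S" "x \<in> S" for s x
  proof -
    have "e s (M - K) x = e s (M - K + L * K) x" by (simp add: eLn)
    also have "M - K + L * K = (L - 1) * K + M" using MK(3) L(1) by (cases L) simp_all
    also have "e s ((L - 1) * K + M) x = e s ((L - 1) * K) x" unfolding M_def by (rule eLn)
    finally show ?thesis using f(5)[OF that(1)] g(5)[OF that(1)] K[OF that(1)] MK(2) that(2) by (simp add: e'_def)
  qed
  have gb: "g s (Suc i) (p a) = g s i a" if "s \<in> S" "a \<in> A" for s i a
    using g(4)[OF that(1), of "p a" i] that(2) inj by (simp add: A'_def p'_def)
  have hS: "h s (Suc j) a = h s j (p a)" if s: "s \<in> S" and j: "j < M" and a: "a \<in> A" for s j a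
  proof -
    consider "Suc j \<le> M - K" | "j = M - K" | "j > M - K" by linarith
    then show ?thesis
    proof cases
      case 1
      then show ?thesis using f(4)[OF s a] by (simp add: h_def)
    next
      case 2
      have KS: "Suc (M - Suc j) = K" using 2 j MK by simp
      have "h s (Suc j) a = g s (M - Suc j) a" using 2 by (simp add: h_def)
      also have "\<dots> = g s K (p a)" using gb[OF s a, of "M - Suc j"] unfolding KS by (rule sym)
      also have "\<dots> = h s j (p a)" using meet[OF s pS(1)[OF a]] 2 by (simp add: h_def)
      finally show ?thesis .
    next
      case 3
      have KS: "Suc (M - Suc j) = M - j" using j by simp
      have "g s (M - j) (p a) = g s (M - Suc j) a" using gb[OF s a, of "M - Suc j"] unfolding KS .
      then show ?thesis using 3 by (simp add: h_def)
    qed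
  qed
  show ?thesis
  proof (intro exI[of _ M] conjI ballI)
    fix s assume s: "s \<in> S"
    have "h s M x = d s x" if "x \<in> S" for x
      using g(1)[OF s] meet[OF s that] MK by (cases "K = 0") (auto simp: h_def)
    then show "\<exists>h. (\<forall>x\<in>S. h 0 x = d s x \<and> h M x = d s x) \<and> (\<forall>j\<le>M. \<forall>x\<in>S. h j x \<in> Q) \<and>
           (\<forall>j\<le>M. \<forall>x\<in>S. \<forall>y\<in>S. h j x \<le> h j y + d x y) \<and> (\<forall>j<M. \<forall>a\<in>A. h (Suc j) a = h j (p a))"
      using f(1,2,3)[OF s] g(2,3)[OF s] hS[OF s] by (intro exI[of _ "h s"]) (auto simp: h_def)
  qed (use MK in simp)
qed

text \<open>Let \<open>V\<close> be the space of \<open>Q\<close>-valued functions on \<open>S \<times> {..<M}\<close> with the maximum distance. The cyclic shift \<open>\<phi>\<close>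
of the second coordinate is an isometry of finite order. The cyclic prescriptions \<open>H s j\<close> define a
Kuratowski-style embedding \<open>\<iota> x = (\<lambda>(s, j). H s j x)\<close> of \<open>S\<close> that turns \<open>p\<close> into \<open>\<phi>\<close>: the coordinates with \<open>j = 0\<close>
make it isometric, and compatibility with \<open>p\<close> says \<open>\<iota> (p a) = \<phi> (\<iota> a)\<close>. The finitely many translates of \<open>\<iota> ` S\<close>
form an invariant finite space, which is embedded back into \<open>Y\<close> over \<open>S\<close>.\<close>

lemma partial_isometry_extends_to_finite_isometry:
  assumes Q: "real_subgroup Q" and Y: "Qmetric Q Y d" "one_point_extensions Q Y d"
    and S: "finite S" "S \<subseteq> Y" "S \<noteq> {}" and p: "A \<subseteq> S" "p ` A \<subseteq> S" "isometry_on A d d p"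
  shows "\<exists>E q. finite E \<and> S \<subseteq> E \<and> E \<subseteq> Y \<and> q ` E = E \<and> isometry_on E d d q \<and> (\<forall>x\<in>A. q x = p x)"
proof -
  have QS: "Qmetric Q S d" using Y(1) S(2) by (rule Qmetric_subset)
  note m = metric_onD[OF QmetricD(1)[OF QS]]
  define R where "R M s h \<longleftrightarrow> (\<forall>x\<in>S. h 0 x = d s x \<and> h M x = d s x) \<and> (\<forall>j\<le>M. \<forall>x\<in>S. h j x \<in> Q) \<and>
      (\<forall>j\<le>M. \<forall>x\<in>S. \<forall>y\<in>S. h j x \<le> h j y + d x y) \<and> (\<forall>j<M. \<forall>a\<in>A. h (Suc j) a = h j (p a))"
    for M s and h :: "nat \<Rightarrow> 'a \<Rightarrow> real"
  obtain M where M: "M > 0" and "\<forall>s\<in>S. \<exists>h. R M s h"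
    using cyclic_extensions[OF Q QS S(1) p] unfolding R_def by blast
  from bchoice[OF this(2)] obtain H where RH: "\<forall>s\<in>S. R M s (H s)" by blast
  have H: "\<And>s x. s \<in> S \<Longrightarrow> x \<in> S \<Longrightarrow> H s 0 x = d s x \<and> H s M x = d s x"
    "\<And>s j x. s \<in> S \<Longrightarrow> j \<le> M \<Longrightarrow> x \<in> S \<Longrightarrow> H s j x \<in> Q"
    "\<And>s j x y. s \<in> S \<Longrightarrow> j \<le> M \<Longrightarrow> x \<in> S \<Longrightarrow> y \<in> S \<Longrightarrow> H s j x \<le> H s j y + d x y"
    "\<And>s j a. s \<in> S \<Longrightarrow> j < M \<Longrightarrow> a \<in> A \<Longrightarrow> H s (Suc j) a = H s j (p a)"
    using RH unfolding R_def by simp_all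
  define I where "I = S \<times> {..<M}"
  have I: "finite I" "I \<noteq> {}" using S M by (auto simp: I_def)
  define V where "V = {v :: 'a \<times> nat \<Rightarrow> real. (\<forall>k. k \<notin> I \<longrightarrow> v k = 0) \<and> (\<forall>k\<in>I. v k \<in> Q)}"
  have V0: "v k = 0" if "v \<in> V" "k \<notin> I" for v k using that unfolding V_def by blast
  define dV where "dV v w = Max ((\<lambda>k. \<bar>v k - w k\<bar>) ` I)" for v w :: "'a \<times> nat \<Rightarrow> real"
  have dV_ge: "\<bar>v k - w k\<bar> \<le> dV v w" if "k \<in> I" for v w k
    unfolding dV_def using I that by (intro Max_ge) auto
  have dV_le: "dV v w \<le> r \<longleftrightarrow> (\<forall>k\<in>I. \<bar>v k - w k\<bar> \<le> r)" for v w r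
    unfolding dV_def using I by (subst Max_le_iff) auto
  have dV_in: "\<exists>k\<in>I. dV v w = \<bar>v k - w k\<bar>" for v w
  proof -
    have "dV v w \<in> (\<lambda>k. \<bar>v k - w k\<bar>) ` I" unfolding dV_def using I by (intro Max_in) auto
    then show ?thesis by blast
  qed
  have V: "Qmetric Q V dV"
    unfolding Qmetric_def metric_on_def
  proof (intro conjI ballI)
    fix v w assume vw: "v \<in> V" "w \<in> V"
    show "0 \<le> dV v w" using dV_in[of v w] by auto
    show "dV v w = dV w v" by (simp add: dV_def abs_minus_commute)
    obtain k where k: "k \<in> I" "dV v w = \<bar>v k - w k\<bar>" using dV_in[of v w] by blast
    then have "v k - w k \<in> Q" using vw real_subgroupD(2)[OF Q] by (simp add: V_def)
    then show "dV v w \<in> Q" using k(2) real_subgroupD(4)[OF Q] by simp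
    show "(dV v w = 0) = (v = w)"
    proof
      assume 0: "dV v w = 0"
      have "v k = w k" for k using dV_ge[of k v w] 0 V0[OF vw(1)] V0[OF vw(2)] by (cases "k \<in> I") auto
      then show "v = w" by blast
    qed (use dV_in[of v w] in auto)
    fix u assume "u \<in> V"
    show "dV v u \<le> dV v w + dV w u"
      unfolding dV_le
    proof
      fix k assume k: "k \<in> I"
      have "\<bar>v k - u k\<bar> \<le> \<bar>v k - w k\<bar> + \<bar>w k - u k\<bar>" by arith
      then show "\<bar>v k - u k\<bar> \<le> dV v w + dV w u" using dV_ge[OF k, of v w] dV_ge[OF k, of w u] by simp
    qed
  qed
  define \<iota> where "\<iota> x = (\<lambda>(s, j). if s \<in> S \<and> j < M then H s j x else 0)" for x
  define \<phi> where "\<phi> v = (\<lambda>(s, j). if s \<in> S \<and> j < M then v (s, Suc j mod M) else 0)" for v :: "'a \<times> nat \<Rightarrow> real"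
  have \<iota>V: "\<iota> x \<in> V" if "x \<in> S" for x using that H(2) by (auto simp: \<iota>_def V_def I_def)
  have \<phi>V: "\<phi> v \<in> V" if "v \<in> V" for v using that M by (auto simp: \<phi>_def V_def I_def)
  have \<phi>n: "(\<phi> ^^ n) v \<in> V \<and> (\<forall>s\<in>S. \<forall>j<M. (\<phi> ^^ n) v (s, j) = v (s, (j + n) mod M))" if "v \<in> V" for v n
  proof (induction n)
    case (Suc n)
    then show ?case using \<phi>V M by (auto simp: \<phi>_def mod_simps)
  qed (use that in simp)
  have \<phi>M: "(\<phi> ^^ M) v = v" if "v \<in> V" for v
  proof
    fix k
    show "(\<phi> ^^ M) v k = v k"
    proof (cases "k \<in> I")
      case True
      then show ?thesis using \<phi>n[OF that, of M] by (auto simp: I_def)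
    next
      case False
      then show ?thesis using \<phi>n[OF that, of M] V0 that by metis
    qed
  qed
  have \<phi>iso: "dV (\<phi> v) (\<phi> w) = dV v w" if "v \<in> V" "w \<in> V" for v w
  proof -
    have le: "dV (\<phi> v) (\<phi> w) \<le> dV v w" for v w
      unfolding dV_le using dV_ge[of _ v w] M by (auto simp: \<phi>_def I_def)
    have "dV ((\<phi> ^^ n) v) ((\<phi> ^^ n) w) \<le> dV (\<phi> v) (\<phi> w)" if "n > 0" for n
      using that
    proof (induction n rule: nat_induct_non_zero)
      case (Suc n)
      then show ?case using le[of "(\<phi> ^^ n) v" "(\<phi> ^^ n) w"] by simp
    qed simp
    from this[OF M] show ?thesis using le[of v w] \<phi>M that by simp
  qed
  have \<iota>iso: "dV (\<iota> x) (\<iota> y) = d x y" if "x \<in> S" "y \<in> S" for x y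
  proof (rule antisym)
    show "dV (\<iota> x) (\<iota> y) \<le> d x y"
      unfolding dV_le
    proof
      fix k assume "k \<in> I"
      then obtain s j where k: "k = (s, j)" "s \<in> S" "j < M" by (auto simp: I_def)
      have "H s j x \<le> H s j y + d x y" "H s j y \<le> H s j x + d y x"
        using k that by (auto intro!: H(3))
      then show "\<bar>\<iota> x k - \<iota> y k\<bar> \<le> d x y" using m(2)[OF that] k by (simp add: \<iota>_def abs_le_iff)
    qed
    show "d x y \<le> dV (\<iota> x) (\<iota> y)"
      using dV_ge[of "(x, 0)" "\<iota> x" "\<iota> y"] that M H(1)[of x] m(4)[of x] m(1)[of x y] by (simp add: \<iota>_def I_def)
  qed
  have \<iota>p: "\<iota> (p a) = \<phi> (\<iota> a)" if a: "a \<in> A" for a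
  proof
    fix k :: "'a \<times> nat"
    obtain s j where k: "k = (s, j)" by fastforce
    have aS: "a \<in> S" using a p by blast
    show "\<iota> (p a) k = \<phi> (\<iota> a) k"
    proof (cases "s \<in> S \<and> j < M")
      case True
      then show ?thesis
        using H(4)[of s j a] H(1)[of s a] a aS M by (cases "Suc j = M") (auto simp: \<iota>_def \<phi>_def k)
    next
      case False
      then show ?thesis by (auto simp: \<iota>_def \<phi>_def k)
    qed
  qed
  define E where "E = (\<Union>n<M. (\<phi> ^^ n) ` \<iota> ` S)"
  have EV: "E \<subseteq> V" using \<phi>n \<iota>V by (auto simp: E_def)
  have fE: "finite E" using S(1) by (simp add: E_def)
  have SE: "\<iota> ` S \<subseteq> E" using M by (auto simp: E_def intro!: bexI[of _ 0])
  have \<phi>E: "\<phi> ` E \<subseteq> E"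
  proof clarify
    fix v assume "v \<in> E"
    then obtain n x where v: "n < M" "x \<in> S" "v = (\<phi> ^^ n) (\<iota> x)" by (auto simp: E_def)
    show "\<phi> v \<in> E"
    proof (cases "Suc n = M")
      case True
      then have "\<phi> v = (\<phi> ^^ M) (\<iota> x)" using v(3) by auto
      then show ?thesis using \<phi>M[OF \<iota>V[OF v(2)]] v(2) SE by auto
    next
      case False
      then have "Suc n \<in> {..<M}" "\<phi> v = (\<phi> ^^ Suc n) (\<iota> x)" using v by auto
      then show ?thesis using v(2) unfolding E_def by blast
    qed
  qed
  have QE: "Qmetric Q E dV" using V EV by (rule Qmetric_subset)
  have \<iota>inj: "inj_on \<iota> S"
    using isometry_on_inj[OF QmetricD(1)[OF QS] QmetricD(1)[OF QE] SE] \<iota>iso by (auto simp: isometry_on_def)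
  have "\<exists>\<kappa>. \<kappa> ` E \<subseteq> Y \<and> (\<forall>x\<in>\<iota> ` S. \<kappa> x = inv_into S \<iota> x) \<and> isometry_on E dV d \<kappa>"
    using S(2,3) \<iota>inj \<iota>iso
    by (intro embed_finite[OF Y fE QE SE]) (auto simp: isometry_on_def)
  then obtain \<kappa> where \<kappa>: "\<kappa> ` E \<subseteq> Y" "\<And>x. x \<in> S \<Longrightarrow> \<kappa> (\<iota> x) = x" "isometry_on E dV d \<kappa>"
    using \<iota>inj by auto
  have \<kappa>inj: "inj_on \<kappa> E"
    using isometry_on_inj[OF QmetricD(1)[OF QE] QmetricD(1)[OF Y(1)] \<kappa>(1,3)] .
  have \<kappa>d: "d (\<kappa> v) (\<kappa> w) = dV v w" if "v \<in> E" "w \<in> E" for v w using \<kappa>(3) that by (simp add: isometry_on_def)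
  define q where "q y = \<kappa> (\<phi> (inv_into E \<kappa> y))" for y
  have q: "q (\<kappa> v) = \<kappa> (\<phi> v)" if "v \<in> E" for v using that \<kappa>inj by (simp add: q_def)
  have iso: "isometry_on (\<kappa> ` E) d d q"
    unfolding isometry_on_def using q \<kappa>d \<phi>E \<phi>iso EV by (auto simp: image_subset_iff subset_iff)
  have sub: "q ` \<kappa> ` E \<subseteq> \<kappa> ` E" using q \<phi>E by (auto simp: image_subset_iff)
  have "inj_on q (\<kappa> ` E)"
    using isometry_on_inj[OF _ _ sub iso] QmetricD(1)[OF Qmetric_subset[OF Y(1) \<kappa>(1)]] by blast
  then have "q ` \<kappa> ` E = \<kappa> ` E" using endo_inj_surj[OF finite_imageI[OF fE] sub] by blast
  moreover have "S \<subseteq> \<kappa> ` E" using \<kappa>(2) SE by (metis image_iff image_subset_iff subsetI)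
  moreover have "q x = p x" if "x \<in> A" for x
  proof -
    have x: "x \<in> S" "p x \<in> S" using that p by auto
    then have "q x = \<kappa> (\<phi> (\<iota> x))" using q[of "\<iota> x"] \<kappa>(2)[of x] SE by auto
    then show ?thesis using \<iota>p[OF that] \<kappa>(2)[OF x(2)] by simp
  qed
  ultimately show ?thesis using iso \<kappa>(1) fE by (intro exI[of _ "\<kappa> ` E"] exI[of _ q]) auto
qed

section \<open>Generic isometries\<close>

text \<open>For an invariant set \<open>B\<close>, this is what the distances must satisfy in order that \<open>f\<close> on \<open>B\<close> together with the
cycle \<open>y 0, ..., y (m - 1)\<close> be an isometry. The map \<open>f\<close> itself may act on the points \<open>y i\<close> in a different way.\<close>

definition cyclic_type :: "('a \<Rightarrow> 'a \<Rightarrow> real) \<Rightarrow> ('a \<Rightarrow> 'a) \<Rightarrow> 'a set \<Rightarrow> nat \<Rightarrow> (nat \<Rightarrow> 'a) \<Rightarrow> bool" where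
  "cyclic_type d f B m y \<longleftrightarrow>
     0 < m \<and> inj_on y {..<m} \<and> y ` {..<m} \<inter> B = {} \<and>
     (\<forall>i<m. \<forall>b\<in>B. d (y (Suc i mod m)) (f b) = d (y i) b) \<and>
     (\<forall>i<m. \<forall>j<m. d (y (Suc i mod m)) (y (Suc j mod m)) = d (y i) (y j))"

definition same_type :: "('a \<Rightarrow> 'a \<Rightarrow> real) \<Rightarrow> 'a set \<Rightarrow> nat \<Rightarrow> (nat \<Rightarrow> 'a) \<Rightarrow> (nat \<Rightarrow> 'a) \<Rightarrow> bool" where
  "same_type d B m y z \<longleftrightarrow>
     (\<forall>i<m. \<forall>b\<in>B. d (z i) b = d (y i) b) \<and> (\<forall>i<m. \<forall>j<m. d (z i) (z j) = d (y i) (y j))"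

text \<open>The space is part of the notion, so that generic isometries of two different spaces can be compared. The last
clause says that every cyclic type over a finite invariant set is the type of an actual cycle of \<open>f\<close>.
The fixed point starts the back-and-forth construction, because types over the empty set are
not considered.\<close>

definition generic_isometry :: "real set \<Rightarrow> 'a set \<Rightarrow> ('a \<Rightarrow> 'a \<Rightarrow> real) \<Rightarrow> ('a \<Rightarrow> 'a) \<Rightarrow> bool" where
  "generic_isometry Q Y d f \<longleftrightarrow>
     Qmetric Q Y d \<and> one_point_extensions Q Y d \<and> f ` Y = Y \<and> isometry_on Y d d f \<and>
     (\<exists>x\<in>Y. f x = x) \<and> (\<forall>x\<in>Y. \<exists>n>0. (f ^^ n) x = x) \<and>
     (\<forall>B m y. finite B \<and> B \<subseteq> Y \<and> B \<noteq> {} \<and> f ` B = B \<and> y ` {..<m} \<subseteq> Y \<and> cyclic_type d f B m y \<longrightarrow>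
        (\<exists>z. z ` {..<m} \<subseteq> Y \<and> (\<forall>i<m. f (z i) = z (Suc i mod m)) \<and> same_type d B m y z))"

lemma generic_isometry_realize:
  assumes "generic_isometry Q Y d f" "finite B" "B \<subseteq> Y" "B \<noteq> {}" "f ` B = B" "y ` {..<m} \<subseteq> Y" "cyclic_type d f B m y"
  shows "\<exists>z. z ` {..<m} \<subseteq> Y \<and> (\<forall>i<m. f (z i) = z (Suc i mod m)) \<and> same_type d B m y z"
  using assms unfolding generic_isometry_def by simp

definition partial_isometry :: "('a \<Rightarrow> 'a \<Rightarrow> real) \<Rightarrow> ('b \<Rightarrow> 'b \<Rightarrow> real) \<Rightarrow> ('a \<times> 'b) set \<Rightarrow> bool" where
  "partial_isometry d d' R \<longleftrightarrow> (\<forall>(x, y)\<in>R. \<forall>(x', y')\<in>R. d x x' = d' y y')"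

lemma partial_isometryD:
  "partial_isometry d d' R \<Longrightarrow> (x, y) \<in> R \<Longrightarrow> (x', y') \<in> R \<Longrightarrow> d x x' = d' y y'"
  by (auto simp: partial_isometry_def)

lemma partial_isometry_functional:
  assumes "metric_on X d" "metric_on Y d'" "R \<subseteq> X \<times> Y" "partial_isometry d d' R" "(x, y) \<in> R" "(x', y') \<in> R"
  shows "x = x' \<longleftrightarrow> y = y'"
proof -
  have "x \<in> X" "x' \<in> X" "y \<in> Y" "y' \<in> Y" using assms by auto
  then show ?thesis
    using metric_onD(3)[OF assms(1), of x x'] metric_onD(3)[OF assms(2), of y y'] partial_isometryD[OF assms(4,5,6)] by auto
qed

lemma partial_isometry_converse: "partial_isometry d d' R \<Longrightarrow> partial_isometry d' d (R\<inverse>)"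
  using partial_isometryD[of d d' R, symmetric] unfolding partial_isometry_def[of d' d] by blast

text \<open>The Rasiowa-Sikorski lemma: countably many dense requirements are met along one increasing chain of
conditions.\<close>

lemma generic_chain:
  fixes P :: "'c set \<Rightarrow> bool"
  assumes "P r" "countable I" "\<And>D r. D \<in> I \<Longrightarrow> P r \<Longrightarrow> \<exists>s. P s \<and> r \<subseteq> s \<and> D s"
  shows "\<exists>R. r \<subseteq> R 0 \<and> (\<forall>n. P (R n)) \<and> (\<forall>n. R n \<subseteq> R (Suc n)) \<and> (\<forall>D\<in>I. \<exists>n. D (R n))"
proof (cases "I = {}")
  case True
  then show ?thesis using assms(1) by (intro exI[of _ "\<lambda>_. r"]) auto
next
  case False
  have "\<exists>R. \<forall>n. (P (R n) \<and> (n = 0 \<longrightarrow> r \<subseteq> R n)) \<and> (R n \<subseteq> R (Suc n) \<and> from_nat_into I n (R (Suc n)))"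
  proof (intro dependent_nat_choice)
    show "\<exists>x. P x \<and> (0 = 0 \<longrightarrow> r \<subseteq> x)" using assms(1) by blast
    fix s and n :: nat assume "P s \<and> (n = 0 \<longrightarrow> r \<subseteq> s)"
    then show "\<exists>t. (P t \<and> (Suc n = 0 \<longrightarrow> r \<subseteq> t)) \<and> (s \<subseteq> t \<and> from_nat_into I n t)"
      using assms(3)[OF from_nat_into[OF False]] by blast
  qed
  then obtain R where R: "\<And>n. P (R n)" "r \<subseteq> R 0" "\<And>n. R n \<subseteq> R (Suc n)" "\<And>n. from_nat_into I n (R (Suc n))"
    by blast
  have "\<exists>n. D (R n)" if "D \<in> I" for D
    using from_nat_into_surj[OF assms(2) that] R(4) by metis
  then show ?thesis using R by blast
qed

lemma chain_le: "(\<And>n. R n \<subseteq> R (Suc n)) \<Longrightarrow> n \<le> m \<Longrightarrow> R n \<subseteq> (R m :: 'a set)"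
  by (rule lift_Suc_mono_le)

lemma partial_isometry_chain:
  assumes "\<And>n. R n \<subseteq> R (Suc n)" "\<And>n. partial_isometry d d' (R n)"
  shows "partial_isometry d d' (\<Union>n. R n)"
  unfolding partial_isometry_def
proof clarify
  fix x y x' y' i j assume "(x, y) \<in> R i" "(x', y') \<in> R j"
  then have "(x, y) \<in> R (max i j)" "(x', y') \<in> R (max i j)"
    using chain_le[of R, OF assms(1)] by (meson max.cobounded1 max.cobounded2 subsetD)+
  then show "d x x' = d' y y'" using assms(2) partial_isometryD by metis
qed

text \<open>A finite piece of an isomorphism from \<open>(Y, f)\<close> to \<open>(Y', f')\<close>. Closure under \<open>f\<close> and \<open>f'\<close> makes the domain
and the range finite invariant sets.\<close>

definition finite_isomorphism ::
  "'a set \<Rightarrow> 'b set \<Rightarrow> ('a \<Rightarrow> 'a \<Rightarrow> real) \<Rightarrow> ('b \<Rightarrow> 'b \<Rightarrow> real) \<Rightarrow> ('a \<Rightarrow> 'a) \<Rightarrow> ('b \<Rightarrow> 'b) \<Rightarrow> ('a \<times> 'b) set \<Rightarrow> bool" where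
  "finite_isomorphism Y Y' d d' f f' R \<longleftrightarrow>
     finite R \<and> R \<noteq> {} \<and> R \<subseteq> Y \<times> Y' \<and> partial_isometry d d' R \<and> (\<forall>(x, y)\<in>R. (f x, f' y) \<in> R)"

lemma finite_isomorphism_converse:
  "finite_isomorphism Y Y' d d' f f' R \<Longrightarrow> finite_isomorphism Y' Y d' d f' f (R\<inverse>)"
  unfolding finite_isomorphism_def by (auto intro: partial_isometry_converse)

text \<open>The orbit of \<open>x\<close> is a cycle of some length \<open>m\<close> disjoint from the domain \<open>B\<close> of \<open>R\<close>. A copy of this orbit over the
range of \<open>R\<close> exists in \<open>Y'\<close> as a set of points, and it is of cyclic type for \<open>f'\<close>; by genericity there is a true
cycle of \<open>f'\<close> with the same distances, to which the orbit can be mapped.\<close>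

lemma orbit_extension:
  assumes f: "generic_isometry Q Y d f" and f': "generic_isometry Q Y' d' f'"
    and fin: "finite_isomorphism Y Y' d d' f f' R" and x: "x \<in> Y"
  shows "\<exists>S. finite_isomorphism Y Y' d d' f f' S \<and> R \<subseteq> S \<and> x \<in> Domain S"
proof (cases "x \<in> Domain R")
  case True
  then show ?thesis using fin by blast
next
  case xR: False
  have R: "finite R" "R \<noteq> {}" "R \<subseteq> Y \<times> Y'" "partial_isometry d d' R" "\<And>x y. (x, y) \<in> R \<Longrightarrow> (f x, f' y) \<in> R"
    using fin by (auto simp: finite_isomorphism_def)
  have Y: "Qmetric Q Y d" "f ` Y = Y" "isometry_on Y d d f" using f by (auto simp: generic_isometry_def)
  have Y': "Qmetric Q Y' d'" "one_point_extensions Q Y' d'" "f' ` Y' = Y'" "isometry_on Y' d' d' f'"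
    using f' by (auto simp: generic_isometry_def)
  note m = metric_onD[OF QmetricD(1)[OF Y(1)]] and m' = metric_onD[OF QmetricD(1)[OF Y'(1)]]
  have fY: "f y \<in> Y" if "y \<in> Y" for y using Y(2) that by blast
  have fd: "d (f y) (f z) = d y z" if "y \<in> Y" "z \<in> Y" for y z using Y(3) that by (simp add: isometry_on_def)
  have finj: "inj_on f Y" using isometry_on_inj[OF QmetricD(1)[OF Y(1)] QmetricD(1)[OF Y(1)]] Y by auto
  have finj': "inj_on f' Y'" using isometry_on_inj[OF QmetricD(1)[OF Y'(1)] QmetricD(1)[OF Y'(1)]] Y' by auto
  have fn: "(f ^^ n) y \<in> Y" if "y \<in> Y" for y n using that fY by (induction n) auto
  define B where "B = Domain R"
  have B: "finite B" "B \<noteq> {}" "B \<subseteq> Y" using R by (auto simp: B_def finite_Domain)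
  have fB: "f b \<in> B" if "b \<in> B" for b using that R(5) by (auto simp: B_def)
  have fnB: "(f ^^ n) b \<in> B" if "b \<in> B" for b n using that fB by (induction n) auto
  define \<theta> where "\<theta> b = (SOME y. (b, y) \<in> R)" for b
  have \<theta>: "(b, \<theta> b) \<in> R" if "b \<in> B" for b
    using that someI_ex[of "\<lambda>y. (b, y) \<in> R"] by (auto simp: \<theta>_def B_def)
  have R\<theta>: "y = \<theta> b" if "(b, y) \<in> R" for b y
    using partial_isometry_functional[OF QmetricD(1)[OF Y(1)] QmetricD(1)[OF Y'(1)] R(3,4) that \<theta>[of b]] that
    by (auto simp: B_def)
  define B' where "B' = Range R"
  have B': "finite B'" "B' \<noteq> {}" "B' \<subseteq> Y'" "B' = \<theta> ` B"
  proof -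
    show "finite B'" "B' \<noteq> {}" "B' \<subseteq> Y'" using R by (auto simp: B'_def finite_Range)
    show "B' = \<theta> ` B"
    proof
      show "B' \<subseteq> \<theta> ` B" using R\<theta> unfolding B'_def B_def by blast
      show "\<theta> ` B \<subseteq> B'" using \<theta> unfolding B'_def by blast
    qed
  qed
  have f\<theta>: "f' (\<theta> b) = \<theta> (f b)" if "b \<in> B" for b using R(5)[OF \<theta>[OF that]] R\<theta> by blast
  have "f' ` B' \<subseteq> B'" using f\<theta> fB by (auto simp: B'(4))
  then have fB': "f' ` B' = B'" using endo_inj_surj[OF B'(1)] inj_on_subset[OF finj' B'(3)] by blast
  have ex: "\<exists>n>0. (f ^^ n) x = x" using f x by (auto simp: generic_isometry_def)
  define m where "m = (LEAST n. 0 < n \<and> (f ^^ n) x = x)"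
  have per: "0 < m" "(f ^^ m) x = x" using LeastI_ex[OF ex] by (auto simp: m_def)
  have least: "(f ^^ n) x \<noteq> x" if "0 < n" "n < m" for n using not_less_Least[of n "\<lambda>n. 0 < n \<and> (f ^^ n) x = x"] that by (auto simp: m_def)
  define orb where "orb i = (f ^^ i) x" for i
  have oY: "orb i \<in> Y" for i using fn[OF x] by (simp add: orb_def)
  have oS: "f (orb i) = orb (Suc i mod m)" if "i < m" for i
    using that per by (cases "Suc i = m") (auto simp: orb_def)
  have oinj: "inj_on orb {..<m}"
  proof -
    have "orb i \<noteq> orb j" if ij: "i < j" "j < m" for i j
    proof
      assume eq: "orb i = orb j"
      have "inj_on (f ^^ i) Y"
      proof (induction i)
        case (Suc i)
        have "(f ^^ i) ` Y \<subseteq> Y" using fn by blast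
        then show ?case using comp_inj_on[OF Suc, of f] inj_on_subset[OF finj] by (simp add: comp_def)
      qed simp
      moreover have "(f ^^ i) ((f ^^ (j - i)) x) = (f ^^ i) x"
        using eq ij by (metis funpow_add o_apply le_add_diff_inverse less_imp_le orb_def)
      ultimately have "(f ^^ (j - i)) x = x" using fn[OF x] x by (metis inj_onD)
      then show False using least[of "j - i"] ij by simp
    qed
    then show ?thesis by (auto simp: inj_on_def) (metis linorder_neqE_nat)
  qed
  have oB: "orb i \<notin> B" if "i < m" for i
  proof
    assume "orb i \<in> B"
    then have "(f ^^ (m - i)) (orb i) \<in> B" by (rule fnB)
    then have "x \<in> B" using per that by (simp add: orb_def flip: funpow_add[THEN fun_cong, unfolded o_apply])
    then show False using xR by (simp add: B_def)
  qed
  define E where "E = B \<union> orb ` {..<m}"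
  have E: "finite E" "E \<subseteq> Y" "B \<subseteq> E" using B oY by (auto simp: E_def)
  have "\<exists>\<kappa>. \<kappa> ` E \<subseteq> Y' \<and> (\<forall>x\<in>B. \<kappa> x = \<theta> x) \<and> isometry_on E d d' \<kappa>"
    using B'(3,4) \<theta> R(4)
    by (intro embed_finite[OF Y'(1,2) E(1) Qmetric_subset[OF Y(1) E(2)] E(3) B(2)])
       (auto simp: isometry_on_def intro: partial_isometryD[symmetric])
  then obtain \<kappa> where \<kappa>: "\<kappa> ` E \<subseteq> Y'" "\<And>b. b \<in> B \<Longrightarrow> \<kappa> b = \<theta> b" "isometry_on E d d' \<kappa>" by auto
  have \<kappa>d: "d' (\<kappa> u) (\<kappa> v) = d u v" if "u \<in> E" "v \<in> E" for u v using \<kappa>(3) that by (simp add: isometry_on_def)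
  have \<kappa>inj: "inj_on \<kappa> E"
    using isometry_on_inj[OF QmetricD(1)[OF Qmetric_subset[OF Y(1) E(2)]] QmetricD(1)[OF Y'(1)] \<kappa>(1,3)] .
  define y where "y i = \<kappa> (orb i)" for i
  have oE: "orb i \<in> E" if "i < m" for i using that by (simp add: E_def)
  have BE: "b \<in> E" "b \<in> Y" if "b \<in> B" for b using that E(3) B(3) by auto
  have sm: "Suc i mod m < m" for i using per by simp
  have "y ` {..<m} \<subseteq> Y'" using \<kappa>(1) oE by (auto simp: y_def)
  moreover have "cyclic_type d' f' B' m y"
    unfolding cyclic_type_def
  proof (intro conjI)
    show "inj_on y {..<m}"
    proof -
      have "orb ` {..<m} \<subseteq> E" using oE by auto
      from comp_inj_on[OF oinj inj_on_subset[OF \<kappa>inj this]] show ?thesis by (simp add: y_def[abs_def] comp_def)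
    qed
    show "y ` {..<m} \<inter> B' = {}"
    proof -
      have "y i \<noteq> \<theta> b" if "i < m" "b \<in> B" for i b
      proof
        assume "y i = \<theta> b"
        then have "\<kappa> (orb i) = \<kappa> b" using \<kappa>(2)[OF that(2)] by (simp add: y_def)
        then have "orb i = b" using inj_onD[OF \<kappa>inj _ oE[OF that(1)] BE(1)[OF that(2)]] by blast
        then show False using oB[OF that(1)] that(2) by simp
      qed
      then show ?thesis by (auto simp: B'(4))
    qed
    show "\<forall>i<m. \<forall>b\<in>B'. d' (y (Suc i mod m)) (f' b) = d' (y i) b"
    proof (intro allI impI ballI)
      fix i b' assume i: "i < m" and "b' \<in> B'"
      then obtain b where b: "b \<in> B" "b' = \<theta> b" by (auto simp: B'(4))
      have "d' (y (Suc i mod m)) (f' b') = d' (\<kappa> (f (orb i))) (\<kappa> (f b))"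
        using \<kappa>(2)[OF fB[OF b(1)]] f\<theta>[OF b(1)] oS[OF i] by (simp add: y_def b(2))
      also have "\<dots> = d (f (orb i)) (f b)" using \<kappa>d oE[OF sm[of i]] oS[OF i] BE(1)[OF fB[OF b(1)]] by simp
      also have "\<dots> = d (orb i) b" using fd[OF oY BE(2)[OF b(1)]] .
      also have "\<dots> = d' (y i) b'" using \<kappa>d[OF oE[OF i] BE(1)[OF b(1)]] \<kappa>(2)[OF b(1)] by (simp add: y_def b(2))
      finally show "d' (y (Suc i mod m)) (f' b') = d' (y i) b'" .
    qed
    show "\<forall>i<m. \<forall>j<m. d' (y (Suc i mod m)) (y (Suc j mod m)) = d' (y i) (y j)"
    proof (intro allI impI)
      fix i j assume ij: "i < m" "j < m"
      then show "d' (y (Suc i mod m)) (y (Suc j mod m)) = d' (y i) (y j)"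
        using \<kappa>d[OF oE[OF sm] oE[OF sm], of i j] \<kappa>d[OF oE oE, of i j] oS fd[OF oY oY, of i j]
        by (simp add: y_def)
    qed
  qed (use per in simp)
  ultimately obtain z where z: "z ` {..<m} \<subseteq> Y'" "\<And>i. i < m \<Longrightarrow> f' (z i) = z (Suc i mod m)" "same_type d' B' m y z"
    using generic_isometry_realize[OF f' B'(1,3,2) fB'] by blast
  define S where "S = R \<union> (\<lambda>i. (orb i, z i)) ` {..<m}"
  have cross': "d (orb i) b = d' (z i) (\<theta> b)" if "b \<in> B" "i < m" for b i
  proof -
    have "d' (z i) (\<theta> b) = d' (y i) (\<theta> b)" using z(3) that by (auto simp: same_type_def B'(4))
    also have "\<dots> = d (orb i) b" using \<kappa>d[OF oE BE(1)] that \<kappa>(2) by (simp add: y_def)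
    finally show ?thesis by simp
  qed
  have cross: "d b (orb i) = d' (\<theta> b) (z i)" if "b \<in> B" "i < m" for b i
  proof -
    have "z i \<in> Y'" "\<theta> b \<in> Y'" using z(1) that B' by auto
    then show ?thesis using cross'[OF that] m(2)[OF oY BE(2)[OF that(1)], of i] m'(2)[of "z i" "\<theta> b"] by simp
  qed
  have RB: "b \<in> B \<and> y = \<theta> b" if "(b, y) \<in> R" for b y using that R\<theta> by (auto simp: B_def)
  have zz: "d (orb i) (orb j) = d' (z i) (z j)" if "i < m" "j < m" for i j
    using z(3) \<kappa>d[OF oE oE] that by (simp add: same_type_def y_def)
  have "partial_isometry d d' S"
    unfolding partial_isometry_def S_def
    using partial_isometryD[OF R(4)] cross cross' zz by (auto dest: RB)
  moreover have "\<forall>(x, y)\<in>S. (f x, f' y) \<in> S"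
    using R(5) oS z(2) sm by (auto simp: S_def)
  moreover have "x \<in> Domain S" using per(1) by (auto simp: S_def orb_def intro!: image_eqI[of _ _ 0])
  ultimately show ?thesis using R z(1) oY
    by (intro exI[of _ S]) (auto simp: S_def finite_isomorphism_def)
qed

text \<open>Back and forth, extending finite isomorphisms by whole orbits.\<close>

theorem generic_isometries_isomorphic:
  assumes f: "generic_isometry Q Y d f" "countable Y" and f': "generic_isometry Q Y' d' f'" "countable Y'"
  shows "\<exists>\<theta>. \<theta> ` Y = Y' \<and> isometry_on Y d d' \<theta> \<and> (\<forall>x\<in>Y. \<theta> (f x) = f' (\<theta> x))"
proof -
  note mY = QmetricD(1)[of Q Y d] and mY' = QmetricD(1)[of Q Y' d']
  have Y: "metric_on Y d" "metric_on Y' d'" using f f' by (auto simp: generic_isometry_def Qmetric_def)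
  define P where "P = finite_isomorphism Y Y' d d' f f'"
  obtain x0 y0 where 0: "x0 \<in> Y" "f x0 = x0" "y0 \<in> Y'" "f' y0 = y0" using f f' by (auto simp: generic_isometry_def)
  then have P0: "P {(x0, y0)}" using metric_onD(4)[OF Y(1)] metric_onD(4)[OF Y(2)] by (auto simp: P_def finite_isomorphism_def partial_isometry_def)
  define I where "I = (\<lambda>x R. x \<in> Domain R) ` Y \<union> (\<lambda>y R. y \<in> Range R) ` Y'"
  have cI: "countable I" using f f' by (simp add: I_def)
  have den: "\<exists>S. P S \<and> R \<subseteq> S \<and> D S" if D: "D \<in> I" and R: "P R" for D R
  proof -
    consider x where "x \<in> Y" "D = (\<lambda>R. x \<in> Domain R)" | y where "y \<in> Y'" "D = (\<lambda>R. y \<in> Range R)"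
      using D by (auto simp: I_def)
    then show ?thesis
    proof cases
      case 1
      then show ?thesis using orbit_extension[OF f(1) f'(1) R[unfolded P_def], of x] by (simp add: P_def)
    next
      case 2
      obtain S where S: "finite_isomorphism Y' Y d' d f' f S" "R\<inverse> \<subseteq> S" "y \<in> Domain S"
        using orbit_extension[OF f'(1) f(1) finite_isomorphism_converse[OF R[unfolded P_def]] 2(1)] by blast
      then have "P (S\<inverse>)" using finite_isomorphism_converse by (simp add: P_def)
      moreover have "R \<subseteq> S\<inverse>" "y \<in> Range (S\<inverse>)" using S(2,3) by auto
      ultimately show ?thesis using 2(2) by blast
    qed
  qed
  from generic_chain[OF P0 cI den]
  obtain R where "(\<forall>n. P (R n)) \<and> (\<forall>n. R n \<subseteq> R (Suc n)) \<and> (\<forall>D\<in>I. \<exists>n. D (R n))" by auto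
  then have R: "\<And>n. P (R n)" "\<And>n. R n \<subseteq> R (Suc n)" "\<And>D. D \<in> I \<Longrightarrow> \<exists>n. D (R n)" by simp_all
  define F where "F = (\<Union>n. R n)"
  have F: "partial_isometry d d' F" "F \<subseteq> Y \<times> Y'" "\<And>x y. (x, y) \<in> F \<Longrightarrow> (f x, f' y) \<in> F"
  proof -
    have R': "partial_isometry d d' (R n)" "R n \<subseteq> Y \<times> Y'" "(x, y) \<in> R n \<Longrightarrow> (f x, f' y) \<in> R n" for n x y
      using R(1)[of n] by (auto simp: P_def finite_isomorphism_def)
    show "partial_isometry d d' F" unfolding F_def by (rule partial_isometry_chain) (fact R(2) R'(1))+
    show "F \<subseteq> Y \<times> Y'" "\<And>x y. (x, y) \<in> F \<Longrightarrow> (f x, f' y) \<in> F"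
      using R'(2,3) unfolding F_def by blast+
  qed
  have dom: "\<exists>y. (x, y) \<in> F" if "x \<in> Y" for x
    using R(3)[of "\<lambda>R. x \<in> Domain R"] that by (auto simp: I_def F_def)
  have ran: "\<exists>x. (x, y) \<in> F" if "y \<in> Y'" for y
    using R(3)[of "\<lambda>R. y \<in> Range R"] that by (auto simp: I_def F_def)
  define \<theta> where "\<theta> x = (SOME y. (x, y) \<in> F)" for x
  have \<theta>: "(x, \<theta> x) \<in> F" if "x \<in> Y" for x using someI_ex[OF dom[OF that]] by (simp add: \<theta>_def)
  have un: "y = \<theta> x" if "(x, y) \<in> F" for x y
    using partial_isometry_functional[OF Y F(2,1) that \<theta>[of x]] that F(2) by auto
  have "\<theta> ` Y = Y'"
  proof
    show "\<theta> ` Y \<subseteq> Y'" using \<theta> F(2) by auto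
    show "Y' \<subseteq> \<theta> ` Y" using ran un F(2) by blast
  qed
  moreover have "isometry_on Y d d' \<theta>"
    unfolding isometry_on_def using partial_isometryD[OF F(1) \<theta> \<theta>] by simp
  moreover have "\<theta> (f x) = f' (\<theta> x)" if "x \<in> Y" for x using un[OF F(3)[OF \<theta>[OF that]]] by simp
  ultimately show ?thesis by blast
qed

text \<open>The amalgam of \<open>E\<close> and the points \<open>y i\<close> over their common part \<open>B\<close>, with distances between the two sides
measured along shortest paths through \<open>B\<close>. The sum type keeps the copies of the \<open>y i\<close> apart from \<open>E\<close>.\<close>

lemma amalgam_over_base:
  assumes Y: "Qmetric Q Y d" and Q: "real_subgroup Q" and E: "E \<subseteq> Y" and B: "finite B" "B \<noteq> {}" "B \<subseteq> E"
    and y: "y ` {..<m} \<subseteq> Y" "inj_on y {..<m}" "y ` {..<m} \<inter> B = {}"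
    and h_def: "\<And>i a. h i a = Min ((\<lambda>b. d (y i) b + d b a) ` B)"
    and D_def: "D = (\<lambda>u v. case (u, v) of (Inl a, Inl b) \<Rightarrow> d a b | (Inl a, Inr j) \<Rightarrow> h j a
                               | (Inr i, Inl b) \<Rightarrow> h i b | (Inr i, Inr j) \<Rightarrow> d (y i) (y j))"
  shows "Qmetric Q (E <+> {..<m}) D" and "\<And>i b. i < m \<Longrightarrow> b \<in> B \<Longrightarrow> h i b = d (y i) b"
proof -
  note m = metric_onD[OF QmetricD(1)[OF Y]]
  have hle: "h i a \<le> d (y i) b + d b a" if "b \<in> B" for i a b
    unfolding h_def using B(1) that by (intro Min_le) auto
  have hin: "\<exists>b\<in>B. h i a = d (y i) b + d b a" for i a
  proof -
    have "h i a \<in> (\<lambda>b. d (y i) b + d b a) ` B" unfolding h_def using B(1,2) by (intro Min_in) auto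
    then show ?thesis by blast
  qed
  have yY: "y i \<in> Y" if "i < m" for i using y(1) that by auto
  have BY: "b \<in> Y" if "b \<in> B" for b using that B(3) E by blast
  have EY: "a \<in> Y" if "a \<in> E" for a using that E by blast
  have hQ: "h i a \<in> Q" "0 < h i a" if ia: "i < m" "a \<in> E" for i a
  proof -
    obtain b where b: "b \<in> B" "h i a = d (y i) b + d b a" using hin by blast
    then show "h i a \<in> Q"
      using QmetricD(2)[OF Y yY[OF ia(1)] BY[OF b(1)]] QmetricD(2)[OF Y BY[OF b(1)] EY[OF ia(2)]] real_subgroupD(3)[OF Q] by simp
    have "y i \<noteq> b" using y(3) ia b(1) by auto
    then have "0 < d (y i) b" using m(1,3)[OF yY[OF ia(1)] BY[OF b(1)]] by (simp add: less_le)
    then show "0 < h i a" using b m(1)[OF BY[OF b(1)] EY[OF ia(2)]] by simp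
  qed
  have t1: "d a b \<le> h i a + h i b" if ia: "i < m" "a \<in> E" "b \<in> E" for i a b
  proof -
    obtain p q where p: "p \<in> B" "h i a = d (y i) p + d p a" and q: "q \<in> B" "h i b = d (y i) q + d q b" using hin by metis
    have "d a b \<le> d a p + d p b" "d p b \<le> d p q + d q b" "d p q \<le> d p (y i) + d (y i) q"
      using m(5) ia EY BY p q yY by simp_all
    then show ?thesis using m(2)[of a p] m(2)[of p "y i"] ia EY BY p q yY by simp
  qed
  have t2: "h i a \<le> d a b + h i b" if ia: "i < m" "a \<in> E" "b \<in> E" for i a b
  proof -
    obtain q where q: "q \<in> B" "h i b = d (y i) q + d q b" using hin by metis
    then show ?thesis
      using hle[OF q(1), of i a] m(5)[of q b a] m(2)[of b a] EY BY ia by auto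
  qed
  have t3: "h i a \<le> d (y i) (y j) + h j a" if ia: "i < m" "j < m" "a \<in> E" for i j a
  proof -
    obtain q where q: "q \<in> B" "h j a = d (y j) q + d q a" using hin by metis
    then show ?thesis using hle[OF q(1), of i a] m(5)[of "y i" "y j" q] yY BY ia by auto
  qed
  have t4: "d (y i) (y j) \<le> h i a + h j a" if ia: "i < m" "j < m" "a \<in> E" for i j a
  proof -
    obtain p q where p: "p \<in> B" "h i a = d (y i) p + d p a" and q: "q \<in> B" "h j a = d (y j) q + d q a" using hin by metis
    have "d (y i) (y j) \<le> d (y i) p + d p (y j)" "d p (y j) \<le> d p a + d a (y j)" "d a (y j) \<le> d a q + d q (y j)"
      using m(5) ia EY BY p q yY by simp_all
    then show ?thesis using m(2)[of a q] m(2)[of q "y j"] ia EY BY p q yY by simp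
  qed
  have inj: "y i = y j \<longleftrightarrow> i = j" if "i < m" "j < m" for i j using y(2) that by (auto simp: inj_on_def)
  have Dsimps: "D (Inl a) (Inl b) = d a b" "D (Inl a) (Inr j) = h j a" "D (Inr j) (Inl a) = h j a"
       "D (Inr i) (Inr j) = d (y i) (y j)" for a b i j by (simp_all add: D_def)
  show "Qmetric Q (E <+> {..<m}) D" (is "Qmetric Q ?W D")
    unfolding Qmetric_def metric_on_def
  proof (intro conjI ballI)
    fix u v assume u: "u \<in> ?W" and v: "v \<in> ?W"
    show "0 \<le> D u v" using u v m(1) EY yY hQ(2) by (auto simp: Dsimps less_imp_le)
    show "D u v = D v u" using u v m(2) EY yY by (auto simp: Dsimps)
    show "(D u v = 0) = (u = v)" using u v m(3) EY yY hQ(2) inj by (auto simp: Dsimps less_le)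
    show "D u v \<in> Q" using u v QmetricD(2)[OF Y] EY yY hQ(1) by (auto simp: Dsimps)
    fix w assume w: "w \<in> ?W"
    show "D u w \<le> D u v + D v w"
      using u v w
    proof (elim PlusE; hypsubst)
      fix a b c assume "a \<in> E" "b \<in> E" "c \<in> E"
      then show "D (Inl a) (Inl c) \<le> D (Inl a) (Inl b) + D (Inl b) (Inl c)" using m(5) EY by (simp add: Dsimps)
    next
      fix a b i assume "a \<in> E" "b \<in> E" "i \<in> {..<m}"
      then show "D (Inl a) (Inr i) \<le> D (Inl a) (Inl b) + D (Inl b) (Inr i)" using t2 by (simp add: Dsimps)
    next
      fix a i c assume "a \<in> E" "i \<in> {..<m}" "c \<in> E"
      then show "D (Inl a) (Inl c) \<le> D (Inl a) (Inr i) + D (Inr i) (Inl c)" using t1 by (simp add: Dsimps)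
    next
      fix a i j assume "a \<in> E" "i \<in> {..<m}" "j \<in> {..<m}"
      then show "D (Inl a) (Inr j) \<le> D (Inl a) (Inr i) + D (Inr i) (Inr j)"
        using t3[of j i a] m(2)[OF yY yY, of i j] by (simp add: Dsimps)
    next
      fix i b c assume "i \<in> {..<m}" "b \<in> E" "c \<in> E"
      then show "D (Inr i) (Inl c) \<le> D (Inr i) (Inl b) + D (Inl b) (Inl c)"
        using t2[of i c b] m(2)[OF EY EY, of b c] by (simp add: Dsimps)
    next
      fix i b j assume "i \<in> {..<m}" "b \<in> E" "j \<in> {..<m}"
      then show "D (Inr i) (Inr j) \<le> D (Inr i) (Inl b) + D (Inl b) (Inr j)" using t4 by (simp add: Dsimps)
    next
      fix i j c assume "i \<in> {..<m}" "j \<in> {..<m}" "c \<in> E"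
      then show "D (Inr i) (Inl c) \<le> D (Inr i) (Inr j) + D (Inr j) (Inl c)" using t3 by (simp add: Dsimps)
    next
      fix i j k assume "i \<in> {..<m}" "j \<in> {..<m}" "k \<in> {..<m}"
      then show "D (Inr i) (Inr k) \<le> D (Inr i) (Inr j) + D (Inr j) (Inr k)" using m(5) yY by (simp add: Dsimps)
    qed
  qed
  show "h i b = d (y i) b" if "i < m" "b \<in> B" for i b
  proof (rule antisym)
    show "h i b \<le> d (y i) b" using hle[OF that(2), of i b] m(4)[OF BY[OF that(2)] BY[OF that(2)]] by simp
    obtain q where q: "q \<in> B" "h i b = d (y i) q + d q b" using hin by metis
    then show "d (y i) b \<le> h i b" using m(5)[OF yY BY BY, of i q b] that by simp
  qed
qed

text \<open>If a finite partial isometry maps the finite set \<open>E\<close> into itself, the orbits in \<open>E\<close> of any of its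
extensions are finite. This makes finiteness of orbits a dense requirement.\<close>

definition closed_under :: "('a \<times> 'a) set \<Rightarrow> 'a set \<Rightarrow> bool" where
  "closed_under R E \<longleftrightarrow> finite E \<and> (\<forall>e\<in>E. \<exists>e'\<in>E. (e, e') \<in> R)"

text \<open>Whether \<open>y\<close> is of cyclic type depends on the values on \<open>B\<close> of the map under construction, which \<open>R\<close> need
not yet determine. Quantifying over all extensions of \<open>R\<close> gives a requirement that is kept once it is met.\<close>

definition realizes_cyclic_type :: "('a \<Rightarrow> 'a \<Rightarrow> real) \<Rightarrow> 'a set \<Rightarrow> nat \<Rightarrow> (nat \<Rightarrow> 'a) \<Rightarrow> ('a \<times> 'a) set \<Rightarrow> bool" where
  "realizes_cyclic_type d B m y R \<longleftrightarrow>
     (\<forall>f. (\<forall>(a, b)\<in>R. f a = b) \<and> f ` B = B \<and> cyclic_type d f B m y \<longrightarrow>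
        (\<exists>z. (\<forall>i<m. (z i, z (Suc i mod m)) \<in> R) \<and> same_type d B m y z))"

definition finite_partial_isometry :: "'a set \<Rightarrow> ('a \<Rightarrow> 'a \<Rightarrow> real) \<Rightarrow> ('a \<times> 'a) set \<Rightarrow> bool" where
  "finite_partial_isometry Y d R \<longleftrightarrow> finite R \<and> R \<subseteq> Y \<times> Y \<and> partial_isometry d d R"

lemma extend_to_closed:
  assumes Q: "real_subgroup Q" and Y: "Qmetric Q Y d" "one_point_extensions Q Y d"
    and R: "finite_partial_isometry Y d R" and X: "finite X" "X \<subseteq> Y" "X \<noteq> {}"
  shows "\<exists>E q. finite E \<and> X \<subseteq> E \<and> E \<subseteq> Y \<and> q ` E = E \<and> isometry_on E d d q \<and> R \<subseteq> (\<lambda>e. (e, q e)) ` E"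
proof -
  note mY = QmetricD(1)[OF Y(1)]
  have R': "finite R" "R \<subseteq> Y \<times> Y" "partial_isometry d d R" using R by (auto simp: finite_partial_isometry_def)
  define p where "p x = (SOME y. (x, y) \<in> R)" for x
  have p: "(x, p x) \<in> R" if "x \<in> Domain R" for x using that someI_ex[of "\<lambda>y. (x, y) \<in> R"] by (auto simp: p_def)
  have un: "y = p x" if "(x, y) \<in> R" for x y
    using partial_isometry_functional[OF mY mY R'(2,3) that p[of x]] that by auto
  define S where "S = X \<union> Domain R \<union> Range R"
  have S: "finite S" "S \<subseteq> Y" "S \<noteq> {}" using X R' by (auto simp: S_def finite_Domain finite_Range)
  have A: "Domain R \<subseteq> S" "p ` Domain R \<subseteq> S" using p by (auto simp: S_def)
  have "isometry_on (Domain R) d d p" unfolding isometry_on_def using p partial_isometryD[OF R'(3)] by metis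
  then obtain E q where E: "finite E" "S \<subseteq> E" "E \<subseteq> Y" "q ` E = E" "isometry_on E d d q" "\<And>x. x \<in> Domain R \<Longrightarrow> q x = p x"
    using partial_isometry_extends_to_finite_isometry[OF Q Y S A] by metis
  have "R \<subseteq> (\<lambda>e. (e, q e)) ` E"
  proof clarify
    fix x y assume xy: "(x, y) \<in> R"
    then have "x \<in> Domain R" by blast
    then have "y = q x" "x \<in> E" using un[OF xy] E(2) E(6)[of x] by (auto simp: S_def)
    then show "(x, y) \<in> (\<lambda>e. (e, q e)) ` E" by blast
  qed
  then show ?thesis using E by (intro exI[of _ E] exI[of _ q]) (auto simp: S_def)
qed

lemma graph_finite_partial_isometry:
  "finite E \<Longrightarrow> E \<subseteq> Y \<Longrightarrow> q ` E = E \<Longrightarrow> isometry_on E d d q \<Longrightarrow> finite_partial_isometry Y d ((\<lambda>e. (e, q e)) ` E)"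
  by (auto simp: finite_partial_isometry_def partial_isometry_def isometry_on_def)

text \<open>After extending \<open>R\<close> to an isometry \<open>q\<close> of a finite set \<open>E\<close> containing \<open>B\<close>, the values on \<open>B\<close> are fixed. If \<open>y\<close> is
not of cyclic type for \<open>q\<close>, there is nothing to realize. Otherwise amalgamate \<open>E\<close> with copies \<open>z i\<close> of the \<open>y i\<close> over \<open>B\<close>:
since \<open>q\<close> maps \<open>B\<close> onto itself, shortest paths through \<open>B\<close> are respected by \<open>q\<close> together with the cycle of
the \<open>z i\<close>, which is therefore an isometry of the amalgam.\<close>

lemma extend_to_realize:
  assumes Q: "real_subgroup Q" and Y: "Qmetric Q Y d" "one_point_extensions Q Y d"
    and R: "finite_partial_isometry Y d R" and B: "finite B" "B \<noteq> {}" "B \<subseteq> Y" and y: "y ` {..<m} \<subseteq> Y"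
  shows "\<exists>S. finite_partial_isometry Y d S \<and> R \<subseteq> S \<and> realizes_cyclic_type d B m y S"
proof -
  obtain E q where E: "finite E" "B \<subseteq> E" "E \<subseteq> Y" "q ` E = E" "isometry_on E d d q" "R \<subseteq> (\<lambda>e. (e, q e)) ` E"
    using extend_to_closed[OF Q Y R B(1,3,2)] by blast
  define S1 where "S1 = (\<lambda>e. (e, q e)) ` E"
  have S1: "finite_partial_isometry Y d S1" "R \<subseteq> S1"
    using graph_finite_partial_isometry[OF E(1,3,4,5)] E(6) by (auto simp: S1_def)
  show ?thesis
  proof (cases "q ` B = B \<and> cyclic_type d q B m y")
    case False
    have "f ` B = q ` B \<and> cyclic_type d f B m y = cyclic_type d q B m y" if "\<forall>(a, b)\<in>S1. f a = b" for f
    proof -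
      have "f b = q b" if "b \<in> B" for b using that \<open>\<forall>(a, b)\<in>S1. f a = b\<close> E(2) by (auto simp: S1_def)
      then show ?thesis by (simp add: cyclic_type_def)
    qed
    then have "realizes_cyclic_type d B m y S1" using False unfolding realizes_cyclic_type_def by metis
    then show ?thesis using S1 by blast
  next
    case True
    then have qB: "q ` B = B" and c: "cyclic_type d q B m y" by auto
    have cy: "0 < m" "inj_on y {..<m}" "y ` {..<m} \<inter> B = {}"
      "\<And>i b. i < m \<Longrightarrow> b \<in> B \<Longrightarrow> d (y (Suc i mod m)) (q b) = d (y i) b"
      "\<And>i j. i < m \<Longrightarrow> j < m \<Longrightarrow> d (y (Suc i mod m)) (y (Suc j mod m)) = d (y i) (y j)"
      using c by (auto simp: cyclic_type_def)
    define h where "h i a = Min ((\<lambda>b. d (y i) b + d b a) ` B)" for i a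
    define D where "D = (\<lambda>u v. case (u, v) of (Inl a, Inl b) \<Rightarrow> d a b | (Inl a, Inr j) \<Rightarrow> h j a
                               | (Inr i, Inl b) \<Rightarrow> h i b | (Inr i, Inr j) \<Rightarrow> d (y i) (y j))"
    note am = amalgam_over_base[OF Y(1) Q E(3) B(1,2) E(2) y cy(2,3) h_def D_def]
    have Dsimps: "D (Inl a) (Inl b) = d a b" "D (Inl a) (Inr j) = h j a" "D (Inr j) (Inl a) = h j a"
       "D (Inr i) (Inr j) = d (y i) (y j)" for a b i j by (simp_all add: D_def)
    have "\<exists>\<kappa>. \<kappa> ` (E <+> {..<m}) \<subseteq> Y \<and> (\<forall>x\<in>Inl ` E. \<kappa> x = projl x) \<and> isometry_on (E <+> {..<m}) D d \<kappa>"
      using E(1,2,3) B(2) by (intro embed_finite[OF Y _ am(1)]) (auto simp: isometry_on_def Dsimps)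
    then obtain \<kappa> where \<kappa>: "\<kappa> ` (E <+> {..<m}) \<subseteq> Y" "\<And>e. e \<in> E \<Longrightarrow> \<kappa> (Inl e) = e" "isometry_on (E <+> {..<m}) D d \<kappa>" by auto
    have \<kappa>d: "d (\<kappa> u) (\<kappa> v) = D u v" if "u \<in> E <+> {..<m}" "v \<in> E <+> {..<m}" for u v
      using \<kappa>(3) that by (simp add: isometry_on_def)
    define z where "z i = \<kappa> (Inr i)" for i
    have zY: "z i \<in> Y" if "i < m" for i using \<kappa>(1) that by (auto simp: z_def)
    have ze: "d (z i) e = h i e" "d e (z i) = h i e" if "i < m" "e \<in> E" for i e
      using \<kappa>d[of "Inr i" "Inl e"] \<kappa>d[of "Inl e" "Inr i"] \<kappa>(2) that by (auto simp: z_def Dsimps)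
    have zz: "d (z i) (z j) = d (y i) (y j)" if "i < m" "j < m" for i j
      using \<kappa>d[of "Inr i" "Inr j"] that by (auto simp: z_def Dsimps)
    have sm: "Suc i mod m < m" for i using cy(1) by simp
    have hq: "h (Suc i mod m) (q e) = h i e" if i: "i < m" and e: "e \<in> E" for i e
    proof -
      have "(\<lambda>b. d (y (Suc i mod m)) b + d b (q e)) ` B = (\<lambda>b. d (y (Suc i mod m)) b + d b (q e)) ` q ` B" by (simp add: qB)
      also have "\<dots> = (\<lambda>b. d (y i) b + d b e) ` B"
        unfolding image_image using cy(4)[OF i] E(2,5) e by (intro image_cong) (auto simp: isometry_on_def)
      finally show ?thesis by (simp add: h_def)
    qed
    define S where "S = S1 \<union> (\<lambda>i. (z i, z (Suc i mod m))) ` {..<m}"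
    have iso: "d (q e) (q e') = d e e'" "q e \<in> E" if "e \<in> E" "e' \<in> E" for e e'
      using E(4,5) that by (auto simp: isometry_on_def)
    have "partial_isometry d d S"
      unfolding partial_isometry_def S_def S1_def
      using iso ze sm hq zz cy(5) by auto
    then have S: "finite_partial_isometry Y d S" "R \<subseteq> S"
      using S1 zY sm by (auto simp: finite_partial_isometry_def S_def)
    have "same_type d B m y z" using ze(1) am(2) zz E(2) by (auto simp: same_type_def)
    then have "realizes_cyclic_type d B m y S"
      unfolding realizes_cyclic_type_def by (intro allI impI exI[of _ z]) (auto simp: S_def)
    then show ?thesis using S by blast
  qed
qed

text \<open>A function whose graph contains a union \<open>F\<close> of partial isometries meeting both kinds of requirements is generic.
Surjectivity follows from the finiteness of the orbits.\<close>

lemma limit_generic_isometry: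
  assumes Y: "Qmetric Q Y d" "one_point_extensions Q Y d"
    and F: "F \<subseteq> Y \<times> Y" "partial_isometry d d F" and f: "\<And>x y. (x, y) \<in> F \<Longrightarrow> f x = y"
    and fix_point: "(x0, x0) \<in> F" and closed: "\<And>x. x \<in> Y \<Longrightarrow> \<exists>E. x \<in> E \<and> closed_under F E"
    and real: "\<And>B y m. finite B \<Longrightarrow> B \<noteq> {} \<Longrightarrow> B \<subseteq> Y \<Longrightarrow> y ` {..<m} \<subseteq> Y \<Longrightarrow>
         \<exists>R\<subseteq>F. realizes_cyclic_type d B m y R"
  shows "generic_isometry Q Y d f"
proof -
  note mY = QmetricD(1)[OF Y(1)]
  have fF: "(x, f x) \<in> F" if "x \<in> Y" for x
    using closed[OF that] f unfolding closed_under_def by blast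
  have fY: "f ` Y \<subseteq> Y" using fF F(1) by blast
  have iso: "isometry_on Y d d f"
    unfolding isometry_on_def using partial_isometryD[OF F(2) fF fF] by simp
  have inj: "inj_on f Y" using isometry_on_inj[OF mY mY fY iso] .
  have per: "\<exists>n>0. (f ^^ n) x = x" if x: "x \<in> Y" for x
  proof -
    obtain E where E: "x \<in> E" "finite E" "\<forall>e\<in>E. \<exists>e'\<in>E. (e, e') \<in> F" using closed[OF x] by (auto simp: closed_under_def)
    have "f ` E \<subseteq> E" using E(3) f by blast
    moreover have "E \<subseteq> Y" using E(3) F(1) by blast
    ultimately show ?thesis using finite_injection_period[OF E(2) inj_on_subset[OF inj]] E(1) by blast
  qed
  have "Y \<subseteq> f ` Y"
  proof
    fix x assume x: "x \<in> Y"
    obtain n where n: "n > 0" "(f ^^ n) x = x" using per[OF x] by blast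
    have "(f ^^ k) x \<in> Y" for k using x fY by (induction k) auto
    moreover have "x = f ((f ^^ (n - 1)) x)" using n by (cases n) auto
    ultimately show "x \<in> f ` Y" by blast
  qed
  then have fYY: "f ` Y = Y" using fY by blast
  have x0: "x0 \<in> Y" "f x0 = x0" using fix_point F(1) f by auto
  have ext: "\<exists>z. z ` {..<m} \<subseteq> Y \<and> (\<forall>i<m. f (z i) = z (Suc i mod m)) \<and> same_type d B m y z"
    if B: "finite B" "B \<subseteq> Y" "B \<noteq> {}" "f ` B = B" "y ` {..<m} \<subseteq> Y" "cyclic_type d f B m y" for B m y
  proof -
    obtain R where R: "R \<subseteq> F" "realizes_cyclic_type d B m y R" using real[OF B(1,3,2,5)] by blast
    have "\<forall>(a, b)\<in>R. f a = b" using R(1) f by blast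
    then obtain z where z: "\<forall>i<m. (z i, z (Suc i mod m)) \<in> R" "same_type d B m y z"
      using R(2) B(4,6) unfolding realizes_cyclic_type_def by blast
    have zF: "(z i, z (Suc i mod m)) \<in> F" if "i < m" for i using z(1) R(1) that by blast
    have "z ` {..<m} \<subseteq> Y" using zF F(1) by blast
    moreover have "\<forall>i<m. f (z i) = z (Suc i mod m)" using zF f by blast
    ultimately show ?thesis using z(2) by blast
  qed
  show ?thesis
    unfolding generic_isometry_def
  proof (intro conjI ballI allI impI)
    show "\<exists>x\<in>Y. f x = x" using x0 by blast
    show "\<exists>n>0. (f ^^ n) x = x" if "x \<in> Y" for x using per[OF that] .
    fix B m y
    assume "finite B \<and> B \<subseteq> Y \<and> B \<noteq> {} \<and> f ` B = B \<and> y ` {..<m} \<subseteq> Y \<and> cyclic_type d f B m y"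
    then show "\<exists>z. z ` {..<m} \<subseteq> Y \<and> (\<forall>i<m. f (z i) = z (Suc i mod m)) \<and> same_type d B m y z" using ext by blast
  qed (fact Y fYY iso)+
qed

lemma realizes_cyclic_type_cong:
  assumes "\<And>i. i < m \<Longrightarrow> y i = y' i"
  shows "realizes_cyclic_type d B m y R = realizes_cyclic_type d B m y' R"
proof -
  have im: "y ` {..<m} = y' ` {..<m}" using assms by (intro image_cong) auto
  have inj: "inj_on y {..<m} = inj_on y' {..<m}" using assms by (intro inj_on_cong) auto
  have "cyclic_type d f B m y = cyclic_type d f B m y'" for f
    unfolding cyclic_type_def im inj using assms by (auto simp: mod_less_divisor)
  moreover have "same_type d B m y z = same_type d B m y' z" for z
    using assms by (auto simp: same_type_def)
  ultimately show ?thesis by (simp add: realizes_cyclic_type_def)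
qed

text \<open>If \<open>R\<close> is a part of the graph of \<open>f\<close>, this is the corresponding part of the graph of \<open>g \<circ> f\<close>.\<close>

definition twist :: "('a \<Rightarrow> 'a) \<Rightarrow> ('a \<times> 'a) set \<Rightarrow> ('a \<times> 'a) set" where
  "twist g R = map_prod id g ` R"

lemma twist_mono: "R \<subseteq> S \<Longrightarrow> twist g R \<subseteq> twist g S"
  by (auto simp: twist_def)

lemma twist_finite_partial_isometry:
  assumes "g ` Y \<subseteq> Y" "isometry_on Y d d g" "finite_partial_isometry Y d R"
  shows "finite_partial_isometry Y d (twist g R)"
proof -
  have R: "finite R" "R \<subseteq> Y \<times> Y" "partial_isometry d d R" using assms(3) by (auto simp: finite_partial_isometry_def)
  have "partial_isometry d d (twist g R)"
    unfolding partial_isometry_def twist_def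
  proof (clarsimp)
    fix x y x' y' assume xy: "(x, y) \<in> R" "(x', y') \<in> R"
    then have "y \<in> Y" "y' \<in> Y" using R(2) by auto
    then show "d x x' = d (g y) (g y')" using partial_isometryD[OF R(3) xy] assms(2) by (simp add: isometry_on_def)
  qed
  moreover have "twist g R \<subseteq> Y \<times> Y" using R(2) assms(1) by (auto simp: twist_def)
  ultimately show ?thesis using R(1) by (simp add: finite_partial_isometry_def twist_def)
qed

text \<open>Composition with the isometry \<open>g\<close> is an automorphism of the ordering of finite partial isometries, so that a requirement
is dense for \<open>g \<circ> f\<close> exactly if it is dense for \<open>f\<close>. One chain meets the requirements for both maps. Only the
fixed points of \<open>f\<close> and \<open>g \<circ> f\<close> have to be provided at the start.\<close>

theorem generic_isometry_pair:
  assumes Q: "real_subgroup Q" and Y: "Qmetric Q Y d" "one_point_extensions Q Y d" "countable Y" "Y \<noteq> {}"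
    and g: "g ` Y = Y" "isometry_on Y d d g"
  shows "\<exists>f. generic_isometry Q Y d f \<and> generic_isometry Q Y d (g \<circ> f)"
proof -
  note mY = QmetricD(1)[OF Y(1)]
  note m = metric_onD[OF mY]
  have gy: "g y \<in> Y" if "y \<in> Y" for y using g(1) that by auto
  have gY: "g ` Y \<subseteq> Y" using g(1) by simp
  have inj: "inj_on g Y" using isometry_on_inj[OF mY mY gY g(2)] .
  define g' where "g' = inv_into Y g"
  have g': "g' (g y) = y" "g (g' y) = y" "g' y \<in> Y" if "y \<in> Y" for y
    using that inj g(1) by (auto simp: g'_def f_inv_into_f inv_into_into)
  have g'Y: "g' ` Y \<subseteq> Y" using g'(3) by auto
  have g'iso: "isometry_on Y d d g'"
    unfolding isometry_on_def using g(2) g' by (metis isometry_on_def)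
  have tw: "twist g (twist g' S) = S" if "S \<subseteq> Y \<times> Y" for S
  proof -
    have "map_prod id g (map_prod id g' z) = z" if "z \<in> S" for z using that \<open>S \<subseteq> Y \<times> Y\<close> g'(2) by auto
    then show ?thesis by (simp add: twist_def image_image)
  qed
  have tw': "twist g' (twist g S) = S" if "S \<subseteq> Y \<times> Y" for S
  proof -
    have "map_prod id g' (map_prod id g z) = z" if "z \<in> S" for z using that \<open>S \<subseteq> Y \<times> Y\<close> g'(1) by auto
    then show ?thesis by (simp add: twist_def image_image)
  qed
  obtain y0 where y0: "y0 \<in> Y" using Y(4) by blast
  have "\<exists>R0. finite_partial_isometry Y d R0 \<and> (\<exists>x. (x, x) \<in> R0) \<and> (\<exists>x. (x, x) \<in> twist g R0)"
  proof (cases "g y0 = y0")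
    case True
    have "finite_partial_isometry Y d {(y0, y0)}"
      using y0 by (simp add: finite_partial_isometry_def partial_isometry_def)
    moreover have "(y0, y0) \<in> twist g {(y0, y0)}" using True by (simp add: twist_def)
    ultimately show ?thesis by blast
  next
    case False
    (* If y1 has the same distance from y0 and from g y0, the map that fixes y0 and sends y1 to g' y1
       is isometric, and its composition with g fixes y1. *)
    define r where "r = d y0 (g y0)"
    have r: "r \<in> Q" "0 < r"
      using QmetricD(2)[OF Y(1) y0 gy[OF y0]] m(1,3)[OF y0 gy[OF y0]] False by (auto simp: r_def less_le)
    have "\<exists>z\<in>Y. \<forall>x\<in>{y0, g y0}. d z x = (\<lambda>_. r) x"
    proof (rule Y(2)[unfolded one_point_extensions_def, rule_format], intro conjI ballI)
      fix x y assume "x \<in> {y0, g y0}" "y \<in> {y0, g y0}"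
      then show "r \<le> r + d x y" "d x y \<le> r + r"
        using m(1,2,4) y0 gy[OF y0] r(2) by (auto simp: r_def)
    qed (use y0 gy r in auto)
    then obtain y1 where y1: "y1 \<in> Y" "d y1 y0 = r" "d y1 (g y0) = r" by auto
    have "d (g' y1) y0 = d y1 (g y0)"
      using g(2) g'(2,3)[OF y1(1)] y0 unfolding isometry_on_def by metis
    then have e: "d (g' y1) y0 = d y1 y0" using y1 by simp
    then have "d y0 (g' y1) = d y0 y1" using m(2)[OF y0 y1(1)] m(2)[OF y0 g'(3)[OF y1(1)]] by simp
    then have "finite_partial_isometry Y d {(y0, y0), (y1, g' y1)}"
      using e y0 y1(1) g'(3)[OF y1(1)] m(4)
      by (simp add: finite_partial_isometry_def partial_isometry_def)
    moreover have "(y1, y1) \<in> twist g {(y0, y0), (y1, g' y1)}" using g'(2)[OF y1(1)] by (simp add: twist_def)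
    ultimately show ?thesis by blast
  qed
  then obtain R0 a b where R0: "finite_partial_isometry Y d R0" "(a, a) \<in> R0" "(b, b) \<in> twist g R0" by blast
  define P where "P = finite_partial_isometry Y d"
  define I1 where "I1 = (\<lambda>x R. \<exists>E. x \<in> E \<and> closed_under R E) ` Y \<union>
     (\<lambda>(B, ys) R. realizes_cyclic_type d B (length ys) (\<lambda>i. ys ! i) R) ` (({B. finite B \<and> B \<subseteq> Y} - {{}}) \<times> lists Y)"
  define I where "I = I1 \<union> (\<lambda>D R. D (twist g R)) ` I1"
  have cI: "countable I"
    unfolding I_def I1_def using Y(3)
    by (intro countable_Un countable_image countable_SIGMA countable_Diff countable_Collect_finite_subset countable_lists) auto
  have den1: "\<exists>S. P S \<and> R \<subseteq> S \<and> D S" if D: "D \<in> I1" and R: "P R" for D R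
  proof -
    consider x where "x \<in> Y" "D = (\<lambda>R. \<exists>E. x \<in> E \<and> closed_under R E)"
      | B ys where "finite B" "B \<subseteq> Y" "B \<noteq> {}" "ys \<in> lists Y" "D = realizes_cyclic_type d B (length ys) (\<lambda>i. ys ! i)"
      using D by (auto simp: I1_def)
    then show ?thesis
    proof cases
      case 1
      obtain E q where E: "finite E" "{x} \<subseteq> E" "E \<subseteq> Y" "q ` E = E" "isometry_on E d d q" "R \<subseteq> (\<lambda>e. (e, q e)) ` E"
        using extend_to_closed[OF Q Y(1,2) R[unfolded P_def], of "{x}"] 1(1) by auto
      have "closed_under ((\<lambda>e. (e, q e)) ` E) E" using E(1,4) by (auto simp: closed_under_def)
      then show ?thesis using graph_finite_partial_isometry[OF E(1,3,4,5)] E(2,6) 1(2) unfolding P_def by blast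
    next
      case 2
      have "(\<lambda>i. ys ! i) ` {..<length ys} \<subseteq> Y" using 2(4) by (auto simp: in_lists_conv_set)
      then show ?thesis using extend_to_realize[OF Q Y(1,2) R[unfolded P_def] 2(1,3,2)] 2(5) by (simp add: P_def)
    qed
  qed
  have PY: "S \<subseteq> Y \<times> Y" if "P S" for S using that by (simp add: P_def finite_partial_isometry_def)
  have den: "\<exists>S. P S \<and> R \<subseteq> S \<and> D S" if D: "D \<in> I" and R: "P R" for D R
  proof (cases "D \<in> I1")
    case True
    then show ?thesis using den1 R by blast
  next
    case False
    then obtain D1 where D1: "D1 \<in> I1" "D = (\<lambda>R. D1 (twist g R))" using D by (auto simp: I_def)
    have "P (twist g R)" using twist_finite_partial_isometry[OF gY g(2)] R by (simp add: P_def)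
    then obtain S where S: "P S" "twist g R \<subseteq> S" "D1 S" using den1[OF D1(1)] by blast
    have "P (twist g' S)" using twist_finite_partial_isometry[OF g'Y g'iso] S(1) by (simp add: P_def)
    moreover have "R \<subseteq> twist g' S" using twist_mono[OF S(2), of g'] tw'[OF PY[OF R]] by simp
    moreover have "D (twist g' S)" using S(3) tw[OF PY[OF S(1)]] by (simp add: D1(2))
    ultimately show ?thesis by blast
  qed
  from generic_chain[OF R0(1)[folded P_def] cI den]
  obtain R where "R0 \<subseteq> R 0 \<and> (\<forall>n. P (R n)) \<and> (\<forall>n. R n \<subseteq> R (Suc n)) \<and> (\<forall>D\<in>I. \<exists>n. D (R n))" by auto
  then have R: "R0 \<subseteq> R 0" "\<And>n. P (R n)" "\<And>n. R n \<subseteq> R (Suc n)" "\<And>D. D \<in> I \<Longrightarrow> \<exists>n. D (R n)" by simp_all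
  define F where "F = (\<Union>n. R n)"
  have F: "F \<subseteq> Y \<times> Y" "partial_isometry d d F"
  proof -
    show "F \<subseteq> Y \<times> Y" using PY[OF R(2)] by (auto simp: F_def)
    show "partial_isometry d d F"
      unfolding F_def
    proof (rule partial_isometry_chain)
      show "partial_isometry d d (R n)" for n using R(2)[of n] by (simp add: P_def finite_partial_isometry_def)
    qed (fact R(3))
  qed
  define f where "f x = (SOME y. (x, y) \<in> F)" for x
  have f: "f x = y" if "(x, y) \<in> F" for x y
  proof -
    have "(x, f x) \<in> F" unfolding f_def using that by (rule someI)
    then show ?thesis using partial_isometry_functional[OF mY mY F that] by blast
  qed
  have lim: "generic_isometry Q Y d h"
    if S: "\<And>n. P (S n)" "\<And>n. S n \<subseteq> S (Suc n)" "\<And>D. D \<in> I1 \<Longrightarrow> \<exists>n. D (S n)" "(x0, x0) \<in> (\<Union>n. S n)"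
      and h: "\<And>x y. (x, y) \<in> (\<Union>n. S n) \<Longrightarrow> h x = y" for S h x0
  proof (rule limit_generic_isometry[OF Y(1,2) _ _ h S(4)])
    show "(\<Union>n. S n) \<subseteq> Y \<times> Y" using PY[OF S(1)] by blast
    show "partial_isometry d d (\<Union>n. S n)"
    proof (rule partial_isometry_chain)
      show "partial_isometry d d (S n)" for n using S(1)[of n] by (simp add: P_def finite_partial_isometry_def)
    qed (fact S(2))
    show "\<exists>E. x \<in> E \<and> closed_under (\<Union>n. S n) E" if "x \<in> Y" for x
    proof -
      have "(\<lambda>R. \<exists>E. x \<in> E \<and> closed_under R E) \<in> I1" using that by (auto simp: I1_def)
      from S(3)[OF this] obtain n E where E: "x \<in> E" "closed_under (S n) E" by auto
      then have "closed_under (\<Union>n. S n) E" unfolding closed_under_def by blast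
      then show ?thesis using E(1) by blast
    qed
    fix B y and k :: nat assume B: "finite B" "B \<noteq> {}" "B \<subseteq> Y" "y ` {..<k} \<subseteq> Y"
    define ys where "ys = map y [0..<k]"
    have ys: "length ys = k" "ys \<in> lists Y" "\<And>i. i < k \<Longrightarrow> ys ! i = y i" using B(4) by (auto simp: ys_def image_subset_iff)
    have "realizes_cyclic_type d B (length ys) (\<lambda>i. ys ! i) \<in> I1"
      unfolding I1_def using B(1,2,3) ys(2) by (intro UnI2 image_eqI[of _ _ "(B, ys)"]) auto
    from S(3)[OF this] obtain n where "realizes_cyclic_type d B (length ys) (\<lambda>i. ys ! i) (S n)" by auto
    then have "realizes_cyclic_type d B k y (S n)"
      unfolding ys(1) using realizes_cyclic_type_cong[of k "\<lambda>i. ys ! i" y] ys(3) by simp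
    then show "\<exists>R\<subseteq>\<Union>n. S n. realizes_cyclic_type d B k y R" by blast
  qed
  have "generic_isometry Q Y d f"
  proof (rule lim[of R a])
    show "P (R n)" "R n \<subseteq> R (Suc n)" for n by (fact R(2) R(3))+
    show "\<exists>n. D (R n)" if "D \<in> I1" for D using R(4)[of D] that by (simp add: I_def)
    show "(a, a) \<in> (\<Union>n. R n)" using R(1) R0(2) by blast
    show "f x = y" if "(x, y) \<in> (\<Union>n. R n)" for x y using f that by (simp add: F_def)
  qed
  moreover have "generic_isometry Q Y d (g \<circ> f)"
  proof (rule lim[of "\<lambda>n. twist g (R n)" b])
    show "P (twist g (R n))" for n using twist_finite_partial_isometry[OF gY g(2)] R(2) by (simp add: P_def)
    show "twist g (R n) \<subseteq> twist g (R (Suc n))" for n using R(3) by (rule twist_mono)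
    show "\<exists>n. D (twist g (R n))" if "D \<in> I1" for D using R(4)[of "\<lambda>R. D (twist g R)"] that by (auto simp: I_def)
    show "(b, b) \<in> (\<Union>n. twist g (R n))" using twist_mono[OF R(1), of g] R0(3) by blast
    fix x y assume "(x, y) \<in> (\<Union>n. twist g (R n))"
    then obtain n where "(x, y) \<in> twist g (R n)" by blast
    then obtain y' where "(x, y') \<in> R n" "y = g y'" unfolding twist_def by auto
    then have "(x, y') \<in> F" "y = g y'" by (auto simp: F_def)
    then show "(g \<circ> f) x = y" using f by simp
  qed
  ultimately show ?thesis by blast
qed

section \<open>A metric space of terms\<close>

text \<open>\<open>Pt z\<close> is a point of the given space. A new point is \<open>New l C\<close>, where the cluster \<open>C\<close> describes a finite
family of points, indexed by labels, that are adjoined simultaneously: \<open>(k, Inl k', r)\<close> puts the points with labels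
\<open>k\<close> and \<open>k'\<close> at distance \<open>r\<close>, and \<open>(k, Inr a, r)\<close> puts the point with label \<open>k\<close> at distance \<open>r\<close> from the earlier
point \<open>a\<close>. Then \<open>New l C\<close> is the member with label \<open>l\<close>. Adjoining families instead of single points is what lets a
permutation of labels move the members of a cluster around among each other.\<close>

datatype ('z, 'l) tm = Pt 'z | New 'l "('l \<times> ('l + ('z, 'l) tm) \<times> real) fset"

text \<open>The costs of the ways to go from one term to another through the prescribed distances; the distance of terms will be the
least cost. Clauses \<open>left\<close> and \<open>right\<close> enter or leave a cluster through a point to which it is attached.\<close>

inductive path :: "'z set \<Rightarrow> ('z \<Rightarrow> 'z \<Rightarrow> real) \<Rightarrow> ('z, 'l) tm \<Rightarrow> ('z, 'l) tm \<Rightarrow> real \<Rightarrow> bool"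
  for Z dZ where
  refl: "path Z dZ s s 0"
| base: "z \<in> Z \<Longrightarrow> z' \<in> Z \<Longrightarrow> path Z dZ (Pt z) (Pt z') (dZ z z')"
| side: "(l, Inl l', r) |\<in>| C \<Longrightarrow> path Z dZ (New l C) (New l' C) r"
| left: "(l, Inr a, r) |\<in>| C \<Longrightarrow> path Z dZ a t q \<Longrightarrow> path Z dZ (New l C) t (r + q)"
| right: "(l, Inr a, r) |\<in>| C \<Longrightarrow> path Z dZ s a q \<Longrightarrow> path Z dZ s (New l C) (q + r)"

text \<open>The prescribed distances are positive, symmetric and satisfy the triangle inequality. The inequalities are expressed by the
existence of a cheaper path or entry, because the distance itself is not available yet; for the same reason
they are visibly preserved under renaming.\<close>

definition cluster :: "real set \<Rightarrow> 'z set \<Rightarrow> ('z \<Rightarrow> 'z \<Rightarrow> real) \<Rightarrow> ('l \<times> ('l + ('z, 'l) tm) \<times> real) fset \<Rightarrow> bool" where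
  "cluster Q Z dZ C \<longleftrightarrow>
     (\<forall>k x r. (k, x, r) |\<in>| C \<longrightarrow> r \<in> Q \<and> 0 < r) \<and>
     (\<forall>k a a' r r'. (k, Inr a, r) |\<in>| C \<and> (k, Inr a', r') |\<in>| C \<longrightarrow> (\<exists>q \<le> r + r'. path Z dZ a a' q)) \<and>
     (\<forall>k k' r. (k, Inl k', r) |\<in>| C \<longrightarrow> (k', Inl k, r) |\<in>| C) \<and>
     (\<forall>k k' a r r'. (k, Inl k', r) |\<in>| C \<and> (k', Inr a, r') |\<in>| C \<longrightarrow> (\<exists>r'' \<le> r + r'. (k, Inr a, r'') |\<in>| C)) \<and>
     (\<forall>k k' k'' r r'. (k, Inl k', r) |\<in>| C \<and> (k', Inl k'', r') |\<in>| C \<longrightarrow>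
        k = k'' \<or> (\<exists>r'' \<le> r + r'. (k, Inl k'', r'') |\<in>| C))"

text \<open>The last premise makes every cluster hang on at least one earlier point for the label in question, which keeps the space
of terms connected by paths of finite cost.\<close>

inductive valid :: "real set \<Rightarrow> 'z set \<Rightarrow> ('z \<Rightarrow> 'z \<Rightarrow> real) \<Rightarrow> ('z, 'l) tm \<Rightarrow> bool"
  for Q Z dZ where
  Pt: "z \<in> Z \<Longrightarrow> valid Q Z dZ (Pt z)"
| New: "cluster Q Z dZ C \<Longrightarrow> (\<And>k a r. (k, Inr a, r) |\<in>| C \<Longrightarrow> valid Q Z dZ a) \<Longrightarrow>
     (l, Inr a, r) |\<in>| C \<Longrightarrow> valid Q Z dZ (New l C)"

lemma size_attached:
  fixes a :: "('z, 'l) tm"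
  assumes "(k, Inr a, r) |\<in>| C"
  shows "size a < size (New l C)"
proof -
  define h :: "'l \<times> ('l + ('z, 'l) tm) \<times> real \<Rightarrow> 'l \<times> ('l + (('z, 'l) tm \<times> nat)) \<times> real"
    where "h = map_prod (\<lambda>x. x) (map_prod (map_sum (\<lambda>x. x) (\<lambda>t. (t, size t))) (\<lambda>x. x))"
  define g where "g = (\<lambda>x :: 'l \<times> ('l + (('z, 'l) tm \<times> nat)) \<times> real.
     Suc (size_prod (\<lambda>_. 0) (size_prod (size_sum (\<lambda>_. 0) snd) (\<lambda>_. 0)) x))"
  have "h (k, Inr a, r) \<in> h ` fset C" using assms by (rule imageI)
  then have "g (h (k, Inr a, r)) \<le> sum g (h ` fset C)" by (intro member_le_sum) auto
  moreover have "size a \<le> g (h (k, Inr a, r))" by (simp add: g_def h_def)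
  moreover have "size (New l C) = sum g (h ` fset C) + 1" by (simp add: g_def h_def)
  ultimately show ?thesis by simp
qed

lemma validD:
  assumes "valid Q Z dZ (New l C)"
  shows "cluster Q Z dZ C" "(k, Inr a, r) |\<in>| C \<Longrightarrow> valid Q Z dZ a"
  using assms by (auto elim: valid.cases)

lemma clusterD:
  assumes "cluster Q Z dZ C"
  shows "(k, x, r) |\<in>| C \<Longrightarrow> r \<in> Q" "(k, x, r) |\<in>| C \<Longrightarrow> 0 < r"
    "(k, Inr a, r) |\<in>| C \<Longrightarrow> (k, Inr a', r') |\<in>| C \<Longrightarrow> \<exists>q \<le> r + r'. path Z dZ a a' q"
    "(k, Inl k', r) |\<in>| C \<Longrightarrow> (k', Inl k, r) |\<in>| C"
    "(k, Inl k', r) |\<in>| C \<Longrightarrow> (k', Inr a, r') |\<in>| C \<Longrightarrow> \<exists>r'' \<le> r + r'. (k, Inr a, r'') |\<in>| C"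
    "(k, Inl k', r) |\<in>| C \<Longrightarrow> (k', Inl k'', r') |\<in>| C \<Longrightarrow> k = k'' \<or> (\<exists>r'' \<le> r + r'. (k, Inl k'', r'') |\<in>| C)"
  using assms unfolding cluster_def by simp_all

locale term_space =
  fixes Q :: "real set" and Z :: "'z set" and dZ :: "'z \<Rightarrow> 'z \<Rightarrow> real"
  assumes Q: "real_subgroup Q" and Z: "Qmetric Q Z dZ" "Z \<noteq> {}"
begin

abbreviation pa where "pa \<equiv> path Z dZ"

definition terms :: "('z, 'l) tm set" where "terms = {t. valid Q Z dZ t}"

definition dT :: "('z, 'l) tm \<Rightarrow> ('z, 'l) tm \<Rightarrow> real" where "dT s t = Min {q. pa s t q}"

lemma Pt_terms: "Pt z \<in> terms \<longleftrightarrow> z \<in> Z"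
  by (auto simp: terms_def intro: valid.Pt elim: valid.cases)

lemma New_terms:
  assumes "New l C \<in> terms"
  shows "cluster Q Z dZ C" "(k, Inr a, r) |\<in>| C \<Longrightarrow> a \<in> terms"
  using assms validD by (auto simp: terms_def)

lemmas mZ = metric_onD[OF QmetricD(1)[OF Z(1)]]

lemma path_sym: "pa s t q \<Longrightarrow> s \<in> terms \<Longrightarrow> t \<in> terms \<Longrightarrow> pa t s q"
proof (induction rule: path.induct)
  case (base z z')
  then show ?case using path.base[of z' Z z dZ] mZ(2) by auto
next
  case (side l l' r C)
  then show ?case using clusterD(4)[OF New_terms(1)] path.side by metis
next
  case (left l a r C t q)
  then show ?case using path.right[OF left(1), of Z dZ t q] New_terms(2) by (metis add.commute)
next
  case (right l a r C s q)
  then show ?case using path.left[OF right(1), of Z dZ s q] New_terms(2) by (metis add.commute)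
qed (rule path.refl)

lemma path_cost: "pa s t q \<Longrightarrow> s \<in> terms \<Longrightarrow> t \<in> terms \<Longrightarrow> q \<in> Q \<and> 0 \<le> q \<and> (q = 0 \<longrightarrow> s = t)"
proof (induction rule: path.induct)
  case (refl s)
  then show ?case using real_subgroupD(1)[OF Q] by simp
next
  case (base z z')
  then show ?case using mZ(1,3) QmetricD(2)[OF Z(1)] by simp
next
  case (side l l' r C)
  then show ?case using clusterD(1,2)[OF New_terms(1)] by (metis less_le)
next
  case (left l a r C t q)
  have "r \<in> Q" "0 < r" using clusterD(1,2)[OF New_terms(1)[OF left(4)] left(1)] .
  then show ?case using left New_terms(2) real_subgroupD(3)[OF Q] by fastforce
next
  case (right l a r C s q)
  have "r \<in> Q" "0 < r" using clusterD(1,2)[OF New_terms(1)[OF right(5)] right(1)] .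
  then show ?case using right New_terms(2) real_subgroupD(3)[OF Q] by fastforce
qed

text \<open>Two consecutive paths can be replaced by one that is not more expensive. The critical case is a middle term
\<open>u\<close> in a cluster that is entered through one attached point \<open>a\<close> and left through another, \<open>a'\<close>; the detour is replaced by a path from
\<open>a\<close> to \<open>a'\<close>, in two applications of the induction hypothesis. The weight \<open>3 ^ size\<close> makes the
two smaller terms together lighter than \<open>u\<close>.\<close>

lemma path_triangle:
  fixes s u t :: "('z, 'l) tm"
  shows "s \<in> terms \<Longrightarrow> u \<in> terms \<Longrightarrow> t \<in> terms \<Longrightarrow> pa s u q1 \<Longrightarrow> pa u t q2 \<Longrightarrow> \<exists>q \<le> q1 + q2. pa s t q"
proof (induction "(3::nat) ^ size s + 3 ^ size u + 3 ^ size t" arbitrary: s u t q1 q2 rule: less_induct)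
  case less
  have IH: "\<exists>q \<le> p1 + p2. pa s' t' q"
    if "(3::nat) ^ size s' + 3 ^ size u' + 3 ^ size t' < 3 ^ size s + 3 ^ size u + 3 ^ size t"
      "s' \<in> terms" "u' \<in> terms" "t' \<in> terms" "pa s' u' p1" "pa u' t' p2"
    for s' u' t' :: "('z, 'l) tm" and p1 p2
    using less.hyps[OF that] .
  have mono: "(3::nat) ^ size a < 3 ^ size (New l C)" if "(k, Inr a, r) |\<in>| C"
    for k a r l and C :: "('l \<times> ('l + ('z, 'l) tm) \<times> real) fset"
    by (rule power_strict_increasing[OF size_attached[OF that]]) simp
  have via_left: "\<exists>q \<le> q1 + q2. pa s t q" if "s = New l C" "(l, Inr a, r) |\<in>| C" "pa a u q" "q1 = r + q" for l C a r q
  proof -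
    have "\<exists>q' \<le> q + q2. pa a t q'"
      using mono[OF that(2), of l] less.prems New_terms(2)[of l C, OF _ that(2)] that by (intro IH[of a u t]) auto
    then obtain q' where q': "q' \<le> q + q2" "pa a t q'" by blast
    have "pa s t (r + q')" unfolding that(1) by (rule path.left[OF that(2) q'(2)])
    then show ?thesis using q'(1) that(4) by (intro exI[of _ "r + q'"]) auto
  qed
  have via_right: "\<exists>q \<le> q1 + q2. pa s t q" if "t = New l C" "(l, Inr a, r) |\<in>| C" "pa u a q" "q2 = q + r" for l C a r q
  proof -
    have "\<exists>q' \<le> q1 + q. pa s a q'"
      using mono[OF that(2), of l] less.prems New_terms(2)[of l C, OF _ that(2)] that by (intro IH[of s u a]) auto
    then obtain q' where q': "q' \<le> q1 + q" "pa s a q'" by blast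
    have "pa s t (q' + r)" unfolding that(1) by (rule path.right[OF that(2) q'(2)])
    then show ?thesis using q'(1) that(4) by (intro exI[of _ "q' + r"]) auto
  qed
  have cross: "\<exists>q \<le> q1 + q2. pa s t q"
    if u: "u = New l C" "(l, Inr a, r) |\<in>| C" "pa s a p1" "q1 = p1 + r" "(l, Inr a', r') |\<in>| C" "pa a' t p2" "q2 = r' + p2"
    for l C a r p1 a' r' p2
  proof -
    have C: "cluster Q Z dZ C" and aa: "a \<in> terms" "a' \<in> terms"
      using New_terms[of l C] less.prems(2) u by auto
    obtain p where p: "p \<le> r + r'" "pa a a' p" using clusterD(3)[OF C u(2,5)] by blast
    have sz: "(3::nat) ^ size a + 3 ^ size a' < 3 ^ size u" "(3::nat) ^ size a' < 3 ^ size u"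
    proof -
      obtain n where n: "size u = Suc n" using size_attached[OF u(2), of l] u(1) by (cases "size u") auto
      have "size a \<le> n" "size a' \<le> n" using size_attached[OF u(2), of l] size_attached[OF u(5), of l] n u(1) by simp_all
      then have "(3::nat) ^ size a \<le> 3 ^ n" "(3::nat) ^ size a' \<le> 3 ^ n" "(0::nat) < 3 ^ n" by simp_all
      then show "(3::nat) ^ size a + 3 ^ size a' < 3 ^ size u" "(3::nat) ^ size a' < 3 ^ size u"
        unfolding n power_Suc by linarith+
    qed
    have "\<exists>q \<le> p1 + p. pa s a' q"
      using sz less.prems aa u(3) p(2) by (intro IH[of s a a']) (auto simp: add.assoc)
    then obtain q where q: "q \<le> p1 + p" "pa s a' q" by blast
    have "\<exists>q' \<le> q + p2. pa s t q'"
      using sz less.prems aa u(6) q(2) by (intro IH[of s a' t]) auto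
    then obtain q' where "q' \<le> q + p2" "pa s t q'" by blast
    then show ?thesis using q(1) p(1) u(4,7) by (intro exI[of _ q']) auto
  qed
  from less.prems(4) show ?case
  proof (cases rule: path.cases)
    case refl
    then show ?thesis using less.prems(5) by auto
  next
    case (left l a r C q)
    then show ?thesis using via_left by blast
  next
    case 1: (base z z')
    from less.prems(5) show ?thesis
    proof (cases rule: path.cases)
      case (base y y')
      then show ?thesis using 1 mZ(5)[of z z' y'] path.base[of z Z y' dZ] by auto
    next
      case (right l a r C q)
      then show ?thesis using via_right by blast
    qed (use 1 less.prems(4) in auto)
  next
    case 1: (side l l' C)
    have C: "cluster Q Z dZ C" using New_terms(1)[of l C] less.prems(1) 1(1) by simp
    from less.prems(5) show ?thesis
    proof (cases rule: path.cases)
      case refl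
      then show ?thesis using less.prems(4) by auto
    next
      case (side k k' D)
      then have k: "(l, Inl l', q1) |\<in>| C" "(l', Inl k', q2) |\<in>| C" "t = New k' C" using 1 by auto
      have "0 \<le> q1 + q2" using clusterD(2)[OF C k(1)] clusterD(2)[OF C k(2)] by simp
      moreover have "pa s s 0" by (rule path.refl)
      ultimately show ?thesis
        using clusterD(6)[OF C k(1,2)] 1(1) k(3) path.side[of l k' _ C Z dZ] by blast
    next
      case (left k a r' D q)
      then have k: "(l, Inl l', q1) |\<in>| C" "(l', Inr a, r') |\<in>| C" "pa a t q" "q2 = r' + q" using 1 by auto
      obtain r'' where r'': "r'' \<le> q1 + r'" "(l, Inr a, r'') |\<in>| C" using clusterD(5)[OF C k(1,2)] by blast
      have "pa s t (r'' + q)" using path.left[OF r''(2) k(3)] 1(1) by simp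
      then show ?thesis using r''(1) k(4) by (intro exI[of _ "r'' + q"]) auto
    next
      case (right l a r C q)
      then show ?thesis using via_right by blast
    qed (use 1 in auto)
  next
    case 1: (right l a r C q)
    have C: "cluster Q Z dZ C" using New_terms(1)[of l C] less.prems(2) 1(1) by simp
    from less.prems(5) show ?thesis
    proof (cases rule: path.cases)
      case refl
      then show ?thesis using less.prems(4) by auto
    next
      case (side k k' D)
      then have k: "(k', Inl l, q2) |\<in>| C" "(l, Inr a, r) |\<in>| C" "t = New k' C"
        using 1 clusterD(4)[OF C] by auto
      obtain r'' where r'': "r'' \<le> q2 + r" "(k', Inr a, r'') |\<in>| C" using clusterD(5)[OF C k(1,2)] by blast
      have "pa s t (q + r'')" using path.right[OF r''(2) 1(4)] k(3) by simp
      then show ?thesis using r''(1) 1(2) by (intro exI[of _ "q + r''"]) auto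
    next
      case (left k a' r' D q')
      then show ?thesis using cross[of l C a r q a' r' q'] 1 by auto
    next
      case (right l a r C q)
      then show ?thesis using via_right by blast
    qed (use 1 in auto)
  qed
qed

text \<open>Costs of paths are obtained from finitely many entries of the two terms, so the minimum defining \<open>dT\<close> is attained.\<close>

lemma finite_costs:
  fixes s t :: "('z, 'l) tm"
  shows "finite {q. pa s t q}"
proof (induction "size s + size t" arbitrary: s t rule: less_induct)
  case less
  define U where "U C G = (\<Union>(k, x, r)\<in>fset C. case x of Inl _ \<Rightarrow> {r} | Inr a \<Rightarrow> (\<lambda>q. r + q) ` G a)"
    for C :: "('l \<times> ('l + ('z, 'l) tm) \<times> real) fset" and G
  define A where "A = (case s of Pt _ \<Rightarrow> {} | New l C \<Rightarrow> U C (\<lambda>a. if size a < size s then {q. pa a t q} else {}))"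
  define B where "B = (case t of Pt _ \<Rightarrow> {} | New l C \<Rightarrow> U C (\<lambda>a. if size a < size t then {q. pa s a q} else {}))"
  define D where "D = (case (s, t) of (Pt z, Pt z') \<Rightarrow> {dZ z z'} | _ \<Rightarrow> {})"
  have U: "finite (U C G)" if "\<And>a. finite (G a)" for C G
  proof -
    have "finite (case x of Inl _ \<Rightarrow> {r} | Inr a \<Rightarrow> (\<lambda>q. r + q) ` G a)" for x :: "'l + ('z, 'l) tm" and r :: real
      using that by (cases x) auto
    then show ?thesis unfolding U_def by (intro finite_UN_I) auto
  qed
  have inU: "r \<in> U C G" if "(k, Inl l', r) |\<in>| C" for k l' r C G
    unfolding U_def using that by (intro UN_I[of "(k, Inl l', r)"]) auto
  have inU': "r + q \<in> U C G" if "(k, Inr a, r) |\<in>| C" "q \<in> G a" for k a r q C G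
    unfolding U_def using that by (intro UN_I[of "(k, Inr a, r)"]) auto
  have "finite A" "finite B" "finite D"
    using less by (auto simp: A_def B_def D_def split: tm.splits intro!: U)
  moreover have "{q. pa s t q} \<subseteq> insert 0 (A \<union> B \<union> D)"
  proof
    fix q assume "q \<in> {q. pa s t q}"
    then have "pa s t q" by simp
    then show "q \<in> insert 0 (A \<union> B \<union> D)"
    proof (cases rule: path.cases)
      case (side l l' C)
      then have "q \<in> A" unfolding A_def using inU[OF side(3)] by simp
      then show ?thesis by blast
    next
      case (left l a r C q')
      then have "q \<in> A" unfolding A_def using inU'[OF left(3)] size_attached[OF left(3), of l] by simp
      then show ?thesis by blast
    next
      case (right l a r C q')
      then have "q \<in> B"
        unfolding B_def using inU'[OF right(3)] size_attached[OF right(3), of l] by (simp add: add.commute)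
      then show ?thesis by blast
    qed (auto simp: D_def)
  qed
  ultimately show ?case using finite_subset by blast
qed

lemma path_to_point: "valid Q Z dZ t \<Longrightarrow> \<exists>z\<in>Z. \<exists>q. pa t (Pt z) q"
proof (induction rule: valid.induct)
  case (Pt z)
  then show ?case using path.refl by blast
next
  case (New C l a r)
  obtain z q where "z \<in> Z" "pa a (Pt z) q" using New.IH[OF New.hyps(3)] by blast
  then show ?case using path.left[OF New.hyps(3), of Z dZ "Pt z" q] by blast
qed

lemma path_exists:
  assumes "s \<in> terms" "t \<in> terms"
  shows "\<exists>q. pa s t q"
proof -
  obtain z q z' q' where z: "z \<in> Z" "pa s (Pt z) q" "z' \<in> Z" "pa t (Pt z') q'"
    using assms path_to_point unfolding terms_def by blast
  have "pa (Pt z') t q'" using path_sym[OF z(4) assms(2)] Pt_terms z(3) by blast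
  then obtain q'' where "pa (Pt z) t q''"
    using path_triangle[of "Pt z" "Pt z'" t] path.base[OF z(1,3)] Pt_terms z assms by metis
  then show ?thesis using path_triangle[OF assms(1) _ assms(2) z(2)] Pt_terms z(1) by blast
qed

lemma dT_path: "s \<in> terms \<Longrightarrow> t \<in> terms \<Longrightarrow> pa s t (dT s t)"
  using Min_in[OF finite_costs, of s t] path_exists[of s t] by (auto simp: dT_def)

lemma dT_le: "pa s t q \<Longrightarrow> dT s t \<le> q"
  unfolding dT_def by (intro Min_le finite_costs) simp

lemma Qmetric_terms: "Qmetric Q (terms :: ('z, 'l) tm set) dT"
  unfolding Qmetric_def metric_on_def
proof (intro conjI ballI)
  fix s t :: "('z, 'l) tm" assume st: "s \<in> terms" "t \<in> terms"
  note c = path_cost[OF dT_path[OF st] st]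
  show "0 \<le> dT s t" "dT s t \<in> Q" using c by auto
  show "dT s t = dT t s"
    using dT_le[OF path_sym[OF dT_path[OF st] st]] dT_le[OF path_sym[OF dT_path[OF st(2,1)] st(2,1)]] by simp
  show "dT s t = 0 \<longleftrightarrow> s = t"
  proof
    assume "s = t"
    then show "dT s t = 0" using c dT_le[OF path.refl, of s] by simp
  qed (use c in simp)
  fix u :: "('z, 'l) tm" assume u: "u \<in> terms"
  obtain q where "q \<le> dT s t + dT t u" "pa s u q"
    using path_triangle[OF st u dT_path[OF st] dT_path[OF st(2) u]] by blast
  then show "dT s u \<le> dT s t + dT t u" using dT_le by force
qed

text \<open>A path from \<open>New l C\<close> to a term of smaller size has to leave the cluster through a point to which \<open>l\<close> is attached. This is what
shows that the distances prescribed by a cluster are not shortened.\<close>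

lemma path_lower_bound:
  "pa s t q \<Longrightarrow> s = New l C \<Longrightarrow> size t < size s \<Longrightarrow>
     \<exists>a r q'. (l, Inr a, r) |\<in>| C \<and> pa a t q' \<and> r + q' \<le> q"
proof (induction rule: path.induct)
  case (left l' a r C' t q)
  then show ?case by auto
next
  case (right l' b r D s q)
  have "size b < size s" using size_attached[OF right(1), of l'] right.prems by simp
  then obtain a r' q' where "(l, Inr a, r') |\<in>| C" "pa a b q'" "r' + q' \<le> q" using right.IH right.prems(1) by blast
  then show ?case using path.right[OF right(1), of Z dZ a q'] by force
qed auto

text \<open>Distances \<open>H i b\<close> of \<open>m\<close> new points from a finite set \<open>B\<close>, and \<open>\<Delta> i j\<close> among each other, that satisfy the triangle
inequality. Conditions involving \<open>\<Delta>\<close> are restricted to distinct indices, so its diagonal may be arbitrary.\<close>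

definition extension_data ::
  "('z, 'l) tm set \<Rightarrow> nat \<Rightarrow> (nat \<Rightarrow> ('z, 'l) tm \<Rightarrow> real) \<Rightarrow> (nat \<Rightarrow> nat \<Rightarrow> real) \<Rightarrow> bool" where
  "extension_data B m H \<Delta> \<longleftrightarrow> finite B \<and> B \<noteq> {} \<and> B \<subseteq> terms \<and>
     (\<forall>i<m. \<forall>b\<in>B. H i b \<in> Q \<and> 0 < H i b) \<and>
     (\<forall>i<m. \<forall>j<m. i \<noteq> j \<longrightarrow> \<Delta> i j \<in> Q \<and> 0 < \<Delta> i j \<and> \<Delta> i j = \<Delta> j i) \<and>
     (\<forall>i<m. \<forall>b\<in>B. \<forall>b'\<in>B. H i b \<le> H i b' + dT b' b \<and> dT b b' \<le> H i b + H i b') \<and>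
     (\<forall>i<m. \<forall>j<m. \<forall>b\<in>B. i \<noteq> j \<longrightarrow> H i b \<le> \<Delta> i j + H j b \<and> \<Delta> i j \<le> H i b + H j b) \<and>
     (\<forall>i<m. \<forall>j<m. \<forall>k<m. i \<noteq> j \<and> j \<noteq> k \<and> i \<noteq> k \<longrightarrow> \<Delta> i k \<le> \<Delta> i j + \<Delta> j k)"

definition attach ::
  "('z, 'l) tm set \<Rightarrow> nat \<Rightarrow> (nat \<Rightarrow> 'l) \<Rightarrow> (nat \<Rightarrow> ('z, 'l) tm \<Rightarrow> real) \<Rightarrow> (nat \<Rightarrow> nat \<Rightarrow> real) \<Rightarrow>
     ('l \<times> ('l + ('z, 'l) tm) \<times> real) fset" where
  "attach B m w H \<Delta> = Abs_fset
     ({(w i, Inl (w j), \<Delta> i j) |i j. i < m \<and> j < m \<and> i \<noteq> j} \<union> {(w i, Inr b, H i b) |i b. i < m \<and> b \<in> B})"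

lemma fset_attach:
  assumes "finite B"
  shows "fset (attach B m w H \<Delta>) =
     {(w i, Inl (w j), \<Delta> i j) |i j. i < m \<and> j < m \<and> i \<noteq> j} \<union> {(w i, Inr b, H i b) |i b. i < m \<and> b \<in> B}"
proof -
  have "{(w i, Inl (w j), \<Delta> i j) |i j. i < m \<and> j < m \<and> i \<noteq> j} \<subseteq>
      (\<lambda>(i, j). (w i, Inl (w j), \<Delta> i j)) ` ({..<m} \<times> {..<m})" by auto
  then have 1: "finite {(w i, Inl (w j), \<Delta> i j) |i j. i < m \<and> j < m \<and> i \<noteq> j}"
    by (rule finite_subset) simp
  have "{(w i, Inr b, H i b) |i b. i < m \<and> b \<in> B} \<subseteq> (\<lambda>(i, b). (w i, Inr b, H i b)) ` ({..<m} \<times> B)" by auto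
  then have 2: "finite {(w i, Inr b, H i b) |i b. i < m \<and> b \<in> B}"
    by (rule finite_subset) (simp add: assms)
  show ?thesis unfolding attach_def by (rule Abs_fset_inverse) (use 1 2 in simp)
qed

text \<open>The space of terms realizes all such data, and it does so with arbitrarily chosen distinct labels.\<close>

lemma attach_terms:
  fixes B :: "('z, 'l) tm set"
  assumes X: "extension_data B m H \<Delta>" and w: "inj_on w {..<m}"
  defines "C \<equiv> attach B m w H \<Delta>"
  shows "\<And>i. i < m \<Longrightarrow> New (w i) C \<in> terms"
    and "\<And>i b. i < m \<Longrightarrow> b \<in> B \<Longrightarrow> dT (New (w i) C) b = H i b"
    and "\<And>i j. i < m \<Longrightarrow> j < m \<Longrightarrow> i \<noteq> j \<Longrightarrow> dT (New (w i) C) (New (w j) C) = \<Delta> i j"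
proof -
  have B: "finite B" "B \<noteq> {}" "B \<subseteq> terms" using X by (auto simp: extension_data_def)
  have HQ: "H i b \<in> Q" "0 < H i b" if "i < m" "b \<in> B" for i b using X that by (auto simp: extension_data_def)
  have XD: "\<forall>i<m. \<forall>j<m. i \<noteq> j \<longrightarrow> \<Delta> i j \<in> Q \<and> 0 < \<Delta> i j \<and> \<Delta> i j = \<Delta> j i"
    using X unfolding extension_data_def by (elim conjE)
  have XH: "\<forall>i<m. \<forall>b\<in>B. \<forall>b'\<in>B. H i b \<le> H i b' + dT b' b \<and> dT b b' \<le> H i b + H i b'"
    using X unfolding extension_data_def by (elim conjE)
  have XHD: "\<forall>i<m. \<forall>j<m. \<forall>b\<in>B. i \<noteq> j \<longrightarrow> H i b \<le> \<Delta> i j + H j b \<and> \<Delta> i j \<le> H i b + H j b"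
    using X unfolding extension_data_def by (elim conjE)
  have XDD: "\<forall>i<m. \<forall>j<m. \<forall>k<m. i \<noteq> j \<and> j \<noteq> k \<and> i \<noteq> k \<longrightarrow> \<Delta> i k \<le> \<Delta> i j + \<Delta> j k"
    using X unfolding extension_data_def by (elim conjE)
  have DQ: "\<Delta> i j \<in> Q" "0 < \<Delta> i j" "\<Delta> i j = \<Delta> j i" if "i < m" "j < m" "i \<noteq> j" for i j
    using XD[rule_format, OF that] by blast+
  have HH: "H i b \<le> H i b' + dT b' b" "dT b b' \<le> H i b + H i b'" if "i < m" "b \<in> B" "b' \<in> B" for i b b'
    using XH[rule_format, OF that] by simp_all
  have HD: "H i b \<le> \<Delta> i j + H j b" "\<Delta> i j \<le> H i b + H j b" if "i < m" "j < m" "i \<noteq> j" "b \<in> B" for i j b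
    using XHD[rule_format, OF that(1,2,4,3)] by simp_all
  have DD: "\<Delta> i k \<le> \<Delta> i j + \<Delta> j k" if "i < m" "j < m" "k < m" "i \<noteq> j" "j \<noteq> k" "i \<noteq> k" for i j k
    using XDD that by simp
  have wi: "w i = w j \<longleftrightarrow> i = j" if "i < m" "j < m" for i j using w that by (auto simp: inj_on_def)
  have memC: "x |\<in>| C \<longleftrightarrow> x \<in> fset C" for x by simp
  have CR: "(k, Inr a, r) |\<in>| C \<longleftrightarrow> (\<exists>i<m. k = w i \<and> a \<in> B \<and> r = H i a)" for k a r
    unfolding memC C_def fset_attach[OF B(1)] by auto
  have CL: "(k, Inl k', r) |\<in>| C \<longleftrightarrow> (\<exists>i<m. \<exists>j<m. i \<noteq> j \<and> k = w i \<and> k' = w j \<and> r = \<Delta> i j)" for k k' r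
    unfolding memC C_def fset_attach[OF B(1)] by auto
  have CRi: "(w i, Inr a, r) |\<in>| C \<longleftrightarrow> a \<in> B \<and> r = H i a" if "i < m" for i a r
    unfolding CR using that wi by auto
  have CLi: "(w i, Inl (w j), r) |\<in>| C \<longleftrightarrow> i \<noteq> j \<and> r = \<Delta> i j" if "i < m" "j < m" for i j r
    unfolding CL using that wi by auto
  have clus: "cluster Q Z dZ C"
    unfolding cluster_def
  proof (intro conjI allI impI)
    fix k x r assume *: "(k, x, r) |\<in>| C"
    have "r \<in> Q \<and> 0 < r"
    proof (cases x)
      case (Inl k')
      then obtain i j where "i < m" "j < m" "i \<noteq> j" "r = \<Delta> i j" using * by (auto simp: CL)
      then show ?thesis using DQ(1,2) by simp
    next
      case (Inr a)
      then obtain i where "i < m" "a \<in> B" "r = H i a" using * by (auto simp: CR)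
      then show ?thesis using HQ by simp
    qed
    then show "r \<in> Q" "0 < r" by auto
  next
    fix k a a' r r' assume "(k, Inr a, r) |\<in>| C \<and> (k, Inr a', r') |\<in>| C"
    then obtain i j where j: "i < m" "k = w i" "a \<in> B" "r = H i a" "j < m" "k = w j" "a' \<in> B" "r' = H j a'"
      unfolding CR by blast
    have "j = i" using wi[OF j(5,1)] j(2,6) by simp
    then have i: "i < m" "k = w i" "a \<in> B" "a' \<in> B" "r = H i a" "r' = H i a'" using j by simp_all
    then show "\<exists>q\<le>r + r'. path Z dZ a a' q" using HH(2)[OF i(1,3,4)] dT_path[of a a'] B(3) by auto
  next
    fix k k' r assume "(k, Inl k', r) |\<in>| C"
    then obtain i j where ij: "i < m" "j < m" "i \<noteq> j" "k = w i" "k' = w j" "r = \<Delta> i j" by (auto simp: CL)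
    then show "(k', Inl k, r) |\<in>| C" using CLi[OF ij(2,1)] DQ(3)[OF ij(1-3)] by simp
  next
    fix k k' a r r' assume *: "(k, Inl k', r) |\<in>| C \<and> (k', Inr a, r') |\<in>| C"
    then obtain i j where ij: "i < m" "j < m" "i \<noteq> j" "k = w i" "k' = w j" "r = \<Delta> i j" by (auto simp: CL)
    then have "a \<in> B" "r' = H j a" using CRi[OF ij(2)] * by auto
    then show "\<exists>r''\<le>r + r'. (k, Inr a, r'') |\<in>| C" using CRi[OF ij(1)] HD(1)[OF ij(1-3)] ij by auto
  next
    fix k k' k'' r r' assume *: "(k, Inl k', r) |\<in>| C \<and> (k', Inl k'', r') |\<in>| C"
    then obtain i j where ij: "i < m" "j < m" "i \<noteq> j" "k = w i" "k' = w j" "r = \<Delta> i j" by (auto simp: CL)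
    obtain j' l where l: "j' < m" "l < m" "j' \<noteq> l" "k' = w j'" "k'' = w l" "r' = \<Delta> j' l" using * by (auto simp: CL)
    have "j' = j" using wi[OF l(1) ij(2)] l(4) ij(5) by simp
    then show "k = k'' \<or> (\<exists>r''\<le>r + r'. (k, Inl k'', r'') |\<in>| C)"
      using CLi[OF ij(1) l(2)] DD[OF ij(1,2) l(2) ij(3)] ij l by (cases "i = l") auto
  qed
  have sz: "size b < size (New l C)" if "b \<in> B" "m > 0" for b l
    using size_attached[of "w 0" b "H 0 b" C l] CRi[OF that(2)] that(1) by simp
  show T: "New (w i) C \<in> terms" if i: "i < m" for i
  proof -
    obtain b where b: "b \<in> B" using B(2) by blast
    have "valid Q Z dZ a" if "(k, Inr a, r) |\<in>| C" for k a r using that B(3) by (auto simp: CR terms_def)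
    then show ?thesis using valid.New[OF clus, of "w i" b "H i b"] CRi[OF i] b by (simp add: terms_def)
  qed
  show HB: "dT (New (w i) C) b = H i b" if i: "i < m" and b: "b \<in> B" for i b
  proof (rule antisym)
    have "pa (New (w i) C) b (H i b + 0)" by (rule path.left[OF _ path.refl]) (simp add: CRi[OF i] b)
    then show "dT (New (w i) C) b \<le> H i b" using dT_le by force
    have "b \<in> terms" using b B(3) by blast
    from path_lower_bound[OF dT_path[OF T[OF i] this] HOL.refl] sz[OF b] i
    obtain a r q where a: "(w i, Inr a, r) |\<in>| C" "pa a b q" "r + q \<le> dT (New (w i) C) b" by fastforce
    then have "a \<in> B" "r = H i a" using CRi[OF i] by auto
    then show "H i b \<le> dT (New (w i) C) b" using HH(1)[OF i b, of a] dT_le[OF a(2)] a(3) by simp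
  qed
  show "dT (New (w i) C) (New (w j) C) = \<Delta> i j" if ij: "i < m" "j < m" "i \<noteq> j" for i j
  proof (rule antisym)
    show "dT (New (w i) C) (New (w j) C) \<le> \<Delta> i j" using CLi[OF ij(1,2)] ij by (intro dT_le path.side) auto
    have "\<Delta> i j \<le> q" if p: "pa (New (w i) C) (New (w j) C) q" for q
      using p
    proof (cases rule: path.cases)
      case refl
      then show ?thesis using wi[OF ij(1,2)] ij(3) by simp
    next
      case (left a r q')
      then have a: "a \<in> B" "r = H i a" using CRi[OF ij(1)] by auto
      then have "pa (New (w j) C) a q'" using path_sym[OF left(3)] T[OF ij(2)] B(3) by auto
      then have "H j a \<le> q'" using dT_le HB[OF ij(2) a(1)] by metis
      then show ?thesis using HD(2)[OF ij a(1)] left(1) a(2) by simp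
    next
      case (right a r q')
      then have a: "a \<in> B" "r = H j a" using CRi[OF ij(2)] by auto
      then have "H i a \<le> q'" using dT_le[OF right(3)] HB[OF ij(1) a(1)] by simp
      then show ?thesis using HD(2)[OF ij a(1)] right(1) a(2) by simp
    qed (use CLi[OF ij(1,2)] in auto)
    then show "\<Delta> i j \<le> dT (New (w i) C) (New (w j) C)" using dT_path[OF T[OF ij(1)] T[OF ij(2)]] by blast
  qed
qed

lemma one_point_extensions_terms: "one_point_extensions Q (terms :: ('z, 'l) tm set) dT"
  unfolding one_point_extensions_def
proof (intro allI impI)
  fix F :: "('z, 'l) tm set" and h
  assume F: "finite F \<and> F \<subseteq> terms \<and> F \<noteq> {} \<and> (\<forall>x\<in>F. h x \<in> Q \<and> 0 < h x) \<and>
     (\<forall>x\<in>F. \<forall>y\<in>F. h x \<le> h y + dT x y \<and> dT x y \<le> h x + h y)"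
  have "dT x y = dT y x" if "x \<in> F" "y \<in> F" for x y
    using metric_onD(2)[OF QmetricD(1)[OF Qmetric_terms]] F that by blast
  then have X: "extension_data F 1 (\<lambda>_. h) (\<lambda>_ _. 1)" using F by (auto simp: extension_data_def)
  (* A single new point; any label will do. *)
  have "inj_on (\<lambda>_. undefined) {..<1::nat}" by (auto simp: inj_on_def)
  note a = attach_terms[OF X this]
  show "\<exists>z\<in>terms. \<forall>x\<in>F. dT z x = h x" using a(1)[of 0] a(2)[of 0] by auto
qed

lemma set1_terms: "valid Q Z dZ t \<Longrightarrow> set1_tm t \<subseteq> Z"
proof (induction rule: valid.induct)
  case (New C l a r)
  have "set1_tm x \<subseteq> Z" if "(k, y, q) \<in> fset C" "x \<in> Basic_BNFs.setr y" for k y q x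
    using New.IH[of k x q] that by (cases y) (auto elim: setr.cases)
  then show ?case by (fastforce elim!: snds.cases fsts.cases)
qed auto

lemma path_map:
  assumes g: "g ` Z \<subseteq> Z" "isometry_on Z dZ dZ g"
  shows "pa s t q \<Longrightarrow> pa (map_tm g \<sigma> s) (map_tm g \<sigma> t) q"
proof (induction rule: path.induct)
  case (base z z')
  then have "path Z dZ (Pt (g z)) (Pt (g z')) (dZ (g z) (g z'))" using g(1) by (intro path.base) auto
  then show ?case using g(2) base by (simp add: isometry_on_def)
next
  case (side l l' r C)
  have m: "(\<sigma> l, Inl (\<sigma> l'), r) |\<in>| map_prod \<sigma> (map_prod (map_sum \<sigma> (map_tm g \<sigma>)) id) |`| C"
    using side by force
  show ?case using path.side[OF m] by simp
next
  case (left l a r C t q)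
  have m: "(\<sigma> l, Inr (map_tm g \<sigma> a), r) |\<in>| map_prod \<sigma> (map_prod (map_sum \<sigma> (map_tm g \<sigma>)) id) |`| C"
    using left(1) by force
  show ?case using path.left[OF m left.IH] by simp
next
  case (right l a r C s q)
  have m: "(\<sigma> l, Inr (map_tm g \<sigma> a), r) |\<in>| map_prod \<sigma> (map_prod (map_sum \<sigma> (map_tm g \<sigma>)) id) |`| C"
    using right(1) by force
  show ?case using path.right[OF m right.IH] by simp
qed (simp add: path.refl)

lemma valid_map:
  assumes g: "g ` Z \<subseteq> Z" "isometry_on Z dZ dZ g" and \<sigma>: "inj \<sigma>"
  shows "valid Q Z dZ t \<Longrightarrow> valid Q Z dZ (map_tm g \<sigma> t)"
proof (induction rule: valid.induct)
  case (Pt z)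
  then show ?case using g(1) by (auto intro!: valid.Pt)
next
  case (New C l a r)
  define C' where "C' = map_prod \<sigma> (map_prod (map_sum \<sigma> (map_tm g \<sigma>)) id) |`| C"
  note C = clusterD[OF New.hyps(1)]
  have up: "(k, x, q) |\<in>| C \<Longrightarrow> (\<sigma> k, map_sum \<sigma> (map_tm g \<sigma>) x, q) |\<in>| C'" for k x q
    unfolding C'_def by force
  have dn: "\<exists>k0 x0. k = \<sigma> k0 \<and> x = map_sum \<sigma> (map_tm g \<sigma>) x0 \<and> (k0, x0, q) |\<in>| C" if "(k, x, q) |\<in>| C'" for k x q
    using that[unfolded C'_def]
  proof (rule fimageE)
    fix y assume "(k, x, q) = map_prod \<sigma> (map_prod (map_sum \<sigma> (map_tm g \<sigma>)) id) y" "y |\<in>| C"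
    then show ?thesis by (cases y) auto
  qed
  have dnR: "\<exists>k0 a0. k = \<sigma> k0 \<and> a = map_tm g \<sigma> a0 \<and> (k0, Inr a0, q) |\<in>| C" if kk: "(k, Inr a, q) |\<in>| C'" for k a q
  proof -
    obtain k0 x0 where x0: "k = \<sigma> k0" "Inr a = map_sum \<sigma> (map_tm g \<sigma>) x0" "(k0, x0, q) |\<in>| C" using dn[OF kk] by blast
    then show ?thesis by (cases x0) auto
  qed
  have dnL: "\<exists>k0 l0. k = \<sigma> k0 \<and> l = \<sigma> l0 \<and> (k0, Inl l0, q) |\<in>| C" if kk: "(k, Inl l, q) |\<in>| C'" for k l q
  proof -
    obtain k0 x0 where x0: "k = \<sigma> k0" "Inl l = map_sum \<sigma> (map_tm g \<sigma>) x0" "(k0, x0, q) |\<in>| C" using dn[OF kk] by blast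
    then show ?thesis by (cases x0) auto
  qed
  have \<sigma>i: "\<sigma> k = \<sigma> k' \<longleftrightarrow> k = k'" for k k' using \<sigma> by (simp add: inj_eq)
  have "cluster Q Z dZ C'"
    unfolding cluster_def
  proof (intro conjI allI impI)
    fix k x r assume "(k, x, r) |\<in>| C'"
    then obtain k0 x0 where "(k0, x0, r) |\<in>| C" using dn by blast
    then show "r \<in> Q" "0 < r" using C(1,2) by blast+
  next
    fix k a a' r r' assume "(k, Inr a, r) |\<in>| C' \<and> (k, Inr a', r') |\<in>| C'"
    then obtain k0 a0 k1 a1 where 0: "k = \<sigma> k0" "a = map_tm g \<sigma> a0" "(k0, Inr a0, r) |\<in>| C"
      and 1: "k = \<sigma> k1" "a' = map_tm g \<sigma> a1" "(k1, Inr a1, r') |\<in>| C" using dnR by meson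
    then have "k1 = k0" using \<sigma>i by simp
    then show "\<exists>q\<le>r + r'. path Z dZ a a' q" using C(3) 0 1 path_map[OF g] by metis
  next
    fix k k' r assume "(k, Inl k', r) |\<in>| C'"
    then obtain k0 l0 where 0: "k = \<sigma> k0" "k' = \<sigma> l0" "(k0, Inl l0, r) |\<in>| C" using dnL by blast
    then show "(k', Inl k, r) |\<in>| C'" using up[OF C(4)[OF 0(3)]] by simp
  next
    fix k k' a r r' assume "(k, Inl k', r) |\<in>| C' \<and> (k', Inr a, r') |\<in>| C'"
    then obtain k0 l0 l1 a0 where 0: "k = \<sigma> k0" "k' = \<sigma> l0" "(k0, Inl l0, r) |\<in>| C"
      and 1: "k' = \<sigma> l1" "a = map_tm g \<sigma> a0" "(l1, Inr a0, r') |\<in>| C" using dnL dnR by meson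
    then have "l1 = l0" using \<sigma>i by simp
    then obtain r'' where "r'' \<le> r + r'" "(k0, Inr a0, r'') |\<in>| C" using C(5)[OF 0(3)] 1(3) by blast
    then show "\<exists>r''\<le>r + r'. (k, Inr a, r'') |\<in>| C'" using up[of k0 "Inr a0" r''] 0 1 by auto
  next
    fix k k' k'' r r' assume "(k, Inl k', r) |\<in>| C' \<and> (k', Inl k'', r') |\<in>| C'"
    then obtain k0 l0 l1 m0 where 0: "k = \<sigma> k0" "k' = \<sigma> l0" "(k0, Inl l0, r) |\<in>| C"
      and 1: "k' = \<sigma> l1" "k'' = \<sigma> m0" "(l1, Inl m0, r') |\<in>| C" using dnL by meson
    then have "l1 = l0" using \<sigma>i by simp
    then have "k0 = m0 \<or> (\<exists>r''\<le>r + r'. (k0, Inl m0, r'') |\<in>| C)" using C(6)[OF 0(3)] 1(3) by blast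
    then show "k = k'' \<or> (\<exists>r''\<le>r + r'. (k, Inl k'', r'') |\<in>| C')" using up[of k0 "Inl m0"] 0 1 by auto
  qed
  moreover have "valid Q Z dZ b" if "(k, Inr b, q) |\<in>| C'" for k b q using dnR[OF that] New.IH by blast
  moreover have "(\<sigma> l, Inr (map_tm g \<sigma> a), r) |\<in>| C'" using up[OF New.hyps(3)] by simp
  ultimately have "valid Q Z dZ (New (\<sigma> l) C')" by (rule valid.New)
  then show ?case by (simp add: C'_def)
qed

text \<open>Renaming points by \<open>g\<close> and labels by \<open>\<sigma>\<close> carries paths to paths of the same cost and valid terms to valid terms, and it is
undone by the inverse renaming. The inverse \<open>g'\<close> is given separately because \<open>g\<close> is controlled on \<open>Z\<close> only.\<close>

lemma term_action:
  assumes g: "g ` Z \<subseteq> Z" "isometry_on Z dZ dZ g" "g' ` Z \<subseteq> Z" "isometry_on Z dZ dZ g'"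
    and inv: "\<And>z. z \<in> Z \<Longrightarrow> g' (g z) = z" "\<And>z. z \<in> Z \<Longrightarrow> g (g' z) = z" and \<sigma>: "bij \<sigma>"
  shows "map_tm g \<sigma> ` terms = (terms :: ('z, 'l) tm set)"
    and "isometry_on (terms :: ('z, 'l) tm set) dT dT (map_tm g \<sigma>)"
proof -
  define \<sigma>' where "\<sigma>' = inv_into UNIV \<sigma>"
  have \<sigma>': "inj \<sigma>" "inj \<sigma>'" "\<sigma>' (\<sigma> x) = x" "\<sigma> (\<sigma>' x) = x" for x
    using \<sigma> by (auto simp: \<sigma>'_def bij_is_inj bij_is_surj surj_f_inv_f bij_imp_bij_inv)
  have 1: "map_tm g' \<sigma>' (map_tm g \<sigma> t) = t" "map_tm g \<sigma> (map_tm g' \<sigma>' t) = t" if "t \<in> terms" for t :: "('z, 'l) tm"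
  proof -
    have "set1_tm t \<subseteq> Z" using that set1_terms by (simp add: terms_def)
    then show "map_tm g' \<sigma>' (map_tm g \<sigma> t) = t" "map_tm g \<sigma> (map_tm g' \<sigma>' t) = t"
      unfolding tm.map_comp using inv \<sigma>' by (auto intro!: tm.map_ident_strong)
  qed
  have 2: "map_tm g \<sigma> t \<in> terms" "map_tm g' \<sigma>' t \<in> terms" if "t \<in> terms" for t :: "('z, 'l) tm"
    using that valid_map[OF g(1,2) \<sigma>'(1)] valid_map[OF g(3,4) \<sigma>'(2)] by (simp_all add: terms_def)
  show "map_tm g \<sigma> ` terms = (terms :: ('z, 'l) tm set)"
  proof
    show "map_tm g \<sigma> ` terms \<subseteq> (terms :: ('z, 'l) tm set)" using 2(1) by blast
    show "(terms :: ('z, 'l) tm set) \<subseteq> map_tm g \<sigma> ` terms"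
    proof
      fix t :: "('z, 'l) tm" assume t: "t \<in> terms"
      show "t \<in> map_tm g \<sigma> ` terms" using 1(2)[OF t, symmetric] 2(2)[OF t] by (rule image_eqI)
    qed
  qed
  have "pa (map_tm g \<sigma> s) (map_tm g \<sigma> t) q \<longleftrightarrow> pa s t q" if "s \<in> terms" "t \<in> terms" for s t :: "('z, 'l) tm" and q
    using path_map[OF g(1,2), of s t q \<sigma>] path_map[OF g(3,4), of "map_tm g \<sigma> s" "map_tm g \<sigma> t" q \<sigma>'] 1(1) that by auto
  then show "isometry_on (terms :: ('z, 'l) tm set) dT dT (map_tm g \<sigma>)"
    by (simp add: isometry_on_def dT_def)
qed

lemma map_tm_funpow:
  fixes \<sigma> :: "'l \<Rightarrow> 'l"
  shows "(map_tm id \<sigma> ^^ n) t = map_tm id (\<sigma> ^^ n) t"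
proof (induction n)
  case 0
  show ?case by (simp add: tm.map_id0[unfolded id_def] id_def)
next
  case (Suc n)
  have "(map_tm id \<sigma> ^^ Suc n) t = map_tm id \<sigma> (map_tm id (\<sigma> ^^ n) t)"
    by (simp only: funpow.simps o_apply Suc)
  also have "\<dots> = map_tm id (\<sigma> ^^ Suc n) t"
  proof -
    have "\<sigma> ^^ Suc n = \<sigma> \<circ> (\<sigma> ^^ n)" by (simp add: fun_eq_iff)
    then show ?thesis by (simp only: tm.map_comp id_comp)
  qed
  finally show ?case .
qed

lemma finite_set2_tm: "finite (set2_tm t)"
proof (induction t)
  case (New l C)
  have "finite (\<Union>x\<in>Basic_BNFs.setr y. set2_tm x)" "finite (Basic_BNFs.setl y)" if "(k, y, q) \<in> fset C" for k y q
    using New[of "(k, y, q)" "(y, q)" y] that by (cases y; auto simp: sum_set_defs prod_set_defs)+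
  then show ?case by (auto simp: sum_set_defs prod_set_defs split: prod.splits sum.splits)
qed simp

lemma common_period:
  assumes "finite F" "\<And>x. \<exists>n>0. (\<sigma> ^^ n) x = x"
  shows "\<exists>N>0. \<forall>x\<in>F. (\<sigma> ^^ N) x = x"
  using assms(1)
proof (induction F)
  case empty
  then show ?case by (intro exI[of _ 1]) simp
next
  case (insert x F)
  obtain N where N: "N > 0" "\<forall>x\<in>F. (\<sigma> ^^ N) x = x" using insert by blast
  obtain n where n: "n > 0" "(\<sigma> ^^ n) x = x" using assms(2) by blast
  have fx: "(f ^^ k) y = y" if "f y = y" for f :: "'a \<Rightarrow> 'a" and k y using that by (induction k) auto
  have "(\<sigma> ^^ (N * n)) y = y" if "y \<in> insert x F" for y
    using that N(2) n(2) fx[of "\<sigma> ^^ N" y n] fx[of "\<sigma> ^^ n" y N] by (auto simp: funpow_mult mult.commute)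
  then show ?case using N(1) n(1) by (intro exI[of _ "N * n"]) auto
qed

text \<open>A cyclic type over an invariant set \<open>B\<close> is realized by attaching to \<open>B\<close> a cluster with labels along a cycle \<open>w m 0, ..., w m (m - 1)\<close>
of \<open>\<sigma>\<close>. The symmetry of the type says precisely that the cluster is mapped to itself, so its members are
permuted cyclically. Orbits are finite because a term contains finitely many labels, and points of \<open>Z\<close> are fixed.\<close>

lemma generic_term_map:
  fixes \<sigma> :: "'l \<Rightarrow> 'l"
  assumes \<sigma>: "bij \<sigma>" "\<And>m i. i < m \<Longrightarrow> \<sigma> (w m i) = w m (Suc i mod m)" "\<And>m. inj (w m)"
    "\<And>x. \<exists>n>0. (\<sigma> ^^ n) x = x"
  shows "generic_isometry Q (terms :: ('z, 'l) tm set) dT (map_tm id \<sigma>)"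
proof -
  define c :: "('z, 'l) tm \<Rightarrow> ('z, 'l) tm" where "c = map_tm id \<sigma>"
  have act: "c ` terms = terms" "isometry_on terms dT dT c"
    using term_action[of id id \<sigma>] \<sigma>(1) by (auto simp: c_def isometry_on_def)
  have injc: "inj c" unfolding c_def using \<sigma>(1) by (intro tm.inj_map) (auto simp: bij_is_inj)
  note mT = metric_onD[OF QmetricD(1)[OF Qmetric_terms]]
  have fixp: "\<exists>x\<in>terms. c x = x"
  proof -
    obtain z where "z \<in> Z" using Z(2) by blast
    then show ?thesis by (intro bexI[of _ "Pt z"]) (auto simp: c_def Pt_terms)
  qed
  have per: "\<exists>n>0. (c ^^ n) t = t" for t
  proof -
    obtain N where N: "N > 0" "\<forall>x\<in>set2_tm t. (\<sigma> ^^ N) x = x"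
      using common_period[OF finite_set2_tm \<sigma>(4)] by blast
    then have "map_tm id (\<sigma> ^^ N) t = t" by (intro tm.map_ident_strong) auto
    then show ?thesis using N(1) unfolding c_def map_tm_funpow by blast
  qed
  have ext: "\<exists>z. z ` {..<m} \<subseteq> terms \<and> (\<forall>i<m. c (z i) = z (Suc i mod m)) \<and> same_type dT B m y z"
    if B: "finite B" "B \<subseteq> terms" "B \<noteq> {}" "c ` B = B" "y ` {..<m} \<subseteq> terms" and cy: "cyclic_type dT c B m y" for B m y
  proof -
    define H where "H i b = dT (y i) b" for i b
    define \<Delta> where "\<Delta> i j = dT (y i) (y j)" for i j
    define C where "C = attach B m (w m) H \<Delta>"
    have yT: "y i \<in> terms" if "i < m" for i using B(5) that by auto
    have BT: "b \<in> terms" if "b \<in> B" for b using B(2) that by auto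
    have yn: "y i \<noteq> b" if "i < m" "b \<in> B" for i b using cy that by (auto simp: cyclic_type_def)
    have yi: "y i \<noteq> y j" if "i < m" "j < m" "i \<noteq> j" for i j using cy that by (auto simp: cyclic_type_def inj_on_def)
    have "extension_data B m H \<Delta>"
      unfolding extension_data_def
    proof (intro conjI allI impI ballI)
      fix i b assume ib: "i < m" "b \<in> B"
      show "H i b \<in> Q" using QmetricD(2)[OF Qmetric_terms yT BT] ib by (simp add: H_def)
      show "0 < H i b" using mT(1,3)[OF yT BT] ib yn[OF ib] by (simp add: H_def less_le)
      fix b' assume b': "b' \<in> B"
      show "H i b \<le> H i b' + dT b' b" using mT(5)[OF yT[OF ib(1)] BT[OF b'] BT[OF ib(2)]] by (simp add: H_def)
      show "dT b b' \<le> H i b + H i b'"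
        using mT(5)[OF BT[OF ib(2)] yT[OF ib(1)] BT[OF b']] mT(2)[OF BT[OF ib(2)] yT[OF ib(1)]] by (simp add: H_def)
    next
      fix i j assume ij: "i < m" "j < m" "i \<noteq> j"
      show "\<Delta> i j \<in> Q" using QmetricD(2)[OF Qmetric_terms yT yT] ij by (simp add: \<Delta>_def)
      show "0 < \<Delta> i j" using mT(1,3)[OF yT yT] ij yi[OF ij] by (simp add: \<Delta>_def less_le)
      show "\<Delta> i j = \<Delta> j i" using mT(2)[OF yT yT] ij by (simp add: \<Delta>_def)
    next
      fix i j b assume ij: "i < m" "j < m" "b \<in> B" "i \<noteq> j"
      show "H i b \<le> \<Delta> i j + H j b" using mT(5)[OF yT yT BT] ij by (simp add: H_def \<Delta>_def)
      show "\<Delta> i j \<le> H i b + H j b"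
        using mT(5)[OF yT[OF ij(1)] BT[OF ij(3)] yT[OF ij(2)]] mT(2)[OF BT[OF ij(3)] yT[OF ij(2)]] by (simp add: H_def \<Delta>_def)
    next
      fix i j k assume "i < m" "j < m" "k < m"
      then show "\<Delta> i k \<le> \<Delta> i j + \<Delta> j k" using mT(5)[OF yT yT yT] by (simp add: \<Delta>_def)
    qed (use B in auto)
    note at = attach_terms[OF this, of "w m", folded C_def]
    have w: "inj_on (w m) {..<m}" using \<sigma>(3) inj_on_subset by blast
    define F where "F = map_prod \<sigma> (map_prod (map_sum \<sigma> c) (id :: real \<Rightarrow> real))"
    have "inj \<sigma>" using \<sigma>(1) by (rule bij_is_inj)
    then have injF: "inj F" unfolding F_def using injc by (intro prod.inj_map sum.inj_map) auto
    have m0: "0 < m" using cy by (simp add: cyclic_type_def)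
    have cH: "H (Suc i mod m) (c b) = H i b" if "i < m" "b \<in> B" for i b
      using cy that by (simp add: cyclic_type_def H_def)
    have cD: "\<Delta> (Suc i mod m) (Suc j mod m) = \<Delta> i j" if "i < m" "j < m" for i j
      using cy that by (simp add: cyclic_type_def \<Delta>_def)
    have ne: "Suc i mod m \<noteq> Suc j mod m" if "i < m" "j < m" "i \<noteq> j" for i j
    proof
      assume "Suc i mod m = Suc j mod m"
      then have "\<sigma> (w m i) = \<sigma> (w m j)" using \<sigma>(2) that by simp
      then show False using \<open>inj \<sigma>\<close> \<sigma>(3)[of m] that(3) by (simp add: inj_eq)
    qed
    have "F ` fset C \<subseteq> fset C"
    proof
      fix x assume "x \<in> F ` fset C"
      then obtain x0 where x0: "x = F x0" "x0 \<in> fset C" by blast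
      then consider i j where "i < m" "j < m" "i \<noteq> j" "x0 = (w m i, Inl (w m j), \<Delta> i j)"
        | i b where "i < m" "b \<in> B" "x0 = (w m i, Inr b, H i b)"
        unfolding C_def fset_attach[OF B(1)] by blast
      then show "x \<in> fset C"
      proof cases
        case 1
        then have "x = (w m (Suc i mod m), Inl (w m (Suc j mod m)), \<Delta> (Suc i mod m) (Suc j mod m))"
          by (simp add: x0(1) F_def \<sigma>(2) cD)
        then show ?thesis
          unfolding C_def fset_attach[OF B(1)] Un_iff mem_Collect_eq using ne[OF 1(1-3)] m0
          by (intro disjI1 exI[of _ "Suc i mod m"] exI[of _ "Suc j mod m"] conjI) simp_all
      next
        case 2
        then have "x = (w m (Suc i mod m), Inr (c b), H (Suc i mod m) (c b))"
          by (simp add: x0(1) F_def \<sigma>(2) cH)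
        moreover have "c b \<in> B" using B(4) 2(2) by blast
        ultimately show ?thesis unfolding C_def fset_attach[OF B(1)] using m0 by auto
      qed
    qed
    then have "F ` fset C = fset C"
      by (rule endo_inj_surj[OF finite_fset _ inj_on_subset[OF injF subset_UNIV]])
    then have FC: "F |`| C = C" by (simp add: fset_inject[symmetric])
    define z where "z i = New (w m i) C" for i
    have "c (z i) = z (Suc i mod m)" if "i < m" for i
      using FC \<sigma>(2)[OF that] by (simp add: z_def c_def F_def)
    moreover have "z ` {..<m} \<subseteq> terms" using at(1)[OF w] by (auto simp: z_def)
    moreover have "same_type dT B m y z"
    proof -
      have "dT (z i) (z j) = dT (y i) (y j)" if "i < m" "j < m" for i j
        using at(3)[OF w that] mT(4)[OF at(1)[OF w that(1)] at(1)[OF w that(1)]] mT(4)[OF yT[OF that(1)] yT[OF that(1)]]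
        by (cases "i = j") (auto simp: z_def \<Delta>_def)
      then show ?thesis using at(2)[OF w] by (simp add: same_type_def z_def H_def)
    qed
    ultimately show ?thesis by blast
  qed
  show ?thesis
    unfolding generic_isometry_def c_def[symmetric]
  proof (intro conjI ballI allI impI)
    show "\<exists>x\<in>terms. c x = x" by (rule fixp)
    show "\<exists>n>0. (c ^^ n) t = t" for t by (rule per)
    fix B m y
    assume "finite B \<and> B \<subseteq> terms \<and> B \<noteq> {} \<and> c ` B = B \<and> y ` {..<m} \<subseteq> terms \<and> cyclic_type dT c B m y"
    then show "\<exists>z. z ` {..<m} \<subseteq> terms \<and> (\<forall>i<m. c (z i) = z (Suc i mod m)) \<and> same_type dT B m y z" using ext by blast
  qed (fact Qmetric_terms one_point_extensions_terms act)+
qed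

text \<open>Terms are reached in countably many layers, each adding the finite clusters over the previous one with distances in \<open>Q\<close>.
The type of clusters itself is uncountable, as it allows arbitrary real entries.\<close>

lemma countable_terms:
  assumes "countable Z" "countable Q"
  shows "countable (terms :: ('z, 'l :: countable) tm set)"
proof -
  define lay where "lay = rec_nat (Pt ` Z) (\<lambda>_ T :: ('z, 'l) tm set. T \<union>
     (\<lambda>(l, C). New l C) ` (UNIV \<times> {C. fset C \<subseteq> UNIV \<times> (range Inl \<union> Inr ` T) \<times> Q}))"
  have lay: "lay 0 = Pt ` Z" "lay (Suc n) = lay n \<union>
     (\<lambda>(l, C). New l C) ` (UNIV \<times> {C. fset C \<subseteq> UNIV \<times> (range Inl \<union> Inr ` lay n) \<times> Q})" for n
    by (simp_all add: lay_def)
  have fs: "countable {C. fset C \<subseteq> X}" if "countable X" for X :: "('l \<times> ('l + ('z, 'l) tm) \<times> real) set"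
  proof -
    have "fset ` {C. fset C \<subseteq> X} \<subseteq> {A. finite A \<and> A \<subseteq> X}" by auto
    then have "countable (fset ` {C. fset C \<subseteq> X})"
      using countable_Collect_finite_subset[OF that] countable_subset by blast
    moreover have "inj_on fset {C. fset C \<subseteq> X}" by (auto simp: inj_on_def fset_inject)
    ultimately show ?thesis using countable_image_inj_on by blast
  qed
  have cl: "countable (lay n)" for n
  proof (induction n)
    case 0
    then show ?case using assms(1) by (simp add: lay)
  next
    case (Suc n)
    have "countable (UNIV \<times> (range Inl \<union> Inr ` lay n) \<times> Q :: ('l \<times> ('l + ('z, 'l) tm) \<times> real) set)"
      using Suc assms(2) by (intro countable_SIGMA countable_Un countable_image) auto
    from fs[OF this] show ?case unfolding lay using Suc
      by (intro countable_Un countable_image countable_SIGMA) auto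
  qed
  have mono: "lay n \<subseteq> lay (Suc n)" for n by (simp add: lay)
  have "\<exists>n. t \<in> lay n" if "valid Q Z dZ t" for t
    using that
  proof (induction rule: valid.induct)
    case (Pt z)
    then show ?case using lay(1) by blast
  next
    case (New C l a r)
    have "\<exists>n. \<forall>x\<in>fset C. \<forall>k a r. x = (k, Inr a, r) \<longrightarrow> a \<in> lay n"
    proof -
      have "\<exists>n. \<forall>k a r. x = (k, Inr a, r) \<longrightarrow> a \<in> lay n" if "x \<in> fset C" for x
      proof -
        obtain k y r where y: "x = (k, y, r)" by (rule prod_cases3)
        show ?thesis
        proof (cases y)
          case (Inr a)
          then have "(k, Inr a, r) |\<in>| C" using that y by simp
          then show ?thesis using New.IH y Inr by blast
        qed (simp add: y)
      qed
      then obtain N where N: "\<And>x. x \<in> fset C \<Longrightarrow> \<forall>k a r. x = (k, Inr a, r) \<longrightarrow> a \<in> lay (N x)" by metis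
      obtain n where n: "\<And>x. x \<in> fset C \<Longrightarrow> N x \<le> n"
        by (metis finite_fset finite_imageI finite_nat_set_iff_bounded_le imageI)
      have "lay (N x) \<subseteq> lay n" if "x \<in> fset C" for x using chain_le[of lay, OF mono n[OF that]] .
      then show ?thesis using N by blast
    qed
    then obtain n where n: "\<And>k a r. (k, Inr a, r) \<in> fset C \<Longrightarrow> a \<in> lay n" by blast
    have "fset C \<subseteq> UNIV \<times> (range Inl \<union> Inr ` lay n) \<times> Q"
    proof
      fix x assume x: "x \<in> fset C"
      obtain k y r where y: "x = (k, y, r)" by (rule prod_cases3)
      then have "r \<in> Q" using clusterD(1)[OF New.hyps(1)] x by simp
      then show "x \<in> UNIV \<times> (range Inl \<union> Inr ` lay n) \<times> Q" using n x y by (cases y) auto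
    qed
    then have "New l C \<in> lay (Suc n)" unfolding lay(2) by (intro UnI2 image_eqI[of _ _ "(l, C)"]) auto
    then show ?case by blast
  qed
  then have "terms \<subseteq> (\<Union>n. lay n)" by (auto simp: terms_def)
  then show ?thesis by (rule countable_subset) (intro countable_UN cl, simp)
qed

lemma dT_Pt:
  assumes "z \<in> Z" "z' \<in> Z"
  shows "dT (Pt z :: ('z, 'l) tm) (Pt z') = dZ z z'"
proof -
  have "pa (Pt z :: ('z, 'l) tm) (Pt z') q \<longleftrightarrow> q = dZ z z'" for q
  proof
    assume "pa (Pt z :: ('z, 'l) tm) (Pt z') q"
    then show "q = dZ z z'" by (cases rule: path.cases) (use mZ(4) assms in auto)
  next
    assume "q = dZ z z'"
    then show "pa (Pt z :: ('z, 'l) tm) (Pt z') q" using path.base[OF assms] by simp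
  qed
  then have "{q. pa (Pt z :: ('z, 'l) tm) (Pt z') q} = {dZ z z'}" by auto
  then show ?thesis by (simp add: dT_def)
qed

end

section \<open>Dense rational subspaces of the Urysohn space\<close>

lemma isometry_inverse:
  assumes T: "metric_on T d" and F: "F ` T = T" "isometry_on T d d F"
  shows "t \<in> T \<Longrightarrow> inv_into T F (F t) = t" and "t \<in> T \<Longrightarrow> F (inv_into T F t) = t"
    and "inv_into T F ` T = T" and "isometry_on T d d (inv_into T F)"
proof -
  have inj: "inj_on F T" using isometry_on_inj[OF T T _ F(2)] F(1) by simp
  show "t \<in> T \<Longrightarrow> inv_into T F (F t) = t" using inj by simp
  have i: "F (inv_into T F t) = t" "inv_into T F t \<in> T" if "t \<in> T" for t
    using F(1) that by (auto simp: f_inv_into_f inv_into_into)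
  show "t \<in> T \<Longrightarrow> F (inv_into T F t) = t" by (rule i(1))
  show "inv_into T F ` T = T" using bij_betw_inv_into[of F T T] inj F(1) by (simp add: bij_betw_def)
  show "isometry_on T d d (inv_into T F)"
    unfolding isometry_on_def
  proof (intro ballI)
    fix s t assume st: "s \<in> T" "t \<in> T"
    then have "d (F (inv_into T F s)) (F (inv_into T F t)) = d (inv_into T F s) (inv_into T F t)"
      using F(2) i(2) by (simp add: isometry_on_def)
    then show "d (inv_into T F s) (inv_into T F t) = d s t" using i(1) st by simp
  qed
qed

lemma metric_on_mdist: "X \<subseteq> mspace U \<Longrightarrow> metric_on X (mdist U)"
  unfolding metric_on_def using mdist_commute mdist_triangle by (metis mdist_nonneg mdist_zero subsetD)

lemma finite_polish_metric:
  assumes "finite (mspace P)"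
  shows "polish_metric P"
proof -
  interpret M: Metric_space "mspace P" "mdist P" by simp
  have "compact_space M.mtopology"
    using assms by (simp add: compact_space_def finite_imp_compactin)
  then have "M.mcomplete" by (rule M.compact_space_imp_mcomplete)
  moreover have "separable_space M.mtopology"
    unfolding separable_space_def using assms
    by (intro exI[of _ "mspace P"]) (auto simp: countable_finite closure_of_topspace[of M.mtopology, simplified])
  ultimately show ?thesis by (simp add: polish_metric_def mcomplete_of_def mtopology_of_def)
qed

text \<open>By universality, \<open>F\<close> with the additional point embeds into \<open>U\<close>; by homogeneity, the copy of \<open>F\<close> can be moved back onto \<open>F\<close>.\<close>

lemma urysohn_one_point_extensions:
  assumes "urysohn_space U"
  shows "one_point_extensions UNIV (mspace U) (mdist U)"
  unfolding one_point_extensions_def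
proof (intro allI impI)
  fix F and h :: "'a \<Rightarrow> real"
  assume *: "finite F \<and> F \<subseteq> mspace U \<and> F \<noteq> {} \<and> (\<forall>x\<in>F. h x \<in> UNIV \<and> 0 < h x) \<and>
    (\<forall>x\<in>F. \<forall>y\<in>F. h x \<le> h y + mdist U x y \<and> mdist U x y \<le> h x + h y)"
  then have F: "finite F" "F \<subseteq> mspace U" "F \<noteq> {}" and hp: "\<And>x. x \<in> F \<Longrightarrow> 0 < h x"
    and h1: "\<And>x y. x \<in> F \<Longrightarrow> y \<in> F \<Longrightarrow> h x \<le> h y + mdist U x y"
    and h2: "\<And>x y. x \<in> F \<Longrightarrow> y \<in> F \<Longrightarrow> mdist U x y \<le> h x + h y" by auto
  define D :: "'a option \<Rightarrow> 'a option \<Rightarrow> real" where "D u v = (case (u, v) of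
      (Some x, Some y) \<Rightarrow> mdist U x y | (Some x, None) \<Rightarrow> \<bar>h x\<bar> | (None, Some y) \<Rightarrow> \<bar>h y\<bar> | (None, None) \<Rightarrow> 0)" for u v
  define M where "M = insert None (Some ` F)"
  have ms: "Metric_space M D"
  proof
    show "0 \<le> D u v" "D u v = D v u" for u v by (auto simp: D_def mdist_commute split: option.splits)
    show "(D u v = 0) = (u = v)" if "u \<in> M" "v \<in> M" for u v
      using that F(2) hp by (force simp: D_def M_def subset_iff)
    show "D u w \<le> D u v + D v w" if "u \<in> M" "v \<in> M" "w \<in> M" for u v w
    proof -
      have tri: "mdist U x z \<le> mdist U x y + mdist U y z" if "x \<in> F" "y \<in> F" "z \<in> F" for x y z
        using that F(2) by (intro mdist_triangle) auto
      have h1': "h x \<le> mdist U x y + h y" "h x \<le> h y + mdist U y x" if "x \<in> F" "y \<in> F" for x y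
        using h1[OF that] by (simp_all add: mdist_commute)
      show ?thesis using that
        by (auto simp: D_def M_def tri h2 h1' abs_of_pos hp less_imp_le)
    qed
  qed
  define P where "P = metric (M, D)"
  have P: "mspace P = M" "mdist P = D" using ms by (simp_all add: P_def Metric_space.mspace_metric Metric_space.mdist_metric)
  have "polish_metric P" using F(1) by (intro finite_polish_metric) (simp add: P M_def)
  then obtain j where j: "isometric_embedding P U j"
    using universal_metric_embeds assms unfolding urysohn_space_def by blast
  have jM: "j u \<in> mspace U" "mdist U (j u) (j v) = D u v" if "u \<in> M" "v \<in> M" for u v
    using j that by (auto simp: isometric_embedding_def P)
  define k where "k x = j (Some x)" for x
  have k: "k x \<in> mspace U" "mdist U (k x) (k y) = mdist U x y" if "x \<in> F" "y \<in> F" for x y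
    using jM[of "Some x" "Some y"] that by (auto simp: k_def M_def D_def)
  have kinj: "inj_on k F" using k F(2) by (metis inj_onI mdist_zero subsetD)
  have "surj_isometry (submetric U (k ` F)) (submetric U F) (inv_into F k)"
    using F(2) k kinj by (auto simp: surj_isometry_def isometric_embedding_def inv_into_into) (metis (no_types, lifting) IntI imageI image_eqI inv_into_f_f subsetD)
  then obtain g where g: "surj_isometry U U g" "\<And>x. x \<in> k ` F \<Longrightarrow> g x = inv_into F k x"
    using assms F(1,2) k(1) unfolding urysohn_space_def homogeneous_metric_def
    by (metis (no_types, lifting) finite_imageI image_subsetI)
  have jN: "j None \<in> mspace U" using jM[of None None] by (simp add: M_def)
  have gd: "g x \<in> mspace U" "mdist U (g x) (g y) = mdist U x y" if "x \<in> mspace U" "y \<in> mspace U" for x y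
    using g(1) that by (auto simp: surj_isometry_def isometric_embedding_def)
  have "mdist U (g (j None)) x = h x" if x: "x \<in> F" for x
  proof -
    have "g (k x) = x" using g(2)[of "k x"] kinj x by simp
    then have "mdist U (g (j None)) x = mdist U (j None) (k x)" using gd(2)[OF jN k(1)[OF x x]] by simp
    also have "\<dots> = h x" using jM(2)[of None "Some x"] x hp[OF x] by (simp add: k_def M_def D_def)
    finally show ?thesis .
  qed
  then show "\<exists>z\<in>mspace U. \<forall>x\<in>F. mdist U z x = h x" using gd(1)[OF jN jN] by blast
qed

text \<open>Closing off a countable set under countable-valued finitary operations, as in the downward
Loewenheim-Skolem theorem.\<close>

lemma countable_closure:
  assumes "countable A" "A \<subseteq> M" "\<And>zs. zs \<in> lists M \<Longrightarrow> countable (Op zs) \<and> Op zs \<subseteq> M"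
  shows "\<exists>Y. A \<subseteq> Y \<and> Y \<subseteq> M \<and> countable Y \<and> (\<forall>zs\<in>lists Y. Op zs \<subseteq> Y)"
proof -
  define W where "W = rec_nat A (\<lambda>_ Y. Y \<union> (\<Union>zs\<in>lists Y. Op zs))"
  have W: "W 0 = A" "W (Suc n) = W n \<union> (\<Union>zs\<in>lists (W n). Op zs)" for n by (simp_all add: W_def)
  have c: "countable (W n) \<and> W n \<subseteq> M" for n
  proof (induction n)
    case (Suc n)
    then have "countable (lists (W n))" "lists (W n) \<subseteq> lists M" by (auto intro: countable_lists lists_mono)
    then show ?case using Suc assms(3) unfolding W(2) by (intro conjI countable_Un countable_UN Un_least UN_least) blast+
  qed (simp add: W assms)
  have mono: "W n \<subseteq> W m" if "n \<le> m" for n m using chain_le[of W, OF _ that] W(2) by blast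
  have "\<exists>n. set zs \<subseteq> W n" if "set zs \<subseteq> (\<Union>n. W n)" for zs
    using that
  proof (induction zs)
    case (Cons z zs)
    then obtain n m where "set zs \<subseteq> W n" "z \<in> W m" by auto
    then have "set (z # zs) \<subseteq> W (max n m)"
      using mono[of n "max n m"] mono[of m "max n m"] by auto
    then show ?case by blast
  qed simp
  then have "Op zs \<subseteq> (\<Union>n. W n)" if "zs \<in> lists (\<Union>n. W n)" for zs
  proof -
    have "set zs \<subseteq> (\<Union>n. W n)" using that by (auto simp: in_lists_conv_set)
    then obtain n where "set zs \<subseteq> W n" using \<open>\<And>zs. set zs \<subseteq> (\<Union>n. W n) \<Longrightarrow> \<exists>n. set zs \<subseteq> W n\<close> by blast
    then have "Op zs \<subseteq> W (Suc n)" unfolding W(2) by (auto simp: in_lists_conv_set)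
    then show ?thesis by blast
  qed
  moreover have "countable (\<Union>n. W n)" "(\<Union>n. W n) \<subseteq> M" using c by auto
  moreover have "A \<subseteq> (\<Union>n. W n)" using W(1) by blast
  ultimately show ?thesis by blast
qed

definition dense_in :: "'a metric \<Rightarrow> 'a set \<Rightarrow> bool" where
  "dense_in U Y \<longleftrightarrow> Y \<subseteq> mspace U \<and> (\<forall>x\<in>mspace U. \<forall>r>0. \<exists>y\<in>Y. mdist U x y < r)"

text \<open>The subgroup of the reals generated by the distances in \<open>S\<close>, written out as the set of finite signed sums; the Boolean
is the sign. In this form countability and finite character are immediate.\<close>

definition distance_group :: "('a \<Rightarrow> 'a \<Rightarrow> real) \<Rightarrow> 'a set \<Rightarrow> real set" where
  "distance_group d S = (\<lambda>l. \<Sum>(b, x, y)\<leftarrow>l. if b then d x y else - d x y) ` lists (UNIV \<times> S \<times> S)"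

lemma distance_group:
  shows "real_subgroup (distance_group d S)" and "x \<in> S \<Longrightarrow> y \<in> S \<Longrightarrow> d x y \<in> distance_group d S"
    and "countable S \<Longrightarrow> countable (distance_group d S)"
    and "q \<in> distance_group d S \<Longrightarrow> \<exists>T\<subseteq>S. finite T \<and> q \<in> distance_group d T"
    and "T \<subseteq> S \<Longrightarrow> distance_group d T \<subseteq> distance_group d S"
proof -
  define ev where "ev l = (\<Sum>(b, x, y)\<leftarrow>l. if b then d x y else - d x y)" for l :: "(bool \<times> 'a \<times> 'a) list"
  have dg: "distance_group d S = ev ` lists (UNIV \<times> S \<times> S)" for S by (simp add: distance_group_def ev_def)
  have ev1: "ev (l @ l') = ev l + ev l'" for l l' by (simp add: ev_def)
  have ev2: "ev (map (\<lambda>(b, x, y). (\<not> b, x, y)) l) = - ev l" for l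
    by (induction l) (auto simp: ev_def)
  note ev = ev1 ev2
  show "real_subgroup (distance_group d S)"
    unfolding real_subgroup_def
  proof (intro conjI ballI)
    show "0 \<in> distance_group d S" unfolding dg by (rule image_eqI[of _ _ "[]"]) (auto simp: ev_def)
    fix q q' assume "q \<in> distance_group d S" "q' \<in> distance_group d S"
    then obtain l l' where l: "l \<in> lists (UNIV \<times> S \<times> S)" "l' \<in> lists (UNIV \<times> S \<times> S)" "q = ev l" "q' = ev l'"
      unfolding dg by blast
    have "q - q' = ev (l @ map (\<lambda>(b, x, y). (\<not> b, x, y)) l')" unfolding ev l by (simp only: diff_conv_add_uminus)
    moreover have "l @ map (\<lambda>(b, x, y). (\<not> b, x, y)) l' \<in> lists (UNIV \<times> S \<times> S)"
      using l(1,2) by (auto simp: in_lists_conv_set)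
    ultimately show "q - q' \<in> distance_group d S" unfolding dg by (rule image_eqI)
  qed
  show "d x y \<in> distance_group d S" if "x \<in> S" "y \<in> S"
    unfolding dg using that by (intro image_eqI[of _ _ "[(True, x, y)]"]) (auto simp: ev_def)
  show "countable (distance_group d S)" if "countable S"
    unfolding dg using that by (intro countable_image countable_lists countable_SIGMA) auto
  show "T \<subseteq> S \<Longrightarrow> distance_group d T \<subseteq> distance_group d S"
    unfolding dg by (intro image_mono lists_mono) auto
  assume "q \<in> distance_group d S"
  then obtain l where l: "l \<in> lists (UNIV \<times> S \<times> S)" "q = ev l" unfolding dg by blast
  define T where "T = fst ` snd ` set l \<union> snd ` snd ` set l"
  have "T \<subseteq> S" "finite T" using l(1) by (auto simp: T_def in_lists_conv_set)
  moreover have "l \<in> lists (UNIV \<times> T \<times> T)" by (force simp: T_def in_lists_conv_set)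
  then have "q \<in> distance_group d T" unfolding dg l(2) by (rule imageI)
  ultimately show "\<exists>T\<subseteq>S. finite T \<and> q \<in> distance_group d T" by blast
qed

lemma IsoD:
  assumes "g \<in> Iso U"
  shows "x \<in> mspace U \<Longrightarrow> g x \<in> mspace U"
    and "x \<in> mspace U \<Longrightarrow> y \<in> mspace U \<Longrightarrow> mdist U (g x) (g y) = mdist U x y"
    and "g ` mspace U = mspace U" and "inj_on g (mspace U)" and "g \<in> extensional (mspace U)"
  using assms surj_isometry_bij_betw[of U U g]
  by (auto simp: Iso_alt surj_isometry_def isometric_embedding_def bij_betw_def)

text \<open>Close off under \<open>g\<close>, its inverse, and chosen realizations of distance prescriptions with values in the group of distances.
Each prescription involves finitely many points and, by finite character, finitely many distances, so a finite list \<open>zs\<close> of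
points gives only countably many prescriptions to be realized. The group \<open>Q\<close> is that of the closed set itself, so no new values
appear afterwards.\<close>

lemma dense_rational_subspace:
  assumes U: "urysohn_space U" and A: "countable A" "A \<subseteq> mspace U" and g: "g \<in> Iso U"
  shows "\<exists>Y Q. countable Y \<and> A \<subseteq> Y \<and> dense_in U Y \<and> real_subgroup Q \<and> countable Q \<and>
           Qmetric Q Y (mdist U) \<and> one_point_extensions Q Y (mdist U) \<and> g ` Y = Y"
proof -
  let ?M = "mspace U" and ?d = "mdist U"
  interpret M: Metric_space ?M ?d by simp
  obtain D where D: "countable D" "D \<subseteq> ?M" "M.mtopology closure_of D = ?M"
    using U by (auto simp: urysohn_space_def polish_metric_def separable_space_def mtopology_of_def)
  define real where "real F h z \<longleftrightarrow> z \<in> ?M \<and> (\<forall>x\<in>F. ?d z x = h x)" for F z and h :: "'a \<Rightarrow> real"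
  define I where "I zs = {(F, h). F \<subseteq> set zs \<and> h \<in> F \<rightarrow>\<^sub>E distance_group ?d (set zs) \<and> (\<exists>z. real F h z)}" for zs
  define Op where "Op zs = g ` set zs \<union> inv_into ?M g ` set zs \<union> (\<lambda>(F, h). SOME z. real F h z) ` I zs" for zs
  have "countable (Op zs) \<and> Op zs \<subseteq> ?M" if "zs \<in> lists ?M" for zs
  proof
    have "I zs \<subseteq> (SIGMA F:Pow (set zs). F \<rightarrow>\<^sub>E distance_group ?d (set zs))" by (auto simp: I_def)
    moreover have "countable (SIGMA F:Pow (set zs). F \<rightarrow>\<^sub>E distance_group ?d (set zs))"
      using distance_group(3)[of "set zs" ?d]
      by (intro countable_SIGMA countable_PiE) (auto intro: countable_finite finite_subset)
    ultimately have "countable (I zs)" by (rule countable_subset)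
    then show "countable (Op zs)" unfolding Op_def by (intro countable_Un countable_image) (auto intro: countable_finite)
    have zs: "z \<in> ?M" if "z \<in> set zs" for z using that \<open>zs \<in> lists ?M\<close> by (auto simp: in_lists_conv_set)
    show "Op zs \<subseteq> ?M"
      unfolding Op_def
    proof (intro Un_least image_subsetI)
      fix z assume "z \<in> set zs"
      then show "g z \<in> ?M" "inv_into ?M g z \<in> ?M"
        using zs IsoD(1)[OF g] IsoD(3)[OF g] by (auto intro: inv_into_into)
    next
      fix p assume "p \<in> I zs"
      then obtain F h where "p = (F, h)" "\<exists>z. real F h z" by (auto simp: I_def)
      then show "(case p of (F, h) \<Rightarrow> SOME z. real F h z) \<in> ?M"
        using someI_ex[of "real F h"] by (simp add: real_def)
    qed
  qed
  then obtain Y where Y: "A \<union> D \<subseteq> Y" "Y \<subseteq> ?M" "countable Y" "\<And>zs. zs \<in> lists Y \<Longrightarrow> Op zs \<subseteq> Y"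
    using countable_closure[of "A \<union> D" ?M Op] A D by auto
  define Q where "Q = distance_group ?d Y"
  have ext: "one_point_extensions Q Y ?d"
    unfolding one_point_extensions_def
  proof (intro allI impI)
    fix F h assume *: "finite F \<and> F \<subseteq> Y \<and> F \<noteq> {} \<and> (\<forall>x\<in>F. h x \<in> Q \<and> 0 < h x) \<and>
      (\<forall>x\<in>F. \<forall>y\<in>F. h x \<le> h y + ?d x y \<and> ?d x y \<le> h x + h y)"
    then have F: "finite F" "F \<subseteq> Y" "\<And>x. x \<in> F \<Longrightarrow> h x \<in> Q" by auto
    have "\<forall>x\<in>F. \<exists>T. T \<subseteq> Y \<and> finite T \<and> h x \<in> distance_group ?d T"
      using distance_group(4)[of _ ?d Y] F(3) unfolding Q_def by blast
    then obtain T where T: "\<And>x. x \<in> F \<Longrightarrow> T x \<subseteq> Y \<and> finite (T x) \<and> h x \<in> distance_group ?d (T x)" by metis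
    define S where "S = F \<union> (\<Union>x\<in>F. T x)"
    have "finite S" "S \<subseteq> Y" using F T by (auto simp: S_def)
    then obtain zs where zs: "set zs = S" using finite_list by blast
    have hS: "h x \<in> distance_group ?d S" if "x \<in> F" for x
      using T[OF that] distance_group(5)[of "T x" S ?d] that by (auto simp: S_def)
    obtain z0 where "z0 \<in> ?M" "\<forall>x\<in>F. ?d z0 x = h x"
      using urysohn_one_point_extensions[OF U, unfolded one_point_extensions_def, rule_format, of F h] * Y(2) by auto
    then have ex: "real F (restrict h F) z0" by (simp add: real_def)
    then have "(F, restrict h F) \<in> I zs" using hS by (auto simp: I_def zs S_def)
    then have "(SOME z. real F (restrict h F) z) \<in> Op zs" unfolding Op_def by (intro UnI2 image_eqI[of _ _ "(F, restrict h F)"]) auto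
    moreover have "zs \<in> lists Y" using \<open>S \<subseteq> Y\<close> zs by (auto simp: in_lists_conv_set)
    ultimately have "(SOME z. real F (restrict h F) z) \<in> Y" using Y(4) by blast
    moreover have "real F (restrict h F) (SOME z. real F (restrict h F) z)" using ex by (rule someI)
    ultimately show "\<exists>z\<in>Y. \<forall>x\<in>F. ?d z x = h x" unfolding real_def by auto
  qed
  have 1: "dense_in U Y"
    unfolding dense_in_def
  proof (intro conjI ballI allI impI)
    fix x and r :: real assume "x \<in> ?M" "r > 0"
    then have "\<exists>y\<in>D. y \<in> M.mball x r" using D(3) unfolding M.metric_closure_of by blast
    then show "\<exists>y\<in>Y. ?d x y < r" using Y(1) by (auto simp: M.in_mball)
  qed (fact Y(2))
  have 2: "Qmetric Q Y ?d"
    unfolding Qmetric_def Q_def by (simp add: metric_on_mdist[OF Y(2)] distance_group(2))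
  have 3: "g ` Y = Y"
  proof
    have single: "Op [y] \<subseteq> Y" if "y \<in> Y" for y using Y(4)[of "[y]"] that by simp
    show "g ` Y \<subseteq> Y" using single by (auto simp: Op_def)
    show "Y \<subseteq> g ` Y"
    proof
      fix y assume y: "y \<in> Y"
      then have "inv_into ?M g y \<in> Y" using single by (auto simp: Op_def)
      moreover have "g (inv_into ?M g y) = y" using IsoD(3)[OF g] y Y(2) by (intro f_inv_into_f) auto
      ultimately show "y \<in> g ` Y" by (metis imageI)
    qed
  qed
  have "A \<subseteq> Y" "real_subgroup Q" "countable Q"
    using Y(1) distance_group(1)[of ?d Y] distance_group(3)[OF Y(3), of ?d] by (auto simp: Q_def)
  then show ?thesis using ext Y(3) 1 2 3 by (intro exI[of _ Y] exI[of _ Q]) simp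
qed

lemma isometries_agree_on_dense:
  assumes Y: "dense_in U Y" and G: "\<And>x y. x \<in> mspace U \<Longrightarrow> y \<in> mspace U \<Longrightarrow> G x \<in> mspace U \<and> mdist U (G x) (G y) = mdist U x y"
    and H: "\<And>x y. x \<in> mspace U \<Longrightarrow> y \<in> mspace U \<Longrightarrow> H x \<in> mspace U \<and> mdist U (H x) (H y) = mdist U x y"
    and eq: "\<And>y. y \<in> Y \<Longrightarrow> G y = H y" and x: "x \<in> mspace U"
  shows "G x = H x"
proof (rule ccontr)
  assume ne: "G x \<noteq> H x"
  define r where "r = mdist U (G x) (H x) / 2"
  have "r > 0" using ne G[OF x x] H[OF x x] mdist_zero[of "G x" U "H x"] mdist_nonneg[of U "G x" "H x"]
    by (simp add: r_def less_le)
  then obtain y where y: "y \<in> Y" "mdist U x y < r" using Y x unfolding dense_in_def by blast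
  then have yM: "y \<in> mspace U" using Y by (auto simp: dense_in_def)
  have "mdist U (G x) (H x) \<le> mdist U (G x) (G y) + mdist U (H y) (H x)"
    using mdist_triangle[of "G x" U "G y" "H x"] G[OF x yM] G[OF yM yM] H[OF x x] eq[OF y(1)] by simp
  also have "\<dots> = 2 * mdist U x y" using G[OF x yM] H[OF yM x] by (simp add: mdist_commute)
  finally show False using y(2) by (simp add: r_def)
qed

text \<open>An isometry is Lipschitz and so extends by completeness; the extension is isometric by density.\<close>

lemma isometric_extension_from_dense:
  assumes U: "mcomplete_of U" and Y: "dense_in U Y" and f: "f ` Y \<subseteq> Y" "isometry_on Y (mdist U) (mdist U) f"
  shows "\<exists>G. (\<forall>y\<in>Y. G y = f y) \<and> (\<forall>x\<in>mspace U. \<forall>y\<in>mspace U. G x \<in> mspace U \<and> mdist U (G x) (G y) = mdist U x y)"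
proof -
  interpret M: Metric_space "mspace U" "mdist U" by simp
  have YM: "Y \<subseteq> mspace U" using Y by (simp add: dense_in_def)
  have cl: "mtopology_of U closure_of Y = mspace U"
    using Y by (fastforce simp: mtopology_of_def M.metric_closure_of dense_in_def)
  have "Lipschitz_continuous_map (submetric U Y) U f"
    unfolding Lipschitz_continuous_map_def using f YM
    by (auto simp: isometry_on_def intro!: exI[of _ 1])
  then obtain G where G: "Lipschitz_continuous_map (submetric U (mspace U)) U G" "\<And>y. y \<in> Y \<Longrightarrow> G y = f y"
    using Lipschitz_continuous_map_extends_to_closure_of[OF U] cl by metis
  then obtain B where "G \<in> mspace U \<rightarrow> mspace U" "B > 0"
      "\<forall>x\<in>mspace U. \<forall>y\<in>mspace U. mdist U (G x) (G y) \<le> B * mdist U x y"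
    unfolding Lipschitz_continuous_map_pos by auto
  then have B: "B > 0" "\<And>x y. x \<in> mspace U \<Longrightarrow> y \<in> mspace U \<Longrightarrow> mdist U (G x) (G y) \<le> B * mdist U x y"
    and GM: "\<And>x. x \<in> mspace U \<Longrightarrow> G x \<in> mspace U" by auto
  have "mdist U (G x) (G x') = mdist U x x'" if x: "x \<in> mspace U" "x' \<in> mspace U" for x x'
  proof -
    have "\<bar>mdist U (G x) (G x') - mdist U x x'\<bar> \<le> 0 + e" if e: "e > 0" for e :: real
    proof -
      define r where "r = e / (2 * B + 2)"
      have "(2 * B + 2) * r = e" using B(1) by (simp add: r_def)
      then have "B * r + B * r + r + r = e" by (simp add: algebra_simps)
      moreover have "r > 0" using e B(1) by (simp add: r_def)
      ultimately have r: "r > 0" "B * r + B * r + r + r = e" by blast+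
      obtain y y' where y: "y \<in> Y" "mdist U x y < r" "y' \<in> Y" "mdist U x' y' < r"
        using Y x r(1) unfolding dense_in_def by meson
      have yM: "y \<in> mspace U" "y' \<in> mspace U" using y YM by auto
      have fy: "mdist U (G y) (G y') = mdist U y y'" using G(2) y(1,3) f(2) by (simp add: isometry_on_def)
      have 1: "mdist U (G x) (G y) \<le> B * r" "mdist U (G x') (G y') \<le> B * r"
        using B y x yM by (meson less_imp_le mult_left_mono order_trans)+
      have "\<bar>mdist U a b - mdist U c d'\<bar> \<le> mdist U a c + mdist U b d'"
        if "a \<in> mspace U" "b \<in> mspace U" "c \<in> mspace U" "d' \<in> mspace U" for a b c d'
        using mdist_triangle[OF that(1,3,2)] mdist_triangle[OF that(3,4,2)] mdist_triangle[OF that(3,1,4)] mdist_triangle[OF that(1,2,4)]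
          mdist_commute[of U a c] mdist_commute[of U b d'] by linarith
      from this[OF GM[OF x(1)] GM[OF x(2)] GM[OF yM(1)] GM[OF yM(2)]] this[OF x yM]
      show ?thesis using 1 y r fy by linarith
    qed
    then have "\<bar>mdist U (G x) (G x') - mdist U x x'\<bar> \<le> 0" by (rule field_le_epsilon)
    then show ?thesis by simp
  qed
  then show ?thesis using G(2) GM by blast
qed

text \<open>A metric space \<open>T\<close> identified through \<open>\<theta>\<close> with a dense subset of the complete space \<open>U\<close>. Isometries of \<open>T\<close> onto itself lift
uniquely to isometries of \<open>U\<close>, and uniqueness makes lifting multiplicative.\<close>

locale dense_copy =
  fixes U :: "'a metric" and T :: "'t set" and dT :: "'t \<Rightarrow> 't \<Rightarrow> real" and \<theta> :: "'t \<Rightarrow> 'a"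
  assumes U: "mcomplete_of U" and T: "metric_on T dT" and dense: "dense_in U (\<theta> ` T)"
    and iso: "isometry_on T dT (mdist U) \<theta>"
begin

definition lift :: "('t \<Rightarrow> 't) \<Rightarrow> 'a \<Rightarrow> 'a" where
  "lift F = (THE G. G \<in> Iso U \<and> (\<forall>t\<in>T. G (\<theta> t) = \<theta> (F t)))"

lemma \<theta>M: "t \<in> T \<Longrightarrow> \<theta> t \<in> mspace U"
  using dense by (auto simp: dense_in_def)

lemma \<theta>inj: "inj_on \<theta> T"
  using isometry_on_inj[OF T metric_on_mdist[OF subset_refl] _ iso] \<theta>M by blast

lemma Iso_eqI:
  assumes "G \<in> Iso U" "H \<in> Iso U" "\<And>t. t \<in> T \<Longrightarrow> G (\<theta> t) = H (\<theta> t)"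
  shows "G = H"
proof
  fix x
  show "G x = H x"
  proof (cases "x \<in> mspace U")
    case True
    show ?thesis
      by (rule isometries_agree_on_dense[OF dense _ _ _ True]) (use assms IsoD in auto)
  next
    case False
    then show ?thesis using IsoD(5)[OF assms(1)] IsoD(5)[OF assms(2)] by (simp add: extensional_def)
  qed
qed

lemma lift_exists:
  assumes F: "F ` T = T" "isometry_on T dT dT F"
  shows "\<exists>G. G \<in> Iso U \<and> (\<forall>t\<in>T. G (\<theta> t) = \<theta> (F t))"
proof -
  define \<theta>' where "\<theta>' = inv_into T \<theta>"
  have \<theta>': "\<theta>' (\<theta> t) = t" if "t \<in> T" for t using \<theta>inj that by (simp add: \<theta>'_def)
  have Fiso: "\<And>E. E ` T = T \<Longrightarrow> isometry_on T dT dT E \<Longrightarrow> \<exists>G. (\<forall>t\<in>T. G (\<theta> t) = \<theta> (E t)) \<and>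
     (\<forall>x\<in>mspace U. \<forall>y\<in>mspace U. G x \<in> mspace U \<and> mdist U (G x) (G y) = mdist U x y)"
  proof -
    fix E assume E: "E ` T = T" "isometry_on T dT dT E"
    have ET: "E t \<in> T" if "t \<in> T" for t using E(1) that by blast
    have "(\<lambda>y. \<theta> (E (\<theta>' y))) ` \<theta> ` T \<subseteq> \<theta> ` T" using \<theta>' ET by auto
    moreover have "isometry_on (\<theta> ` T) (mdist U) (mdist U) (\<lambda>y. \<theta> (E (\<theta>' y)))"
      unfolding isometry_on_def using \<theta>' ET E(2) iso by (auto simp: isometry_on_def)
    ultimately show "\<exists>G. (\<forall>t\<in>T. G (\<theta> t) = \<theta> (E t)) \<and>
     (\<forall>x\<in>mspace U. \<forall>y\<in>mspace U. G x \<in> mspace U \<and> mdist U (G x) (G y) = mdist U x y)"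
      using isometric_extension_from_dense[OF U dense] \<theta>' by fastforce
  qed
  define F' where "F' = inv_into T F"
  note i = isometry_inverse[OF T F, folded F'_def]
  have F': "F' t \<in> T" "F (F' t) = t" if "t \<in> T" for t using i(2,3) that by auto
  obtain H where H: "\<And>t. t \<in> T \<Longrightarrow> H (\<theta> t) = \<theta> (F' t)"
    "\<And>x y. x \<in> mspace U \<Longrightarrow> y \<in> mspace U \<Longrightarrow> H x \<in> mspace U \<and> mdist U (H x) (H y) = mdist U x y"
    using Fiso[OF i(3,4)] by auto
  obtain G where G: "\<And>t. t \<in> T \<Longrightarrow> G (\<theta> t) = \<theta> (F t)"
    "\<And>x y. x \<in> mspace U \<Longrightarrow> y \<in> mspace U \<Longrightarrow> G x \<in> mspace U \<and> mdist U (G x) (G y) = mdist U x y"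
    using Fiso[OF F] by auto
  have GH: "G (H x) = x" if x: "x \<in> mspace U" for x
    by (rule isometries_agree_on_dense[OF dense, of "\<lambda>x. G (H x)" "\<lambda>x. x", OF _ _ _ x]) (use G H F' in auto)
  define G' where "G' = restrict G (mspace U)"
  have "surj_isometry U U G'"
    unfolding surj_isometry_def isometric_embedding_def
  proof (intro conjI)
    show "G' \<in> mspace U \<rightarrow> mspace U" using G(2) by (auto simp: G'_def)
    show "\<forall>x\<in>mspace U. \<forall>y\<in>mspace U. mdist U (G' x) (G' y) = mdist U x y" using G(2) by (auto simp: G'_def)
    show "G' ` mspace U = mspace U"
    proof
      show "G' ` mspace U \<subseteq> mspace U" using G(2) by (auto simp: G'_def)
      show "mspace U \<subseteq> G' ` mspace U"
      proof
        fix x assume x: "x \<in> mspace U"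
        have "H x \<in> mspace U" using H(2)[OF x x] by blast
        then show "x \<in> G' ` mspace U" using GH[OF x] by (intro image_eqI[of _ _ "H x"]) (auto simp: G'_def)
      qed
    qed
  qed
  then have "G' \<in> Iso U" by (simp add: Iso_alt G'_def)
  moreover have "\<forall>t\<in>T. G' (\<theta> t) = \<theta> (F t)" using G(1) \<theta>M by (simp add: G'_def)
  ultimately show ?thesis by blast
qed

lemma lift:
  assumes F: "F ` T = T" "isometry_on T dT dT F"
  shows "lift F \<in> Iso U" and "t \<in> T \<Longrightarrow> lift F (\<theta> t) = \<theta> (F t)"
proof -
  have "\<exists>!G. G \<in> Iso U \<and> (\<forall>t\<in>T. G (\<theta> t) = \<theta> (F t))"
    using lift_exists[OF F] Iso_eqI by (metis (no_types, lifting))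
  from theI'[OF this] show "lift F \<in> Iso U" and "t \<in> T \<Longrightarrow> lift F (\<theta> t) = \<theta> (F t)"
    unfolding lift_def by blast+
qed

lemma lift_comp:
  assumes F: "F ` T = T" "isometry_on T dT dT F" and E: "E ` T = T" "isometry_on T dT dT E"
    and D: "\<And>t. t \<in> T \<Longrightarrow> D t = F (E t)"
  shows "lift D = lift F \<otimes>\<^bsub>IsoGroup U\<^esub> lift E"
proof -
  have I: "lift F \<in> Iso U" "lift E \<in> Iso U" using lift(1) F E by blast+
  have "D ` T = (\<lambda>t. F (E t)) ` T" using D by (intro image_cong) auto
  also have "\<dots> = F ` E ` T" by (simp add: image_image)
  finally have D1: "D ` T = T" using F(1) E(1) by simp
  have D2: "isometry_on T dT dT D"
    unfolding isometry_on_def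
  proof (intro ballI)
    fix s t assume st: "s \<in> T" "t \<in> T"
    then have "E s \<in> T" "E t \<in> T" using E(1) by auto
    then show "dT (D s) (D t) = dT s t" using D st F(2) E(2) by (simp add: isometry_on_def)
  qed
  interpret G: group "IsoGroup U" by (rule group_IsoGroup)
  have m: "lift F \<otimes>\<^bsub>IsoGroup U\<^esub> lift E = compose (mspace U) (lift F) (lift E)"
    using I by (simp add: IsoGroup_def BijGroup_def Iso_def)
  have "lift F \<otimes>\<^bsub>IsoGroup U\<^esub> lift E \<in> Iso U" using G.m_closed[of "lift F" "lift E"] I by (simp add: IsoGroup_def)
  then show ?thesis
  proof (rule Iso_eqI[OF lift(1)[OF D1 D2]])
    fix t assume t: "t \<in> T"
    then have "E t \<in> T" using E(1) by blast
    then show "lift D (\<theta> t) = (lift F \<otimes>\<^bsub>IsoGroup U\<^esub> lift E) (\<theta> t)"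
      using t lift(2)[OF D1 D2 t] lift(2)[OF E t] lift(2)[OF F] D[OF t] \<theta>M[OF t] by (simp add: m compose_def)
  qed
qed

end

section \<open>Homomorphisms from the isometry group\<close>

lemma carrier_IsoGroup: "carrier (IsoGroup U) = Iso U"
  by (simp add: IsoGroup_def)

text \<open>Take the terms over a one-point space. The label permutation \<open>\<sigma>\<close> with all finite cycle lengths acts on them as a generic isometry,
which is isomorphic to \<open>f\<close>. Transporting the action of all label permutations to \<open>U\<close> gives a homomorphism from the symmetric group
to \<open>Iso U\<close> that sends \<open>\<sigma>\<close> to the extension of \<open>f\<close>. Its composition with \<open>\<Phi>\<close> kills \<open>\<sigma>\<close>, a product of two moiety
involutions.\<close>

lemma generic_isometry_in_kernel:
  fixes K :: "('b, 'm) monoid_scheme"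
  assumes U: "mcomplete_of U" and Y: "dense_in U Y" "countable Y" and Q: "real_subgroup Q" "countable Q"
    and f: "generic_isometry Q Y (mdist U) f"
    and K: "group K" "mspace \<rho> = carrier K" "mcomplete_of \<rho>" "separable_space (mtopology_of \<rho>)"
      "left_invariant_metric K \<rho>"
    and \<Phi>: "\<Phi> \<in> hom (IsoGroup U) K"
  shows "\<exists>G\<in>Iso U. (\<forall>y\<in>Y. G y = f y) \<and> \<Phi> G = \<one>\<^bsub>K\<^esub>"
proof -
  have "Qmetric Q {()} (\<lambda>_ _. 0)" using real_subgroupD(1)[OF Q(1)] by (simp add: Qmetric_def metric_on_def)
  then interpret ts: term_space Q "{()}" "\<lambda>_ _. 0" using Q(1) by unfold_locales auto
  obtain \<sigma> \<alpha> \<beta> :: "nat \<Rightarrow> nat" and w where \<sigma>: "moiety_involution UNIV \<alpha>" "moiety_involution UNIV \<beta>" "\<sigma> = \<alpha> \<circ> \<beta>"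
    "\<And>m i. i < m \<Longrightarrow> \<sigma> (w m i) = w m (Suc i mod m)" "\<And>m. inj (w m)" "\<And>x. \<exists>n>0. (\<sigma> ^^ n) x = x"
    by (rule permutation_with_all_cycle_lengths) (rule that; (assumption | blast))
  have b: "bij \<alpha>" "bij \<beta>" "bij \<sigma>"
    using \<sigma>(1,2,3) moiety_involution_bij bij_comp by blast+
  define T :: "(unit, nat) tm set" where "T = ts.terms"
  have gen: "generic_isometry Q T ts.dT (map_tm id \<sigma>)"
    unfolding T_def by (rule ts.generic_term_map[OF b(3) \<sigma>(4,5,6)])
  have cT: "countable T" unfolding T_def by (rule ts.countable_terms) (use Q in auto)
  obtain \<theta> where \<theta>: "\<theta> ` T = Y" "isometry_on T ts.dT (mdist U) \<theta>" "\<And>t. t \<in> T \<Longrightarrow> \<theta> (map_tm id \<sigma> t) = f (\<theta> t)"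
    using generic_isometries_isomorphic[OF gen cT f Y(2)] by blast
  have mT: "metric_on T ts.dT" unfolding T_def by (rule QmetricD(1)[OF ts.Qmetric_terms])
  interpret dc: dense_copy U T ts.dT \<theta>
    using U mT \<theta>(1,2) Y(1) by unfold_locales auto
  have act: "map_tm id \<tau> ` T = T" "isometry_on T ts.dT ts.dT (map_tm id \<tau>)" if "bij \<tau>" for \<tau> :: "nat \<Rightarrow> nat"
    using ts.term_action[of id id \<tau>] that by (auto simp: T_def isometry_on_def)
  define \<Psi> where "\<Psi> \<tau> = \<Phi> (dc.lift (map_tm id \<tau>))" for \<tau> :: "nat \<Rightarrow> nat"
  interpret ph: perm_hom K \<rho> \<Psi>
  proof (intro perm_hom.intro K)
    show "\<Psi> \<tau> \<in> carrier K" if "bij \<tau>" for \<tau>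
      using dc.lift(1)[OF act[OF that]] hom_in_carrier[OF \<Phi>] by (simp add: \<Psi>_def carrier_IsoGroup)
    show "\<Psi> (\<tau> \<circ> \<tau>') = \<Psi> \<tau> \<otimes>\<^bsub>K\<^esub> \<Psi> \<tau>'" if "bij \<tau>" "bij \<tau>'" for \<tau> \<tau>'
    proof -
      have "dc.lift (map_tm id (\<tau> \<circ> \<tau>')) = dc.lift (map_tm id \<tau>) \<otimes>\<^bsub>IsoGroup U\<^esub> dc.lift (map_tm id \<tau>')"
        by (rule dc.lift_comp) (use act that in \<open>auto simp: tm.map_comp\<close>)
      then show ?thesis
        using dc.lift(1)[OF act] that hom_mult[OF \<Phi>] by (simp add: \<Psi>_def carrier_IsoGroup)
    qed
  qed
  have "\<Psi> \<sigma> = \<Psi> \<alpha> \<otimes>\<^bsub>K\<^esub> \<Psi> \<beta>" using ph.hom b \<sigma>(3) by simp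
  also have "\<dots> = \<one>\<^bsub>K\<^esub>"
    using ph.kills_moiety_involutions[OF \<sigma>(1)] ph.kills_moiety_involutions[OF \<sigma>(2)] K(1)
    by (simp add: group.is_monoid monoid.l_one monoid.one_closed)
  finally have "\<Phi> (dc.lift (map_tm id \<sigma>)) = \<one>\<^bsub>K\<^esub>" by (simp add: \<Psi>_def)
  moreover have "dc.lift (map_tm id \<sigma>) y = f y" if "y \<in> Y" for y
    using dc.lift(2)[OF act[OF b(3)]] \<theta>(1,3) that by force
  ultimately show ?thesis using dc.lift(1)[OF act[OF b(3)]] by blast
qed

lemma id_Iso: "restrict (\<lambda>x. x) (mspace U) \<in> Iso U"
  by (auto simp: Iso_alt surj_isometry_def isometric_embedding_def)

text \<open>For \<open>f\<close> such that \<open>f\<close> and \<open>g \<circ> f\<close> are both generic on a dense skeleton invariant under \<open>g\<close>, the homomorphism \<open>\<Phi>\<close> kills the extensions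
of both, hence also \<open>g\<close>.\<close>

theorem homomorphism_trivial:
  fixes K :: "('b, 'm) monoid_scheme"
  assumes U: "urysohn_space U"
    and K: "group K" "mspace \<rho> = carrier K" "mcomplete_of \<rho>" "separable_space (mtopology_of \<rho>)"
      "left_invariant_metric K \<rho>"
    and \<Phi>: "\<Phi> \<in> hom (IsoGroup U) K" and g: "g \<in> Iso U"
  shows "\<Phi> g = \<one>\<^bsub>K\<^esub>"
proof -
  obtain Y Q where Y: "countable Y" "dense_in U Y" "real_subgroup Q" "countable Q"
      "Qmetric Q Y (mdist U)" "one_point_extensions Q Y (mdist U)" "g ` Y = Y"
    using dense_rational_subspace[OF U _ _ g, of "{}"] by auto
  have cU: "mcomplete_of U" using U by (simp add: urysohn_space_def polish_metric_def)
  have YM: "Y \<subseteq> mspace U" using Y(2) by (simp add: dense_in_def)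
  show ?thesis
  proof (cases "Y = {}")
    case True
    then have "mspace U = {}" using Y(2) unfolding dense_in_def by (metis all_not_in_conv zero_less_one)
    then have "g \<otimes>\<^bsub>IsoGroup U\<^esub> g = g"
      using IsoD(5)[OF g] g by (auto simp: IsoGroup_def BijGroup_def Iso_def compose_def extensional_def fun_eq_iff)
    then have "\<Phi> g \<otimes>\<^bsub>K\<^esub> \<Phi> g = \<Phi> g" using hom_mult[OF \<Phi>, of g g] g by (simp add: carrier_IsoGroup)
    then show ?thesis using hom_in_carrier[OF \<Phi>, of g] g group.l_cancel_one[OF K(1)] by (simp add: carrier_IsoGroup)
  next
    case False
    have "isometry_on Y (mdist U) (mdist U) g" using IsoD(2)[OF g] YM by (auto simp: isometry_on_def)
    then obtain f where f: "generic_isometry Q Y (mdist U) f" "generic_isometry Q Y (mdist U) (g \<circ> f)"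
      using generic_isometry_pair[OF Y(3,5,6,1) False Y(7)] by blast
    obtain G where G: "G \<in> Iso U" "\<And>y. y \<in> Y \<Longrightarrow> G y = f y" "\<Phi> G = \<one>\<^bsub>K\<^esub>"
      using generic_isometry_in_kernel[OF cU Y(2,1,3,4) f(1) K \<Phi>] by blast
    obtain H where H: "H \<in> Iso U" "\<And>y. y \<in> Y \<Longrightarrow> H y = g (f y)" "\<Phi> H = \<one>\<^bsub>K\<^esub>"
      using generic_isometry_in_kernel[OF cU Y(2,1,3,4) f(2) K \<Phi>] by auto
    interpret dc: dense_copy U Y "mdist U" id
      using cU Y(2) metric_on_mdist[OF YM] by unfold_locales (auto simp: isometry_on_def)
    have m: "g \<otimes>\<^bsub>IsoGroup U\<^esub> G = compose (mspace U) g G"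
      using g G(1) by (simp add: IsoGroup_def BijGroup_def Iso_def)
    interpret IG: group "IsoGroup U" by (rule group_IsoGroup)
    have "g \<otimes>\<^bsub>IsoGroup U\<^esub> G = H"
    proof (rule dc.Iso_eqI[OF _ H(1)])
      show "g \<otimes>\<^bsub>IsoGroup U\<^esub> G \<in> Iso U" using IG.m_closed[of g G] g G(1) by (simp add: carrier_IsoGroup)
      fix y assume "y \<in> Y"
      then show "(g \<otimes>\<^bsub>IsoGroup U\<^esub> G) (id y) = H (id y)" using G(2) H(2) YM by (auto simp: m compose_def)
    qed
    then have "\<Phi> g \<otimes>\<^bsub>K\<^esub> \<one>\<^bsub>K\<^esub> = \<one>\<^bsub>K\<^esub>"
      using hom_mult[OF \<Phi>, of g G] g G(1,3) H(3) by (simp add: carrier_IsoGroup)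
    then show ?thesis
      using hom_in_carrier[OF \<Phi>, of g] g K(1) by (simp add: carrier_IsoGroup group.is_monoid monoid.r_one)
  qed
qed

section \<open>Homogeneously isolated tuples\<close>

text \<open>A finite partial isometry of the sphere about \<open>p\<close> extends by \<open>p \<mapsto> p\<close>, and so, by homogeneity of \<open>U\<close>, to an isometry of \<open>U\<close> that fixes \<open>p\<close>
and preserves the sphere. For every pair of finite tuples one such isometry is chosen, if there is any; a countable set
closed under the chosen isometries and their inverses is homogeneous.\<close>

lemma homogeneous_countable_subset:
  assumes U: "homogeneous_metric U" and p: "p \<in> mspace U" and R: "R > 0"
    and A: "countable A" "A \<subseteq> {x \<in> mspace U. mdist U p x = R}"
  shows "\<exists>X. A \<subseteq> X \<and> X \<subseteq> {x \<in> mspace U. mdist U p x = R} \<and> countable X \<and> homogeneous_metric (submetric U X)"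
proof -
  let ?S = "{x \<in> mspace U. mdist U p x = R}"
  define P where "P xs ys g \<longleftrightarrow> g \<in> Iso U \<and> g p = p \<and> map g xs = ys" for xs ys and g
  define pick where "pick xs ys = (SOME g. P xs ys g)" for xs ys
  (* A list zs codes a point, its head, and all ways to split its tail into two tuples. *)
  define Op where "Op zs = {x. \<exists>n. (\<exists>g. P (take n (tl zs)) (drop n (tl zs)) g) \<and> zs \<noteq> [] \<and>
      x \<in> {pick (take n (tl zs)) (drop n (tl zs)) (hd zs), inv_into (mspace U) (pick (take n (tl zs)) (drop n (tl zs))) (hd zs)}}" for zs
  have gS: "g x \<in> ?S" "inv_into (mspace U) g x \<in> ?S" if g: "g \<in> Iso U" "g p = p" and x: "x \<in> ?S" for g x
  proof -
    show "g x \<in> ?S" using IsoD(1)[OF g(1)] IsoD(2)[OF g(1) p, of x] g(2) x by auto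
    have i: "inv_into (mspace U) g x \<in> mspace U" "g (inv_into (mspace U) g x) = x"
      using IsoD(3)[OF g(1)] x by (auto simp: inv_into_into f_inv_into_f)
    then show "inv_into (mspace U) g x \<in> ?S" using IsoD(2)[OF g(1) p i(1)] g(2) x by auto
  qed
  have pick: "P xs ys (pick xs ys)" if "\<exists>g. P xs ys g" for xs ys
    unfolding pick_def using that by (rule someI_ex)
  have "countable (Op zs) \<and> Op zs \<subseteq> ?S" if zs: "zs \<in> lists ?S" for zs
  proof
    have "Op zs \<subseteq> (\<Union>n. {pick (take n (tl zs)) (drop n (tl zs)) (hd zs), inv_into (mspace U) (pick (take n (tl zs)) (drop n (tl zs))) (hd zs)})"
      unfolding Op_def by blast
    then show "countable (Op zs)" by (rule countable_subset) auto
    show "Op zs \<subseteq> ?S"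
    proof
      fix x assume "x \<in> Op zs"
      then obtain n where n: "\<exists>g. P (take n (tl zs)) (drop n (tl zs)) g" "zs \<noteq> []"
        "x = pick (take n (tl zs)) (drop n (tl zs)) (hd zs) \<or>
         x = inv_into (mspace U) (pick (take n (tl zs)) (drop n (tl zs))) (hd zs)"
        unfolding Op_def by auto
      have "hd zs \<in> ?S" using zs n(2) by (cases zs) auto
      then show "x \<in> ?S" using gS[of "pick (take n (tl zs)) (drop n (tl zs))"] pick[OF n(1)] n(3)
        unfolding P_def by blast
    qed
  qed
  then have "\<exists>Y. A \<subseteq> Y \<and> Y \<subseteq> ?S \<and> countable Y \<and> (\<forall>zs\<in>lists Y. Op zs \<subseteq> Y)"
    by (rule countable_closure[OF A])
  then obtain X where "A \<subseteq> X \<and> X \<subseteq> ?S \<and> countable X \<and> (\<forall>zs\<in>lists X. Op zs \<subseteq> X)" by (rule exE)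
  then have X: "A \<subseteq> X" "X \<subseteq> ?S" "countable X" "\<forall>zs\<in>lists X. Op zs \<subseteq> X" by blast+
  have XM: "X \<subseteq> mspace U" using X(2) by blast
  have closed: "pick xs ys x \<in> X" "inv_into (mspace U) (pick xs ys) x \<in> X"
    if "\<exists>g. P xs ys g" "x \<in> X" "set xs \<subseteq> X" "set ys \<subseteq> X" for xs ys x
  proof -
    have "x # xs @ ys \<in> lists X" using that by auto
    moreover have "{pick xs ys x, inv_into (mspace U) (pick xs ys) x} \<subseteq> Op (x # xs @ ys)"
      using that(1) unfolding Op_def by (auto intro!: exI[of _ "length xs"])
    ultimately have "{pick xs ys x, inv_into (mspace U) (pick xs ys) x} \<subseteq> X" using X(4) by (meson subset_trans)
    then show "pick xs ys x \<in> X" "inv_into (mspace U) (pick xs ys) x \<in> X" by simp_all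
  qed
  have "homogeneous_metric (submetric U X)"
    unfolding homogeneous_metric_def
  proof (intro allI impI)
    fix C D f
    assume *: "finite C \<and> C \<subseteq> mspace (submetric U X) \<and> finite D \<and> D \<subseteq> mspace (submetric U X) \<and>
       surj_isometry (submetric (submetric U X) C) (submetric (submetric U X) D) f"
    then have CD: "finite C" "C \<subseteq> X" "finite D" "D \<subseteq> X" using XM by auto
    have CM: "C \<subseteq> mspace U" "D \<subseteq> mspace U" using CD XM by auto
    have f: "f ` C = D" "\<And>x y. x \<in> C \<Longrightarrow> y \<in> C \<Longrightarrow> mdist U (f x) (f y) = mdist U x y"
      using * CD CM by (auto simp: surj_isometry_def isometric_embedding_def Int_absorb1 Int_absorb2)
    have "p \<notin> X"
    proof
      assume "p \<in> X"
      then have "mdist U p p = R" using X(2) by blast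
      then show False using R mdist_zero[OF p p] by simp
    qed
    then have pC: "p \<notin> C" "p \<notin> D" using CD by blast+
    define h where "h x = (if x = p then p else f x)" for x
    have pd: "mdist U p x = R" "mdist U x p = R" if "x \<in> X" for x using X(2) that by (auto simp: mdist_commute)
    have fX: "f x \<in> X" if "x \<in> C" for x using f(1) CD(4) that by blast
    have hC: "h ` insert p C = insert p D" using f(1) pC by (auto simp: h_def)
    have "mdist U (h x) (h y) = mdist U x y" if "x \<in> insert p C" "y \<in> insert p C" for x y
      using that f(2) pd fX CD(2) p pC by (auto simp: h_def)
    then have "surj_isometry (submetric U (insert p C)) (submetric U (insert p D)) h"
      using hC CM p by (auto simp: surj_isometry_def isometric_embedding_def Int_absorb1 Int_absorb2)
    then have "\<exists>g. surj_isometry U U g \<and> (\<forall>x\<in>insert p C. g x = h x)"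
      using CD CM p by (intro U[unfolded homogeneous_metric_def, rule_format, of _ "insert p D"]) auto
    then obtain g where g: "surj_isometry U U g" "\<And>x. x \<in> insert p C \<Longrightarrow> g x = h x" by blast
    define g' where "g' = restrict g (mspace U)"
    have g': "g' \<in> Iso U"
      using g(1) by (auto simp: Iso_alt g'_def surj_isometry_def isometric_embedding_def)
    obtain xs where xs: "set xs = C" using finite_list[OF CD(1)] by blast
    have gx: "g' x = f x" if "x \<in> C" for x using g(2)[of x] that pC CM by (auto simp: g'_def h_def)
    have "P xs (map f xs) g'"
      unfolding P_def using g' g(2)[of p] p gx xs by (auto simp: g'_def h_def)
    then have ex: "\<exists>g. P xs (map f xs) g" by blast
    define k where "k = pick xs (map f xs)"
    have k: "k \<in> Iso U" "k p = p" "map k xs = map f xs" using pick[OF ex] by (auto simp: P_def k_def)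
    have sub: "set xs \<subseteq> X" "set (map f xs) \<subseteq> X" using xs CD f(1) by auto
    have kX: "k x \<in> X" "inv_into (mspace U) k x \<in> X" if "x \<in> X" for x
      using closed[OF ex that sub] by (simp_all add: k_def)
    have "k ` X = X"
    proof
      show "k ` X \<subseteq> X" using kX by blast
      show "X \<subseteq> k ` X"
      proof
        fix x assume x: "x \<in> X"
        have "k (inv_into (mspace U) k x) = x" using IsoD(3)[OF k(1)] x XM by (intro f_inv_into_f) auto
        then show "x \<in> k ` X" using kX(2)[OF x] by (metis imageI)
      qed
    qed
    then have "surj_isometry (submetric U X) (submetric U X) k"
      using IsoD(2)[OF k(1)] XM kX by (auto simp: surj_isometry_def isometric_embedding_def Int_absorb1 Int_absorb2 subset_iff)
    moreover have "\<forall>x\<in>C. k x = f x" using k(3) xs by (simp add: map_eq_conv)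
    ultimately show "\<exists>g. surj_isometry (submetric U X) (submetric U X) g \<and> (\<forall>x\<in>C. g x = f x)" by blast
  qed
  then show ?thesis using X by blast
qed

lemma surj_isometryD:
  assumes "surj_isometry m n f"
  shows "f ` mspace m = mspace n" "x \<in> mspace m \<Longrightarrow> y \<in> mspace m \<Longrightarrow> mdist n (f x) (f y) = mdist m x y"
  using assms by (auto simp: surj_isometry_def isometric_embedding_def)

lemma surj_isometryI:
  assumes "f ` mspace m = mspace n" "\<And>x y. x \<in> mspace m \<Longrightarrow> y \<in> mspace m \<Longrightarrow> mdist n (f x) (f y) = mdist m x y"
  shows "surj_isometry m n f"
  using assms by (auto simp: surj_isometry_def isometric_embedding_def)

lemma surj_isometry_comp:
  "surj_isometry m n f \<Longrightarrow> surj_isometry n k g \<Longrightarrow> surj_isometry m k (g \<circ> f)"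
  by (rule surj_isometryI) (simp only: image_comp[symmetric] surj_isometryD(1), auto simp: surj_isometry_def isometric_embedding_def Pi_iff)

lemma surj_isometry_inv:
  assumes "surj_isometry m n f"
  shows "surj_isometry n m (inv_into (mspace m) f)" "x \<in> mspace m \<Longrightarrow> inv_into (mspace m) f (f x) = x"
    "y \<in> mspace n \<Longrightarrow> f (inv_into (mspace m) f y) = y"
proof -
  have b: "bij_betw f (mspace m) (mspace n)" using assms by (rule surj_isometry_bij_betw)
  show 1: "x \<in> mspace m \<Longrightarrow> inv_into (mspace m) f (f x) = x" using b by (simp add: bij_betw_def)
  have 2: "f (inv_into (mspace m) f y) = y" "inv_into (mspace m) f y \<in> mspace m" if "y \<in> mspace n" for y
    using b that by (auto simp: bij_betw_def f_inv_into_f inv_into_into)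
  show "y \<in> mspace n \<Longrightarrow> f (inv_into (mspace m) f y) = y" by (rule 2)
  show "surj_isometry n m (inv_into (mspace m) f)"
  proof (rule surj_isometryI)
    show "inv_into (mspace m) f ` mspace n = mspace m" using bij_betw_inv_into[OF b] by (simp add: bij_betw_def)
    show "mdist m (inv_into (mspace m) f x) (inv_into (mspace m) f y) = mdist n x y" if "x \<in> mspace n" "y \<in> mspace n" for x y
      using surj_isometryD(2)[OF assms 2(2)[OF that(1)] 2(2)[OF that(2)]] 2(1) that by simp
  qed
qed

lemma surj_isometry_restrict:
  assumes "surj_isometry m n f" "A \<subseteq> mspace m"
  shows "surj_isometry (submetric m A) (submetric n (f ` A)) f"
proof -
  have "f ` A \<subseteq> mspace n" using surj_isometryD(1)[OF assms(1)] assms(2) by blast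
  then show ?thesis using surj_isometryD(2)[OF assms(1)] assms(2)
    by (intro surj_isometryI) (auto simp: Int_absorb2 subset_iff)
qed

text \<open>Homogeneity is invariant under isometry: conjugate with \<open>h\<close>.\<close>

lemma homogeneous_metric_transfer:
  assumes h: "surj_isometry m n h" and m: "homogeneous_metric m"
  shows "homogeneous_metric n"
  unfolding homogeneous_metric_def
proof (intro allI impI)
  fix A B f
  assume *: "finite A \<and> A \<subseteq> mspace n \<and> finite B \<and> B \<subseteq> mspace n \<and> surj_isometry (submetric n A) (submetric n B) f"
  define k where "k = inv_into (mspace m) h"
  note k = surj_isometry_inv[OF h, folded k_def]
  have fB: "f ` A = B" using * surj_isometryD(1)[of "submetric n A" "submetric n B" f] by (simp add: Int_absorb2)
  have kA: "k ` A \<subseteq> mspace m" "k ` B \<subseteq> mspace m" using surj_isometryD(1)[OF k(1)] * by auto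
  have hk: "h ` k ` A = A" using k(3) * by (force simp: image_image)
  have "surj_isometry (submetric m (k ` A)) (submetric n A) h"
    using surj_isometry_restrict[OF h kA(1)] by (simp add: hk)
  moreover have "surj_isometry (submetric n B) (submetric m (k ` B)) k"
    using surj_isometry_restrict[OF k(1)] * by blast
  ultimately have "surj_isometry (submetric m (k ` A)) (submetric m (k ` B)) (k \<circ> f \<circ> h)"
    using * by (intro surj_isometry_comp[of _ "submetric n A"] surj_isometry_comp[of _ "submetric n B"]) (auto simp: comp_assoc intro: surj_isometry_comp)
  then have "\<exists>g. surj_isometry m m g \<and> (\<forall>x\<in>k ` A. g x = (k \<circ> f \<circ> h) x)"
    using m[unfolded homogeneous_metric_def, rule_format, of "k ` A" "k ` B" "k \<circ> f \<circ> h"] * kA by blast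
  then obtain g where g: "surj_isometry m m g" "\<And>x. x \<in> k ` A \<Longrightarrow> g x = (k \<circ> f \<circ> h) x" by blast
  have "surj_isometry n n (h \<circ> g \<circ> k)"
    by (intro surj_isometry_comp[OF k(1)] surj_isometry_comp[OF g(1)] h)
  moreover have "(h \<circ> g \<circ> k) x = f x" if "x \<in> A" for x
  proof -
    have "x \<in> mspace n" "f x \<in> mspace n" using * fB that by auto
    then show ?thesis using g(2)[of "k x"] k(3) that by simp
  qed
  ultimately show "\<exists>g. surj_isometry n n g \<and> (\<forall>x\<in>A. g x = f x)" by blast
qed

lemma urysohn_nonempty:
  assumes "urysohn_space U"
  shows "mspace U \<noteq> {}"
proof -
  let ?P = "submetric (euclidean_metric :: real metric) {0}"
  have "polish_metric ?P" by (rule finite_polish_metric) simp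
  then obtain f where "isometric_embedding ?P U f"
    using universal_metric_embeds assms by (metis urysohn_space_def)
  then have "f 0 \<in> mspace U" by (auto simp: isometric_embedding_def)
  then show ?thesis by blast
qed

text \<open>The constant function \<open>R\<close> is a Katetov function on \<open>F\<close> once \<open>2 * R\<close> bounds the distances in \<open>F\<close>.\<close>

lemma equidistant_point:
  assumes U: "urysohn_space U" and F: "finite F" "F \<subseteq> mspace U" "F \<noteq> {}"
  obtains p R where "p \<in> mspace U" "R > 0" "\<And>x. x \<in> F \<Longrightarrow> mdist U p x = R"
proof -
  define R where "R = 1 + (\<Sum>(x, y)\<in>F \<times> F. mdist U x y)"
  have le: "mdist U x y \<le> R - 1" if "x \<in> F" "y \<in> F" for x y
    using member_le_sum[of "(x, y)" "F \<times> F" "\<lambda>(x, y). mdist U x y"] that F(1) by (auto simp: R_def)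
  have R: "R > 0" by (auto simp: R_def intro!: add_pos_nonneg sum_nonneg)
  have "R \<le> R + mdist U x y \<and> mdist U x y \<le> R + R" if "x \<in> F" "y \<in> F" for x y
    using le[OF that] mdist_nonneg[of U x y] R by linarith
  then obtain p where "p \<in> mspace U" "\<forall>x\<in>F. mdist U p x = R"
    using urysohn_one_point_extensions[OF U, unfolded one_point_extensions_def, rule_format, of F "\<lambda>_. R"] F R
    by (auto simp: mdist_commute)
  then show thesis using that R by blast
qed

text \<open>The space \<open>Z\<close> consists of copies of \<open>A\<close>, indexed by the naturals, at distance \<open>R\<close> from each other; this is a metric as distances in \<open>A\<close> are at
most \<open>2 * R\<close>. The skeleton \<open>Y\<close> is chosen to contain \<open>p\<close> and \<open>A\<close>, so that \<open>R\<close> and the distances of \<open>A\<close> belong to \<open>Q\<close>. The terms over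
\<open>Z\<close> and the space \<open>Y\<close> both carry a generic isometry and are therefore isometric, which
places the copies \<open>X k\<close> in \<open>U\<close> in such a way that every isometry of \<open>Z\<close> extends to \<open>U\<close>, multiplicatively. It remains to
recognize isometries of \<open>Z\<close>: independent isometries of the single copies, and permutations of the copies.\<close>

theorem urysohn_homogeneously_isolated:
  assumes U: "urysohn_space U" and a: "set a \<subseteq> mspace U"
  shows "homogeneously_isolated U a"
proof -
  have cU: "mcomplete_of U" and hU: "homogeneous_metric U"
    using U by (simp_all add: urysohn_space_def polish_metric_def)
  obtain x0 where x0: "x0 \<in> mspace U" using urysohn_nonempty[OF U] by blast
  obtain p R where p: "p \<in> mspace U" and R: "R > 0" and pR: "\<And>x. x \<in> insert x0 (set a) \<Longrightarrow> mdist U p x = R"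
    using equidistant_point[OF U, of "insert x0 (set a)"] a x0 by auto
  have "\<exists>X. insert x0 (set a) \<subseteq> X \<and> X \<subseteq> {x \<in> mspace U. mdist U p x = R} \<and> countable X \<and> homogeneous_metric (submetric U X)"
    by (rule homogeneous_countable_subset[OF hU p R]) (use a x0 pR in \<open>auto intro: countable_finite\<close>)
  then obtain A where A: "insert x0 (set a) \<subseteq> A" "A \<subseteq> {x \<in> mspace U. mdist U p x = R}" "countable A"
    and hA: "homogeneous_metric (submetric U A)" by auto
  have AM: "A \<subseteq> mspace U" using A(2) by blast
  have x0A: "x0 \<in> A" using A(1) by blast
  have Adist: "mdist U x y \<le> R + R" if "x \<in> A" "y \<in> A" for x y
  proof -
    have "x \<in> mspace U" "y \<in> mspace U" "mdist U p x = R" "mdist U p y = R" using A(2) that by auto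
    then show ?thesis using mdist_triangle[of x U p y] mdist_commute[of U x p] p by simp
  qed
  obtain Y Q where Y: "countable Y" "insert p A \<subseteq> Y" "dense_in U Y" and Q: "real_subgroup Q" "countable Q"
    and YQ: "Qmetric Q Y (mdist U)" "one_point_extensions Q Y (mdist U)"
    using dense_rational_subspace[OF U _ _ id_Iso, of "insert p A"] A(3) AM p by auto
  have "mdist U p x0 \<in> Q" using YQ(1) Y(2) x0A by (auto simp: Qmetric_def)
  then have RQ: "R \<in> Q" using pR by simp
  define Z where "Z = A \<times> (UNIV :: nat set)"
  define dZ where "dZ z z' = (if snd z = snd z' then mdist U (fst z) (fst z') else R)" for z z' :: "'a \<times> nat"
  have dZ: "dZ (x, k) (y, l) = (if k = l then mdist U x y else R)" for x y k l by (simp add: dZ_def)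
  have "dZ z z'' \<le> dZ z z' + dZ z' z''" if z: "z \<in> Z" "z' \<in> Z" "z'' \<in> Z" for z z' z''
    using Adist[of "fst z" "fst z''"] mdist_triangle[of "fst z" U "fst z'" "fst z''"] z AM
      mdist_nonneg[of U "fst z" "fst z'"] mdist_nonneg[of U "fst z'" "fst z''"] R
    by (auto simp: dZ_def Z_def mem_Times_iff subset_iff)
  then have mZ: "metric_on Z dZ"
    using AM R unfolding metric_on_def by (auto simp: dZ Z_def mdist_commute subset_iff)
  have "dZ z z' \<in> Q" if "z \<in> Z" "z' \<in> Z" for z z'
    using that YQ(1) Y(2) RQ by (auto simp: dZ_def Z_def Qmetric_def subset_iff)
  then have "Qmetric Q Z dZ" using mZ by (simp add: Qmetric_def)
  then interpret ts: term_space Q Z dZ using Q(1) x0A by unfold_locales (auto simp: Z_def)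
  obtain \<sigma> \<alpha> \<beta> :: "nat \<Rightarrow> nat" and w where \<sigma>: "moiety_involution UNIV \<alpha>" "moiety_involution UNIV \<beta>" "\<sigma> = \<alpha> \<circ> \<beta>"
    "\<And>m i. i < m \<Longrightarrow> \<sigma> (w m i) = w m (Suc i mod m)" "\<And>m. inj (w m)" "\<And>x. \<exists>n>0. (\<sigma> ^^ n) x = x"
    by (rule permutation_with_all_cycle_lengths) (rule that; (assumption | blast))
  have b: "bij \<sigma>" using \<sigma>(1,2,3) moiety_involution_bij bij_comp by blast
  define T :: "('a \<times> nat, nat) tm set" where "T = ts.terms"
  have gen: "generic_isometry Q T ts.dT (map_tm id \<sigma>)"
    unfolding T_def by (rule ts.generic_term_map[OF b \<sigma>(4,5,6)])
  have cT: "countable T" unfolding T_def by (rule ts.countable_terms) (use Q A(3) in \<open>auto simp: Z_def\<close>)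
  have Yne: "Y \<noteq> {}" using Y(2) by blast
  have idY: "id ` Y = Y" "isometry_on Y (mdist U) (mdist U) id" by (auto simp: isometry_on_def)
  obtain f where f: "generic_isometry Q Y (mdist U) f"
    using generic_isometry_pair[OF Q(1) YQ Y(1) Yne idY] by blast
  obtain \<theta> where \<theta>: "\<theta> ` T = Y" "isometry_on T ts.dT (mdist U) \<theta>"
    using generic_isometries_isomorphic[OF gen cT f Y(1)] by blast
  have mT: "metric_on T ts.dT" unfolding T_def by (rule QmetricD(1)[OF ts.Qmetric_terms])
  interpret dc: dense_copy U T ts.dT \<theta>
    using cU mT \<theta>(1,2) Y(3) by unfold_locales auto
  define \<iota> where "\<iota> k x = \<theta> (Pt (x, k))" for k x
  have PtT: "Pt (x, k) \<in> T" if "x \<in> A" for x k unfolding T_def using that by (intro ts.Pt_terms[THEN iffD2]) (simp add: Z_def)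
  have \<iota>d: "mdist U (\<iota> k x) (\<iota> l y) = (if k = l then mdist U x y else R)" if "x \<in> A" "y \<in> A" for k x l y
  proof -
    have "mdist U (\<iota> k x) (\<iota> l y) = ts.dT (Pt (x, k) :: ('a \<times> nat, nat) tm) (Pt (y, l))"
      using \<theta>(2) PtT that by (simp add: isometry_on_def \<iota>_def)
    also have "\<dots> = dZ (x, k) (y, l)" by (rule ts.dT_Pt) (use that in \<open>simp_all add: Z_def\<close>)
    finally show ?thesis by (simp add: dZ)
  qed
  have \<iota>M: "\<iota> k x \<in> mspace U" if "x \<in> A" for k x using dc.\<theta>M[OF PtT[OF that]] by (simp add: \<iota>_def)
  define X where "X k = \<iota> k ` A" for k
  have XM: "X k \<subseteq> mspace U" for k using \<iota>M by (auto simp: X_def)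
  have \<iota>inj: "x = y" if "x \<in> A" "y \<in> A" "\<iota> k x = \<iota> k y" for k x y
  proof -
    have "mdist U x y = 0"
      using \<iota>d[OF that(1,2), of k k] that(3) mdist_zero[OF \<iota>M[OF that(2), of k] \<iota>M[OF that(2), of k]] by simp
    moreover have "x \<in> mspace U" "y \<in> mspace U" using that(1,2) AM by auto
    ultimately show ?thesis using mdist_zero[of x U y] by simp
  qed
  have Xinj: "k = l" if "X k = X l" for k l
  proof (rule ccontr)
    assume "k \<noteq> l"
    obtain y where y: "y \<in> A" "\<iota> k x0 = \<iota> l y" using x0A \<open>X k = X l\<close> unfolding X_def by blast
    then show False using \<iota>d[OF x0A y(1), of k l] \<open>k \<noteq> l\<close> R mdist_zero[OF \<iota>M[OF y(1), of l] \<iota>M[OF y(1), of l]] by simp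
  qed
  have \<iota>iso: "surj_isometry (submetric U A) (submetric U (X k)) (\<iota> k)" for k
    using AM XM[of k] \<iota>d by (intro surj_isometryI) (auto simp: X_def Int_absorb2 subset_iff)
  have hX: "homogeneous_metric (submetric U (X k))" for k
    by (rule homogeneous_metric_transfer[OF \<iota>iso hA])
  have real: "map (\<iota> k) a \<in> realizations U (length a) (qftp U a) (X k)" for k
  proof -
    have "a ! i \<in> A" if "i < length a" for i using A(1) that nth_mem[OF that] by blast
    then show ?thesis
      unfolding realizations_qftp_iff[OF XM a] using \<iota>d A(1) by (auto simp: X_def)
  qed
  have ext: "\<exists>\<psi>\<in>Iso U. \<forall>l. \<forall>x\<in>X l. \<psi> x = \<phi> l x" if \<phi>: "\<forall>l. \<phi> l \<in> Iso (submetric U (X l))" for \<phi>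
  proof -
    have \<phi>X: "\<phi> l ` X l = X l" and \<phi>d: "\<And>x y. x \<in> X l \<Longrightarrow> y \<in> X l \<Longrightarrow> mdist U (\<phi> l x) (\<phi> l y) = mdist U x y" for l
      using IsoD(2,3)[OF \<phi>[rule_format, of l]] XM[of l] by (auto simp: Int_absorb2 subset_iff)
    have ex: "\<exists>y. y \<in> A \<and> \<iota> l y = \<phi> l (\<iota> l x)" if "x \<in> A" for l x
    proof -
      have "\<phi> l (\<iota> l x) \<in> X l" using \<phi>X[of l] that by (auto simp: X_def)
      then show ?thesis by (auto simp: X_def)
    qed
    define m where "m l x = (SOME y. y \<in> A \<and> \<iota> l y = \<phi> l (\<iota> l x))" for l x
    have m: "m l x \<in> A" "\<iota> l (m l x) = \<phi> l (\<iota> l x)" if "x \<in> A" for l x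
      using someI_ex[OF ex[OF that, of l]] by (simp_all add: m_def)
    define g where "g = (\<lambda>(x, l). (m l x, l))"
    have md: "mdist U (m l x) (m l y) = mdist U x y" if "x \<in> A" "y \<in> A" for l x y
      using \<iota>d[OF m(1)[OF that(1), of l] m(1)[OF that(2), of l], of l l] \<iota>d[OF that, of l l]
        \<phi>d[of "\<iota> l x" l "\<iota> l y"] that m(2) by (simp add: X_def)
    have gZ: "g ` Z = Z"
    proof
      show "g ` Z \<subseteq> Z" using m(1) by (auto simp: g_def Z_def)
      show "Z \<subseteq> g ` Z"
      proof
        fix z assume "z \<in> Z"
        then obtain y l where z: "z = (y, l)" "y \<in> A" by (auto simp: Z_def)
        have "\<iota> l y \<in> \<phi> l ` X l" unfolding \<phi>X using z(2) by (simp add: X_def)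
        then obtain x where x: "x \<in> A" "\<iota> l y = \<phi> l (\<iota> l x)" by (auto simp: X_def)
        then have "m l x = y" using \<iota>inj[of "m l x" y l] m z(2) by simp
        then show "z \<in> g ` Z" using x(1) z(1) by (intro image_eqI[of _ _ "(x, l)"]) (auto simp: g_def Z_def)
      qed
    qed
    have gd: "isometry_on Z dZ dZ g" using md by (auto simp: isometry_on_def g_def Z_def dZ)
    note gi = isometry_inverse[OF mZ gZ gd]
    have act: "map_tm g id ` T = T" "isometry_on T ts.dT ts.dT (map_tm g id)"
      using ts.term_action[of g "inv_into Z g" "id :: nat \<Rightarrow> nat"] gZ gd gi by (simp_all add: T_def)
    have "dc.lift (map_tm g id) x = \<phi> l x" if xl: "x \<in> X l" for l x
    proof -
      obtain y where y: "y \<in> A" "x = \<iota> l y" using xl by (auto simp: X_def)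
      have "dc.lift (map_tm g id) (\<theta> (Pt (y, l))) = \<theta> (map_tm g id (Pt (y, l)))"
        by (rule dc.lift(2)[OF act PtT[OF y(1)]])
      then show ?thesis using y m(2) by (simp add: g_def \<iota>_def)
    qed
    then show ?thesis using dc.lift(1)[OF act] by blast
  qed
  define E :: "(nat \<Rightarrow> nat) \<Rightarrow> ('a \<times> nat, nat) tm \<Rightarrow> ('a \<times> nat, nat) tm"
    where "E \<tau> = map_tm (map_prod id \<tau>) id" for \<tau>
  have E: "E \<tau> ` T = T" "isometry_on T ts.dT ts.dT (E \<tau>)" if "bij \<tau>" for \<tau>
  proof -
    have i: "inv_into UNIV \<tau> (\<tau> x) = x" "\<tau> (inv_into UNIV \<tau> x) = x" for x
      using that by (simp_all add: bij_is_inj bij_is_surj surj_f_inv_f)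
    then have c: "\<tau> x = \<tau> y \<longleftrightarrow> x = y" "inv_into UNIV \<tau> x = inv_into UNIV \<tau> y \<longleftrightarrow> x = y" for x y by metis+
    let ?g = "map_prod id \<tau> :: 'a \<times> nat \<Rightarrow> 'a \<times> nat" and ?g' = "map_prod id (inv_into UNIV \<tau>) :: 'a \<times> nat \<Rightarrow> 'a \<times> nat"
    have "?g ` Z \<subseteq> Z" "?g' ` Z \<subseteq> Z" by (auto simp: Z_def)
    moreover have "isometry_on Z dZ dZ ?g" "isometry_on Z dZ dZ ?g'" using c by (auto simp: isometry_on_def dZ)
    moreover have "?g' (?g z) = z" "?g (?g' z) = z" for z using i by (cases z; simp)+
    ultimately show "E \<tau> ` T = T" "isometry_on T ts.dT ts.dT (E \<tau>)"
      using ts.term_action[of ?g ?g' "id :: nat \<Rightarrow> nat"] unfolding E_def T_def by simp_all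
  qed
  define e where "e \<tau> = dc.lift (E \<tau>)" for \<tau>
  have carr: "carrier (BijGroup (UNIV :: nat set)) = {\<tau>. bij \<tau>}"
    by (auto simp: BijGroup_def Bij_def)
  have eX: "e \<tau> ` X k = X (\<tau> k)" if "bij \<tau>" for \<tau> k
  proof -
    have "e \<tau> (\<iota> k x) = \<iota> (\<tau> k) x" if x: "x \<in> A" for x
      using dc.lift(2)[OF E[OF \<open>bij \<tau>\<close>] PtT[OF x]] by (simp add: e_def \<iota>_def E_def)
    then show ?thesis by (simp add: X_def image_image)
  qed
  have "e \<in> hom (BijGroup UNIV) (IsoGroup U)"
  proof (rule homI)
    show "e \<tau> \<in> carrier (IsoGroup U)" if "\<tau> \<in> carrier (BijGroup UNIV)" for \<tau>
      using dc.lift(1)[OF E] that by (simp add: carr carrier_IsoGroup e_def)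
    fix \<tau> \<tau>' :: "nat \<Rightarrow> nat" assume t: "\<tau> \<in> carrier (BijGroup UNIV)" "\<tau>' \<in> carrier (BijGroup UNIV)"
    have "\<tau> \<otimes>\<^bsub>BijGroup UNIV\<^esub> \<tau>' = \<tau> \<circ> \<tau>'"
      using t by (auto simp: BijGroup_def compose_def)
    moreover have "dc.lift (E (\<tau> \<circ> \<tau>')) = dc.lift (E \<tau>) \<otimes>\<^bsub>IsoGroup U\<^esub> dc.lift (E \<tau>')"
      by (rule dc.lift_comp) (use t E in \<open>auto simp: carr E_def tm.map_comp map_prod.comp\<close>)
    ultimately show "e (\<tau> \<otimes>\<^bsub>BijGroup UNIV\<^esub> \<tau>') = e \<tau> \<otimes>\<^bsub>IsoGroup U\<^esub> e \<tau>'" by (simp add: e_def)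
  qed
  moreover have "inj_on e (carrier (BijGroup (UNIV :: nat set)))"
  proof (rule inj_onI)
    fix \<tau> \<tau>' assume t: "\<tau> \<in> carrier (BijGroup (UNIV :: nat set))" "\<tau>' \<in> carrier (BijGroup (UNIV :: nat set))" "e \<tau> = e \<tau>'"
    then have "X (\<tau> k) = X (\<tau>' k)" for k using eX[of \<tau> k] eX[of \<tau>' k] by (simp add: carr)
    then show "\<tau> = \<tau>'" using Xinj by blast
  qed
  moreover have "\<tau> k = l \<longleftrightarrow> e \<tau> ` X k = X l" if "\<tau> \<in> carrier (BijGroup UNIV)" for \<tau> k l
    using eX[of \<tau> k] that Xinj[of "\<tau> k" l] by (auto simp: carr)
  ultimately have 3: "\<exists>e \<in> hom (BijGroup (UNIV :: nat set)) (IsoGroup U). inj_on e (carrier (BijGroup (UNIV :: nat set))) \<and>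
      (\<forall>\<tau> \<in> carrier (BijGroup (UNIV :: nat set)). \<forall>k l. \<tau> k = l \<longleftrightarrow> e \<tau> ` X k = X l)"
    by blast
  show ?thesis
    unfolding homogeneously_isolated_def
  proof (intro exI[of _ X] exI[of _ "\<lambda>k. map (\<iota> k) a"] conjI)
    show "\<forall>k. X k \<subseteq> mspace U \<and> map (\<iota> k) a \<in> realizations U (length a) (qftp U a) (X k)"
      using XM real by simp
    show "\<forall>k. homogeneous_metric (submetric U (X k))" using hX by simp
    show "\<forall>\<phi>. (\<forall>l. \<phi> l \<in> Iso (submetric U (X l))) \<longrightarrow> (\<exists>\<psi>\<in>Iso U. \<forall>l. \<forall>x\<in>X l. \<psi> x = \<phi> l x)"
      by (intro allI impI) (rule ext)
  qed (rule 3)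
qed

theorem theorem9:
  fixes U :: "'a metric"
  assumes "urysohn_space U"
  shows "(\<forall>a. set a \<subseteq> mspace U \<longrightarrow> homogeneously_isolated U a) \<and>
         (\<forall>(K :: ('b, 'm) monoid_scheme) (T :: 'b topology) (\<Phi> :: ('a \<Rightarrow> 'a) \<Rightarrow> 'b).
            topological_group K T \<and> separable_space T \<and>
            (\<exists>\<rho>. mtopology_of \<rho> = T \<and> mcomplete_of \<rho> \<and> left_invariant_metric K \<rho>) \<and>
            \<Phi> \<in> hom (IsoGroup U) K \<longrightarrow>
            (\<forall>g \<in> carrier (IsoGroup U). \<Phi> g = \<one>\<^bsub>K\<^esub>))"
proof (intro conjI allI impI ballI)
  show "homogeneously_isolated U a" if "set a \<subseteq> mspace U" for a
    using assms that by (rule urysohn_homogeneously_isolated)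
  fix K :: "('b, 'm) monoid_scheme" and T :: "'b topology" and \<Phi> :: "('a \<Rightarrow> 'a) \<Rightarrow> 'b" and g
  assume *: "topological_group K T \<and> separable_space T \<and>
      (\<exists>\<rho>. mtopology_of \<rho> = T \<and> mcomplete_of \<rho> \<and> left_invariant_metric K \<rho>) \<and> \<Phi> \<in> hom (IsoGroup U) K"
    and g: "g \<in> carrier (IsoGroup U)"
  then obtain \<rho> where \<rho>: "mtopology_of \<rho> = T" "mcomplete_of \<rho>" "left_invariant_metric K \<rho>" by blast
  have K: "group K" "topspace T = carrier K" using * by (simp_all add: topological_group_def)
  have "mspace \<rho> = carrier K" using K(2) \<rho>(1) topspace_mtopology_of[of \<rho>] by simp
  then show "\<Phi> g = \<one>\<^bsub>K\<^esub>"
    using homomorphism_trivial[OF assms K(1) _ \<rho>(2) _ \<rho>(3)] * \<rho>(1) g by (simp add: carrier_IsoGroup)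
qed

end
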